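(* The worst-case time complexity of Algorithm 2 is $\mathcal O(n^2)$, where $n$ is the number of users.
   Context: MCS setting. There are $m$ tasks; performing task $k$ has value $u_k>0$ per unit time. There are $n$ users $A_1,\dots,A_n$ (set $\mathcal A$); user $A_i$ can perform exactly one task $\kappa_i$; put $\mu_i=u_{\kappa_i}$. The budget is $G>0$. User $A_i$ bids $b_i=(d_i,s_i,e_i)$ with $d_i>0$ and integers $s_i<e_i$, $T_i=[s_i,e_i]$, $e_i-s_i\le\lambda$, where $\lambda$ is a fixed integer constant. A schedule is $\vec y=(y_1,\dots,y_n)$ with $y_i\subseteq T_i$; $|\cdot|$ is total length; a time unit is an interval $[t,t+1]$, $t\in\mathbb Z$. The revenue is $R(\vec y)=\sum_{k=1}^m u_k\lfloor|\bigcup_{j:\kappa_j=k}y_j|\rfloor$. Time is measured in elementary (unit-cost arithmetic) operations. Order: $A_i\prec A_j$ iff $\mu_i/d_i<\mu_j/d_j$, or $\mu_i/d_i=\mu_j/d_j$ and $j>i$. Algorithm 1 (ApproxMCS). Start with $\mathcal D=\mathcal A$, $\mathcal W=\emptyset$, all $y_i=\emptyset$. Repeat: let $A_j$ be the $\prec$-maximum of $\mathcal D$; $Z_j=T_j\setminus\bigcup_{i:\kappa_i=\kappa_j}y_i$; $q=\min\{|Z_j|,\lfloor\frac{G}{2d_j}-\frac{R(\vec y)}{\mu_j}\rfloor\}$; if $q>0$: add $j$ to $\mathcal W$, set $y_j$ to the first (earliest) $q$ time units of $Z_j$, and remove from $\mathcal D$ all $A_i$ with $T_i\subseteq\bigcup_{\ell:\kappa_\ell=\kappa_i}y_\ell$;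 until $q<|Z_j|$ or $\mathcal D=\emptyset$. Return $\vec y$ and $\mathcal W=\{n_1,\dots,n_h\}$, indexed in order of selection. Algorithm 3 (CalPayment for $n_i\in\mathcal W$). Set $t_{n_j}=y_{n_j}$ for $1\le j\le i-1$ and all other $t_j=\emptyset$; $\mathcal S=\{j: A_j\prec A_{n_i}\}$; $p_{n_i}=d_{n_i}|y_{n_i}|$; $k=n_i$; $\theta=|\mathcal S|$. While $\theta\ge0$: (a) $\mathcal Z_1=T_{n_i}\setminus\bigcup_{\ell:\kappa_\ell=\kappa_{n_i}}t_\ell$, $\gamma_1=\frac{\mu_{n_i}}{\mu_k}d_k$, $\gamma_2=\frac{\mu_{n_i}G}{2R(\vec t)}$ ($=+\infty$ if $R(\vec t)=0$); if $\mathcal S\ne\emptyset$, let $A_j$ be the $\prec$-maximal user with index in $\mathcal S$ and replace $\gamma_2$ by $\min\{\frac{\mu_{n_i}}{\mu_j}d_j,\gamma_2\}$. (b) If $|\mathcal Z_1|>0$ and $\gamma_2\ge\gamma_1$, add $\int_{\gamma_1}^{\gamma_2}\min\{|\mathcal Z_1|,\lfloor\frac{G}{2v}-\frac{R(\vec t)}{\mu_{n_i}}\rfloor\}\,dv$ to $p_{n_i}$; otherwise exit the loop. (c) If $\mathcal S\neq\emptyset$: $\mathcal Z_2=T_j\setminus\bigcup_{\ell:\kappa_\ell=\kappa_j}t_\ell$, $q=\min\{|\mathcal Z_2|,\lfloor\frac{G}{2d_j}-\frac{R(\vec t)}{\mu_j}\rfloor\}$; if $q>0$ set $t_j$ to the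 first $q$ time units of $\mathcal Z_2$; if $q<|\mathcal Z_2|$ exit the loop; then set $k=j$, $\theta=|\mathcal S|$, and remove $j$ from $\mathcal S$. (d) $\theta\leftarrow\theta-1$. Return $p_{n_i}$. Algorithm 2 (offline mechanism). With probability $1/2$: compute $(\vec y,\mathcal W)$ by Algorithm 1, pay each $n_i\in\mathcal W$ the amount computed by Algorithm 3 and pay other users $0$. Otherwise: let $j=\arg\max_{i:d_i\le G}\mu_i$ (ties broken by a fixed index rule; nobody is selected if no $d_i\le G$), let $y_j$ be an arbitrary single time unit of $T_j$, all other $y_i=\emptyset$, $p_j=G$, all other payments $0$. *)

theory Defs
  imports
    "HOL-Probability.Probability"
    "HOL-Library.While_Combinator"
    "HOL-Library.Landau_Symbols"
begin

section \<open>The task assignment market\<close>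

text \<open>Users are numbered \<open>1..n\<close> and tasks \<open>1..m\<close>; the fields are only meaningful there.\<close>

record mcs =
  num_users :: nat
  num_tasks :: nat
  task_value :: "nat \<Rightarrow> real"
  user_task :: "nat \<Rightarrow> nat"
  budget :: real
  unit_cost :: "nat \<Rightarrow> real"
  start_time :: "nat \<Rightarrow> int"
  end_time :: "nat \<Rightarrow> int"

definition users :: "mcs \<Rightarrow> nat set" where
  "users I = {1..num_users I}"

definition valid_mcs :: "int \<Rightarrow> mcs \<Rightarrow> bool" where
  "valid_mcs lam I \<longleftrightarrow>
     num_users I \<ge> 1 \<and> budget I > 0 \<and>
     (\<forall>k\<in>{1..num_tasks I}. task_value I k > 0) \<and>
     (\<forall>i\<in>users I. user_task I i \<in> {1..num_tasks I} \<and> unit_cost I i > 0 \<and>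
        start_time I i < end_time I i \<and> end_time I i - start_time I i \<le> lam)"

definition user_value :: "mcs \<Rightarrow> nat \<Rightarrow> real" where
  "user_value I i = task_value I (user_task I i)"

definition interval :: "mcs \<Rightarrow> nat \<Rightarrow> real set" where
  "interval I i = {real_of_int (start_time I i)..real_of_int (end_time I i)}"

text \<open>A schedule maps each user to the set of points in time at which she works.\<close>

type_synonym schedule = "nat \<Rightarrow> real set"

definition len :: "real set \<Rightarrow> real" where
  "len A = measure lborel A"

definition covered :: "mcs \<Rightarrow> schedule \<Rightarrow> nat \<Rightarrow> real set" where
  "covered I y k = (\<Union>i\<in>{i \<in> users I. user_task I i = k}. y i)"

definition revenue :: "mcs \<Rightarrow> schedule \<Rightarrow> real" where
  "revenue I y =
     (\<Sum>k = 1..num_tasks I. task_value I k * real_of_int \<lfloor>len (covered I y k)\<rfloor>)"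

definition prec :: "mcs \<Rightarrow> nat \<Rightarrow> nat \<Rightarrow> bool" where
  "prec I i j \<longleftrightarrow>
     user_value I i / unit_cost I i < user_value I j / unit_cost I j \<or>
     user_value I i / unit_cost I i = user_value I j / unit_cost I j \<and> i < j"

definition prec_max :: "mcs \<Rightarrow> nat set \<Rightarrow> nat" where
  "prec_max I S = (THE j. j \<in> S \<and> (\<forall>i\<in>S - {j}. prec I i j))"

definition free_time :: "mcs \<Rightarrow> schedule \<Rightarrow> nat \<Rightarrow> real set" where
  "free_time I y j = interval I j - covered I y (user_task I j)"

definition quota :: "mcs \<Rightarrow> schedule \<Rightarrow> nat \<Rightarrow> real" where
  "quota I y j =
     min (len (free_time I y j))
       (real_of_int \<lfloor>budget I / (2 * unit_cost I j) - revenue I y / user_value I j\<rfloor>)"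

definition time_unit :: "int \<Rightarrow> real set" where
  "time_unit t = {real_of_int t..real_of_int t + 1}"

text \<open>Removing closed time units from a closed interval loses end points, so the time units of a
  difference set are recognised by their interiors.\<close>

definition units_of :: "real set \<Rightarrow> int set" where
  "units_of Z = {t. {real_of_int t<..<real_of_int t + 1} \<subseteq> Z}"

definition first_units :: "nat \<Rightarrow> real set \<Rightarrow> real set" where
  "first_units q Z = (\<Union>t\<in>set (take q (sorted_list_of_set (units_of Z))). time_unit t)"


section \<open>The mechanism\<close>

record approx_state =
  candidates :: "nat set"
  winners :: "nat list"
  sched :: schedule
  stop :: bool

definition approx_init :: "mcs \<Rightarrow> approx_state" where
  "approx_init I = \<lparr>candidates = users I, winners = [], sched = (\<lambda>_. {}), stop = False\<rparr>"

definition approx_step :: "mcs \<Rightarrow> approx_state \<Rightarrow> approx_state" where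
  "approx_step I st =
     (let j = prec_max I (candidates st);
          Z = free_time I (sched st) j;
          q = quota I (sched st) j;
          st' =
            (if q > 0 then
               let y = (sched st)(j := first_units (nat \<lfloor>q\<rfloor>) Z)
               in st\<lparr>winners := winners st @ [j], sched := y,
                     candidates :=
                       {i \<in> candidates st. \<not> interval I i \<subseteq> covered I y (user_task I i)}\<rparr>
             else st)
      in st'\<lparr>stop := q < len Z \<or> candidates st' = {}\<rparr>)"

definition approx_mcs :: "mcs \<Rightarrow> schedule \<times> nat list" where
  "approx_mcs I =
     (let st = while (\<lambda>st. \<not> stop st) (approx_step I) (approx_init I)
      in (sched st, winners st))"

record pay_state =
  psched :: schedule
  rest :: "nat set"
  pay :: real
  cur :: nat
  theta :: int
  exited :: bool

text \<open>\<open>before\<close> lists the winners selected before \<open>w\<close>.\<close>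

definition pay_init :: "mcs \<Rightarrow> schedule \<Rightarrow> nat list \<Rightarrow> nat \<Rightarrow> pay_state" where
  "pay_init I y before w =
     (let S = {j \<in> users I. prec I j w}
      in \<lparr>psched = (\<lambda>i. if i \<in> set before then y i else {}),
          rest = S, pay = unit_cost I w * len (y w), cur = w, theta = int (card S),
          exited = False\<rparr>)"

definition pay_step :: "mcs \<Rightarrow> nat \<Rightarrow> pay_state \<Rightarrow> pay_state" where
  "pay_step I w st =
     (let y = psched st;
          S = rest st;
          Z1 = free_time I y w;
          g1 = user_value I w / user_value I (cur st) * unit_cost I (cur st);
          g = (if revenue I y = 0 then \<infinity>
               else ereal (user_value I w * budget I / (2 * revenue I y)));
          j = prec_max I S;
          g2 = (if S \<noteq> {} then min (ereal (user_value I w / user_value I j * unit_cost I j)) g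
                else g)
      in if len Z1 > 0 \<and> ereal g1 \<le> g2 then
           let st' = st\<lparr>pay := pay st +
                 (LBINT v=ereal g1..g2.
                    min (len Z1)
                      (real_of_int \<lfloor>budget I / (2 * v) - revenue I y / user_value I w\<rfloor>))\<rparr>
           in if S = {} then st'\<lparr>theta := theta st - 1\<rparr>
              else
                let Z2 = free_time I y j;
                    q = quota I y j;
                    st'' = st'\<lparr>psched := (if q > 0 then y(j := first_units (nat \<lfloor>q\<rfloor>) Z2) else y)\<rparr>
                in if q < len Z2 then st''\<lparr>exited := True\<rparr>
                   else st''\<lparr>cur := j, theta := int (card S) - 1, rest := S - {j}\<rparr>
         else st\<lparr>exited := True\<rparr>)"

definition cal_payment :: "mcs \<Rightarrow> schedule \<Rightarrow> nat list \<Rightarrow> nat \<Rightarrow> real" where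
  "cal_payment I y before w =
     pay (while (\<lambda>st. \<not> exited st \<and> theta st \<ge> 0) (pay_step I w) (pay_init I y before w))"

definition fair_coin :: "bool pmf" where
  "fair_coin = bernoulli_pmf (1 / 2)"

text \<open>The pairs of schedule and payment vector that the mechanism may return, given the outcome of
  the coin. The second branch leaves the choice of the time unit open; ties for the most valuable
  user are broken in favour of the smallest index.\<close>

definition mechanism :: "mcs \<Rightarrow> bool \<Rightarrow> (schedule \<times> (nat \<Rightarrow> real)) set" where
  "mechanism I coin =
     (if coin then
        let (y, W) = approx_mcs I
        in {(y, \<lambda>i. if i \<in> set W then cal_payment I y (takeWhile (\<lambda>l. l \<noteq> i) W) i else 0)}
      else
        let E = {i \<in> users I. unit_cost I i \<le> budget I};
            j = Min {i \<in> E. \<forall>l\<in>E. user_value I l \<le> user_value I i}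
        in if E = {} then {(\<lambda>_. {}, \<lambda>_. 0)}
           else {(\<lambda>i. if i = j then time_unit t else {}, \<lambda>i. if i = j then budget I else 0) |t.
                   start_time I j \<le> t \<and> t < end_time I j})"


section \<open>Elementary operations\<close>

text \<open>
  Running time is measured on a unit-cost random access machine over the integers and the reals,
  presented as a while language; variables and arrays of the two sorts live in separate name
  spaces. Every variable or array access, constant, arithmetic operation, comparison, Boolean
  connective, conversion, assignment and test counts one step; array indices are integers.
\<close>

type_synonym vname = string

datatype iexp =
    N int
  | V vname
  | IArr vname iexp ("_.[_]\<^sub>i" [1000, 0] 1000)
  | IAdd iexp iexp (infixl "+\<^sub>i" 65)
  | ISub iexp iexp (infixl "-\<^sub>i" 65)
  | Floor rexp
and rexp =
    Real iexp
  | R vname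
  | RArr vname iexp ("_.[_]\<^sub>r" [1000, 0] 1000)
  | RAdd rexp rexp (infixl "+\<^sub>r" 65)
  | RSub rexp rexp (infixl "-\<^sub>r" 65)
  | RMul rexp rexp (infixl "*\<^sub>r" 70)
  | RDiv rexp rexp (infixl "'/\<^sub>r" 70)

datatype bexp =
    ILess iexp iexp (infix "<\<^sub>i" 50)
  | IEq iexp iexp (infix "=\<^sub>i" 50)
  | RLess rexp rexp (infix "<\<^sub>r" 50)
  | REq rexp rexp (infix "=\<^sub>r" 50)
  | BNot bexp ("NOT _" [40] 40)
  | BAnd bexp bexp (infixr "AND" 35)
  | BOr bexp bexp (infixr "OR" 30)

datatype com =
    SKIP
  | IAssign vname iexp ("_ :=\<^sub>i _" [1000, 61] 61)
  | RAssign vname rexp ("_ :=\<^sub>r _" [1000, 61] 61)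
  | IStore vname iexp iexp ("_.[_] :=\<^sub>i _" [1000, 0, 61] 61)
  | RStore vname iexp rexp ("_.[_] :=\<^sub>r _" [1000, 0, 61] 61)
  | Seq com com ("_;;/ _" [60, 61] 60)
  | Cond bexp com com ("(IF _/ THEN _/ ELSE _)" [0, 0, 61] 61)
  | Loop bexp com ("(WHILE _/ DO _)" [0, 61] 61)

record state =
  ivar :: "vname \<Rightarrow> int"
  rvar :: "vname \<Rightarrow> real"
  iarr :: "vname \<Rightarrow> int \<Rightarrow> int"
  rarr :: "vname \<Rightarrow> int \<Rightarrow> real"

primrec ival :: "iexp \<Rightarrow> state \<Rightarrow> int" and rval :: "rexp \<Rightarrow> state \<Rightarrow> real" where
  "ival (N c) s = c"
| "ival (V x) s = ivar s x"
| "ival (IArr a e) s = iarr s a (ival e s)"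
| "ival (IAdd e f) s = ival e s + ival f s"
| "ival (ISub e f) s = ival e s - ival f s"
| "ival (Floor e) s = \<lfloor>rval e s\<rfloor>"
| "rval (Real e) s = real_of_int (ival e s)"
| "rval (R x) s = rvar s x"
| "rval (RArr a e) s = rarr s a (ival e s)"
| "rval (RAdd e f) s = rval e s + rval f s"
| "rval (RSub e f) s = rval e s - rval f s"
| "rval (RMul e f) s = rval e s * rval f s"
| "rval (RDiv e f) s = rval e s / rval f s"

primrec bval :: "bexp \<Rightarrow> state \<Rightarrow> bool" where
  "bval (ILess e f) s \<longleftrightarrow> ival e s < ival f s"
| "bval (IEq e f) s \<longleftrightarrow> ival e s = ival f s"
| "bval (RLess e f) s \<longleftrightarrow> rval e s < rval f s"
| "bval (REq e f) s \<longleftrightarrow> rval e s = rval f s"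
| "bval (BNot b) s \<longleftrightarrow> \<not> bval b s"
| "bval (BAnd b c) s \<longleftrightarrow> bval b s \<and> bval c s"
| "bval (BOr b c) s \<longleftrightarrow> bval b s \<or> bval c s"

primrec icost :: "iexp \<Rightarrow> nat" and rcost :: "rexp \<Rightarrow> nat" where
  "icost (N c) = 1"
| "icost (V x) = 1"
| "icost (IArr a e) = 1 + icost e"
| "icost (IAdd e f) = 1 + icost e + icost f"
| "icost (ISub e f) = 1 + icost e + icost f"
| "icost (Floor e) = 1 + rcost e"
| "rcost (Real e) = 1 + icost e"
| "rcost (R x) = 1"
| "rcost (RArr a e) = 1 + icost e"
| "rcost (RAdd e f) = 1 + rcost e + rcost f"
| "rcost (RSub e f) = 1 + rcost e + rcost f"
| "rcost (RMul e f) = 1 + rcost e + rcost f"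
| "rcost (RDiv e f) = 1 + rcost e + rcost f"

primrec bcost :: "bexp \<Rightarrow> nat" where
  "bcost (ILess e f) = 1 + icost e + icost f"
| "bcost (IEq e f) = 1 + icost e + icost f"
| "bcost (RLess e f) = 1 + rcost e + rcost f"
| "bcost (REq e f) = 1 + rcost e + rcost f"
| "bcost (BNot b) = 1 + bcost b"
| "bcost (BAnd b c) = 1 + bcost b + bcost c"
| "bcost (BOr b c) = 1 + bcost b + bcost c"

text \<open>\<open>(c, s) \<Rightarrow> k \<Down> s'\<close>: program \<open>c\<close> started in \<open>s\<close> halts in \<open>s'\<close> after \<open>k\<close> steps.\<close>

inductive big_step_t :: "com \<times> state \<Rightarrow> nat \<Rightarrow> state \<Rightarrow> bool" ("_ \<Rightarrow> _ \<Down> _" [55, 55, 55] 55)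
where
  Skip: "(SKIP, s) \<Rightarrow> 1 \<Down> s"
| IAssign: "(IAssign x e, s) \<Rightarrow> 1 + icost e \<Down> s\<lparr>ivar := (ivar s)(x := ival e s)\<rparr>"
| RAssign: "(RAssign x e, s) \<Rightarrow> 1 + rcost e \<Down> s\<lparr>rvar := (rvar s)(x := rval e s)\<rparr>"
| IStore: "(IStore a e f, s) \<Rightarrow> 1 + icost e + icost f \<Down>
     s\<lparr>iarr := (iarr s)(a := (iarr s a)(ival e s := ival f s))\<rparr>"
| RStore: "(RStore a e f, s) \<Rightarrow> 1 + icost e + rcost f \<Down>
     s\<lparr>rarr := (rarr s)(a := (rarr s a)(ival e s := rval f s))\<rparr>"
| Seq: "(c, s) \<Rightarrow> k \<Down> s' \<Longrightarrow> (d, s') \<Rightarrow> l \<Down> s'' \<Longrightarrow> (Seq c d, s) \<Rightarrow> k + l \<Down> s''"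
| CondTrue: "bval b s \<Longrightarrow> (c, s) \<Rightarrow> k \<Down> s' \<Longrightarrow> (Cond b c d, s) \<Rightarrow> 1 + bcost b + k \<Down> s'"
| CondFalse: "\<not> bval b s \<Longrightarrow> (d, s) \<Rightarrow> k \<Down> s' \<Longrightarrow> (Cond b c d, s) \<Rightarrow> 1 + bcost b + k \<Down> s'"
| LoopFalse: "\<not> bval b s \<Longrightarrow> (Loop b c, s) \<Rightarrow> 1 + bcost b \<Down> s"
| LoopTrue: "bval b s \<Longrightarrow> (c, s) \<Rightarrow> k \<Down> s' \<Longrightarrow> (Loop b c, s') \<Rightarrow> l \<Down> s'' \<Longrightarrow>
     (Loop b c, s) \<Rightarrow> 1 + bcost b + k + l \<Down> s''"

text \<open>\<open>FOR x FROM a UNTO b DO c\<close> runs \<open>c\<close> with \<open>x = a, \<dots>, b - 1\<close>; the bound \<open>b\<close> is evaluated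
  (and charged) at every test.\<close>

definition For :: "vname \<Rightarrow> iexp \<Rightarrow> iexp \<Rightarrow> com \<Rightarrow> com"
    ("(FOR _/ FROM _/ UNTO _/ DO _)" [1000, 0, 0, 61] 61) where
  "FOR x FROM a UNTO b DO c =
     (x :=\<^sub>i a;; WHILE V x <\<^sub>i b DO (c;; x :=\<^sub>i V x +\<^sub>i N 1))"

definition When :: "bexp \<Rightarrow> com \<Rightarrow> com" ("(WHEN _/ DO _)" [0, 61] 61) where
  "WHEN b DO c = (IF b THEN c ELSE SKIP)"


section \<open>The mechanism as a program\<close>

text \<open>
  Input: \<open>n\<close>, \<open>G\<close>, the coin toss, and the arrays \<open>s\<close>, \<open>e\<close>, \<open>d\<close>, \<open>kappa\<close> (indexed by users) and \<open>u\<close>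
  (indexed by tasks). The time unit \<open>[t, t + 1]\<close> of user \<open>i\<close> is stored at position
  \<open>off[i] + (t - s[i])\<close>, so that the arrays indexed by positions are dense. Position \<open>x\<close> stands
  for the same task and time unit as position \<open>cid[x]\<close>, the first of all equivalent positions;
  \<open>occ[cid[x]]\<close> tells whether that unit of the task is covered by the current schedule. This
  makes a membership test in a union of schedules elementary.
\<close>

abbreviation (input) "start i \<equiv> ''s''.[i]\<^sub>i"
abbreviation (input) "finish i \<equiv> ''e''.[i]\<^sub>i"
abbreviation (input) "kappa i \<equiv> ''kappa''.[i]\<^sub>i"
abbreviation (input) "mu i \<equiv> ''u''.[''kappa''.[i]\<^sub>i]\<^sub>r"
abbreviation (input) "bid i \<equiv> ''d''.[i]\<^sub>r"
abbreviation (input) "pos i t \<equiv> ''off''.[i]\<^sub>i +\<^sub>i (t -\<^sub>i ''s''.[i]\<^sub>i)"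
abbreviation (input) "cell i t \<equiv> ''cid''.[''off''.[i]\<^sub>i +\<^sub>i (t -\<^sub>i ''s''.[i]\<^sub>i)]\<^sub>i"
abbreviation (input) "past_users \<equiv> V ''n'' +\<^sub>i N 1"
abbreviation (input) "past_positions \<equiv> ''off''.[V ''n'' +\<^sub>i N 1]\<^sub>i"

definition prec_test :: "iexp \<Rightarrow> iexp \<Rightarrow> bexp" where
  "prec_test i j =
     (mu i /\<^sub>r bid i <\<^sub>r mu j /\<^sub>r bid j OR (mu i /\<^sub>r bid i =\<^sub>r mu j /\<^sub>r bid j AND i <\<^sub>i j))"

definition offsets_com :: com where
  "offsets_com =
     (''off''.[N 1] :=\<^sub>i N 0;;
      FOR ''i'' FROM N 1 UNTO past_users DO
        ''off''.[V ''i'' +\<^sub>i N 1] :=\<^sub>i ''off''.[V ''i'']\<^sub>i +\<^sub>i (finish (V ''i'') -\<^sub>i start (V ''i'')))"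

definition cells_com :: com where
  "cells_com =
     (FOR ''i'' FROM N 1 UNTO past_users DO
        FOR ''t'' FROM start (V ''i'') UNTO finish (V ''i'') DO
          (''l'' :=\<^sub>i N 1;;
           WHILE NOT (kappa (V ''l'') =\<^sub>i kappa (V ''i'') AND
                      NOT (V ''t'' <\<^sub>i start (V ''l'')) AND V ''t'' <\<^sub>i finish (V ''l'')) DO
             ''l'' :=\<^sub>i V ''l'' +\<^sub>i N 1;;
           ''cid''.[pos (V ''i'') (V ''t'')] :=\<^sub>i pos (V ''l'') (V ''t'')))"

text \<open>\<open>rank[i]\<close> is the number of users above \<open>i\<close> in the order, and \<open>ord\<close> is the inverse of \<open>rank\<close>.\<close>

definition ranks_com :: com where
  "ranks_com =
     (FOR ''i'' FROM N 1 UNTO past_users DO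
        (''r'' :=\<^sub>i N 0;;
         (FOR ''j'' FROM N 1 UNTO past_users DO
            WHEN prec_test (V ''i'') (V ''j'') DO ''r'' :=\<^sub>i V ''r'' +\<^sub>i N 1);;
         ''rank''.[V ''i''] :=\<^sub>i V ''r'';;
         ''ord''.[V ''r''] :=\<^sub>i V ''i''))"

text \<open>\<open>x := |Z|\<close>, where \<open>Z\<close> is the part of the interval of user \<open>i\<close> not covered for her task.\<close>

definition count_free_com :: "vname \<Rightarrow> iexp \<Rightarrow> com" where
  "count_free_com x i =
     (x :=\<^sub>i N 0;;
      FOR ''t'' FROM start i UNTO finish i DO
        WHEN ''occ''.[cell i (V ''t'')]\<^sub>i =\<^sub>i N 0 DO x :=\<^sub>i V x +\<^sub>i N 1)"

text \<open>\<open>q := min {z, \<lfloor>G / (2 d\<^sub>j) - rev / \<mu>\<^sub>j\<rfloor>}\<close>\<close>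

definition quota_com :: "iexp \<Rightarrow> vname \<Rightarrow> com" where
  "quota_com j z =
     (''q'' :=\<^sub>i Floor (R ''G'' /\<^sub>r (Real (N 2) *\<^sub>r bid j) -\<^sub>r R ''rev'' /\<^sub>r mu j);;
      WHEN V z <\<^sub>i V ''q'' DO ''q'' :=\<^sub>i V z)"

text \<open>Gives the first \<open>q\<close> free time units to user \<open>j\<close> in schedule \<open>y\<close> and updates the revenue.\<close>

definition take_com :: "vname \<Rightarrow> iexp \<Rightarrow> com" where
  "take_com y j =
     (''c'' :=\<^sub>i N 0;;
      (FOR ''t'' FROM start j UNTO finish j DO
         WHEN (''occ''.[cell j (V ''t'')]\<^sub>i =\<^sub>i N 0 AND V ''c'' <\<^sub>i V ''q'') DO
           (''occ''.[cell j (V ''t'')] :=\<^sub>i N 1;;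
            y.[pos j (V ''t'')] :=\<^sub>i N 1;;
            ''c'' :=\<^sub>i V ''c'' +\<^sub>i N 1));;
      ''rev'' :=\<^sub>r R ''rev'' +\<^sub>r Real (V ''q'') *\<^sub>r mu j)"

definition clear_com :: "vname \<Rightarrow> com" where
  "clear_com y =
     ((FOR ''x'' FROM N 0 UNTO past_positions DO
         (''occ''.[V ''x''] :=\<^sub>i N 0;; y.[V ''x''] :=\<^sub>i N 0));;
      ''rev'' :=\<^sub>r Real (N 0))"

definition approx_com :: com where
  "approx_com =
     (clear_com ''y'';;
      (FOR ''i'' FROM N 1 UNTO past_users DO ''cand''.[V ''i''] :=\<^sub>i N 1);;
      ''ncand'' :=\<^sub>i V ''n'';;
      ''h'' :=\<^sub>i N 0;;
      ''stop'' :=\<^sub>i N 0;;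
      WHILE V ''stop'' =\<^sub>i N 0 DO
        (''j'' :=\<^sub>i N 0;;
         (FOR ''i'' FROM N 1 UNTO past_users DO
            WHEN (''cand''.[V ''i'']\<^sub>i =\<^sub>i N 1 AND
                  (V ''j'' =\<^sub>i N 0 OR prec_test (V ''j'') (V ''i''))) DO
              ''j'' :=\<^sub>i V ''i'');;
         count_free_com ''z'' (V ''j'');;
         quota_com (V ''j'') ''z'';;
         (WHEN N 0 <\<^sub>i V ''q'' DO
            (''h'' :=\<^sub>i V ''h'' +\<^sub>i N 1;;
             ''W''.[V ''h''] :=\<^sub>i V ''j'';;
             take_com ''y'' (V ''j'');;
             FOR ''i'' FROM N 1 UNTO past_users DO
               WHEN ''cand''.[V ''i'']\<^sub>i =\<^sub>i N 1 DO
                 (count_free_com ''z1'' (V ''i'');;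
                  WHEN V ''z1'' =\<^sub>i N 0 DO
                    (''cand''.[V ''i''] :=\<^sub>i N 0;; ''ncand'' :=\<^sub>i V ''ncand'' -\<^sub>i N 1))));;
         WHEN (V ''q'' <\<^sub>i V ''z'' OR V ''ncand'' =\<^sub>i N 0) DO ''stop'' :=\<^sub>i N 1))"

text \<open>
  Adds the payment integral over \<open>[g1, g2]\<close> (over \<open>[g1, \<infinity>)\<close> if \<open>inf = 1\<close>) to \<open>pay\<close>. There
  \<open>v \<le> \<mu> G / (2 rev)\<close>, so the integrand counts the \<open>a \<in> {1..z1}\<close> with
  \<open>a \<le> G / (2 v) - rev / \<mu>\<close>, that is, with \<open>v \<le> G / (2 (a + rev / \<mu>))\<close>; each of them contributes
  the length of an interval.
\<close>

definition integral_com :: "iexp \<Rightarrow> com" where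
  "integral_com w =
     (FOR ''a'' FROM N 1 UNTO V ''z1'' +\<^sub>i N 1 DO
        (''c'' :=\<^sub>r R ''G'' /\<^sub>r (Real (N 2) *\<^sub>r (Real (V ''a'') +\<^sub>r R ''rev'' /\<^sub>r mu w));;
         (WHEN (V ''inf'' =\<^sub>i N 0 AND R ''g2'' <\<^sub>r R ''c'') DO ''c'' :=\<^sub>r R ''g2'');;
         WHEN R ''g1'' <\<^sub>r R ''c'' DO ''pay'' :=\<^sub>r R ''pay'' +\<^sub>r (R ''c'' -\<^sub>r R ''g1'')))"

text \<open>
  Payment of the winner \<open>w = W[b]\<close>. The component \<open>rest\<close> of \<open>pay_state\<close> corresponds to
  \<open>{ord[r], \<dots>, ord[n - 1]}\<close> with maximum \<open>ord[r]\<close>; leaving the loop early is done by making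
  \<open>theta\<close> negative.
\<close>

definition payment_com :: com where
  "payment_com =
     (''w'' :=\<^sub>i ''W''.[V ''b'']\<^sub>i;;
      clear_com ''tt'';;
      (FOR ''l'' FROM N 1 UNTO V ''b'' DO
         (''j'' :=\<^sub>i ''W''.[V ''l'']\<^sub>i;;
          FOR ''t'' FROM start (V ''j'') UNTO finish (V ''j'') DO
            WHEN ''y''.[pos (V ''j'') (V ''t'')]\<^sub>i =\<^sub>i N 1 DO
              (''tt''.[pos (V ''j'') (V ''t'')] :=\<^sub>i N 1;;
               ''occ''.[cell (V ''j'') (V ''t'')] :=\<^sub>i N 1;;
               ''rev'' :=\<^sub>r R ''rev'' +\<^sub>r mu (V ''j''))));;
      ''c'' :=\<^sub>i N 0;;
      (FOR ''t'' FROM start (V ''w'') UNTO finish (V ''w'') DO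
         WHEN ''y''.[pos (V ''w'') (V ''t'')]\<^sub>i =\<^sub>i N 1 DO ''c'' :=\<^sub>i V ''c'' +\<^sub>i N 1);;
      ''pay'' :=\<^sub>r bid (V ''w'') *\<^sub>r Real (V ''c'');;
      ''k'' :=\<^sub>i V ''w'';;
      ''r'' :=\<^sub>i ''rank''.[V ''w'']\<^sub>i +\<^sub>i N 1;;
      ''theta'' :=\<^sub>i V ''n'' -\<^sub>i V ''r'';;
      (WHILE NOT (V ''theta'' <\<^sub>i N 0) DO
         (count_free_com ''z1'' (V ''w'');;
          ''g1'' :=\<^sub>r mu (V ''w'') /\<^sub>r mu (V ''k'') *\<^sub>r bid (V ''k'');;
          (IF R ''rev'' =\<^sub>r Real (N 0) THEN ''inf'' :=\<^sub>i N 1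
           ELSE (''inf'' :=\<^sub>i N 0;;
                 ''g2'' :=\<^sub>r mu (V ''w'') *\<^sub>r R ''G'' /\<^sub>r (Real (N 2) *\<^sub>r R ''rev'')));;
          (WHEN V ''r'' <\<^sub>i V ''n'' DO
             (''j'' :=\<^sub>i ''ord''.[V ''r'']\<^sub>i;;
              ''c'' :=\<^sub>r mu (V ''w'') /\<^sub>r mu (V ''j'') *\<^sub>r bid (V ''j'');;
              WHEN (V ''inf'' =\<^sub>i N 1 OR R ''c'' <\<^sub>r R ''g2'') DO
                (''inf'' :=\<^sub>i N 0;; ''g2'' :=\<^sub>r R ''c'')));;
          IF (N 0 <\<^sub>i V ''z1'' AND (V ''inf'' =\<^sub>i N 1 OR NOT (R ''g2'' <\<^sub>r R ''g1''))) THEN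
            (integral_com (V ''w'');;
             (WHEN V ''r'' <\<^sub>i V ''n'' DO
                (count_free_com ''z'' (V ''j'');;
                 quota_com (V ''j'') ''z'';;
                 (WHEN N 0 <\<^sub>i V ''q'' DO take_com ''tt'' (V ''j''));;
                 IF V ''q'' <\<^sub>i V ''z'' THEN ''theta'' :=\<^sub>i N 0
                 ELSE (''k'' :=\<^sub>i V ''j'';;
                       ''theta'' :=\<^sub>i V ''n'' -\<^sub>i V ''r'';;
                       ''r'' :=\<^sub>i V ''r'' +\<^sub>i N 1)));;
             ''theta'' :=\<^sub>i V ''theta'' -\<^sub>i N 1)
          ELSE ''theta'' :=\<^sub>i N (- 1)));;
      ''p''.[V ''w''] :=\<^sub>r R ''pay'')"

definition single_com :: com where
  "single_com =
     (clear_com ''y'';;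
      ''j'' :=\<^sub>i N 0;;
      (FOR ''i'' FROM N 1 UNTO past_users DO
         WHEN (NOT (R ''G'' <\<^sub>r bid (V ''i'')) AND
               (V ''j'' =\<^sub>i N 0 OR mu (V ''j'') <\<^sub>r mu (V ''i''))) DO
           ''j'' :=\<^sub>i V ''i'');;
      WHEN NOT (V ''j'' =\<^sub>i N 0) DO
        (''y''.[pos (V ''j'') (start (V ''j''))] :=\<^sub>i N 1;;
         ''p''.[V ''j''] :=\<^sub>r R ''G''))"

definition mechanism_com :: com where
  "mechanism_com =
     (offsets_com;;
      (FOR ''i'' FROM N 1 UNTO past_users DO ''p''.[V ''i''] :=\<^sub>r Real (N 0));;
      IF V ''coin'' =\<^sub>i N 1 THEN
        (cells_com;;
         ranks_com;;
         approx_com;;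
         FOR ''b'' FROM N 1 UNTO V ''h'' +\<^sub>i N 1 DO payment_com)
      ELSE single_com)"

text \<open>The initial memory is arbitrary outside the input cells.\<close>

definition loaded :: "mcs \<Rightarrow> bool \<Rightarrow> state \<Rightarrow> bool" where
  "loaded I coin st \<longleftrightarrow>
     ivar st ''n'' = int (num_users I) \<and> rvar st ''G'' = budget I \<and>
     ivar st ''coin'' = (if coin then 1 else 0) \<and>
     (\<forall>k\<in>{1..num_tasks I}. rarr st ''u'' (int k) = task_value I k) \<and>
     (\<forall>i\<in>users I.
        iarr st ''s'' (int i) = start_time I i \<and> iarr st ''e'' (int i) = end_time I i \<and>
        iarr st ''kappa'' (int i) = int (user_task I i) \<and> rarr st ''d'' (int i) = unit_cost I i)"

definition position :: "mcs \<Rightarrow> nat \<Rightarrow> int \<Rightarrow> int" where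
  "position I i t = (\<Sum>l = 1..<i. end_time I l - start_time I l) + (t - start_time I i)"

definition schedule_of :: "mcs \<Rightarrow> state \<Rightarrow> schedule" where
  "schedule_of I st i =
     (\<Union>t\<in>{t. i \<in> users I \<and> start_time I i \<le> t \<and> t < end_time I i \<and>
             iarr st ''y'' (position I i t) = 1}. time_unit t)"

definition payments_of :: "mcs \<Rightarrow> state \<Rightarrow> nat \<Rightarrow> real" where
  "payments_of I st i = (if i \<in> users I then rarr st ''p'' (int i) else 0)"

end

theory Submission
  imports Defs
begin

text \<open>
  A time unit belongs to a union of closed time units iff its interior does, so every real set
  occurring in the mechanism can be replaced by a finite set of integers: lengths become
  cardinalities, and the array \<open>occ\<close> represents the covered units of each task exactly. A state of
  the program is related to a state of the abstract algorithm, and one round of each loop preserves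
  the relation.

  In Algorithm 1 every round that does not stop exhausts the interval of its winner, who is then
  no longer a candidate; so there are at most \<open>n\<close> rounds, each with \<open>O(n)\<close> intervals of length at
  most \<open>\<lambda>\<close> to inspect. In Algorithm 3 every round that does not exit goes on to the next user in
  the order, and it inspects \<open>O(1)\<close> intervals only. The payment integral is a finite sum because
  the integrand is the number of \<open>a \<le> |Z|\<close> with \<open>v \<le> G / (2 (a + R / \<mu>))\<close>.
\<close>

section \<open>Cost-annotated execution\<close>

text \<open>The number of tasks must not enter the bound, although \<open>revenue\<close> is a sum
  over all tasks. Awarded units are always free, so an award raises the revenue by the value of one
  unit times their number, and the program keeps \<open>rev\<close> by additions. Coverage is
  likewise stored at positions of users, of which there are at most \<open>n * lam\<close>, and not
  per task. The abstract loops are \<open>while\<close> terms that come without a termination proof.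
  Each is unfolded round by round together with the loop of the program, in one induction that
  yields termination, step count and agreement at once. Quadratic cost has three sources: a linear
  search for every position, a comparison of all pairs of users, and at most \<open>n\<close> rounds
  or payments of linear cost each. The memory is arbitrary at the start, so the relations speak only
  of cells that hold input or have been written. The numerical constants are crude; lower-order
  terms are absorbed because the number of users and \<open>lam\<close> are at least 1.\<close>

text \<open>As the postcondition receives the number of steps, the equations below turn the simplifier
  into an interpreter for loop-free code that accounts for time as well.\<close>

definition runs :: "com \<Rightarrow> state \<Rightarrow> (nat \<Rightarrow> state \<Rightarrow> bool) \<Rightarrow> bool" where
  "runs c s Q \<longleftrightarrow> (\<exists>k s'. (c, s) \<Rightarrow> k \<Down> s' \<and> Q k s')"

lemma runs_mono: "runs c s P \<Longrightarrow> (\<And>k s'. P k s' \<Longrightarrow> Q k s') \<Longrightarrow> runs c s Q"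
  unfolding runs_def by blast

lemma step_iff:
  "(SKIP, s) \<Rightarrow> k \<Down> s' \<longleftrightarrow> k = 1 \<and> s' = s"
  "(IAssign x e, s) \<Rightarrow> k \<Down> s' \<longleftrightarrow> k = 1 + icost e \<and> s' = s\<lparr>ivar := (ivar s)(x := ival e s)\<rparr>"
  "(RAssign x f, s) \<Rightarrow> k \<Down> s' \<longleftrightarrow> k = 1 + rcost f \<and> s' = s\<lparr>rvar := (rvar s)(x := rval f s)\<rparr>"
  "(IStore x e e', s) \<Rightarrow> k \<Down> s' \<longleftrightarrow> k = 1 + icost e + icost e' \<and>
     s' = s\<lparr>iarr := (iarr s)(x := (iarr s x)(ival e s := ival e' s))\<rparr>"
  "(RStore x e f, s) \<Rightarrow> k \<Down> s' \<longleftrightarrow> k = 1 + icost e + rcost f \<and>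
     s' = s\<lparr>rarr := (rarr s)(x := (rarr s x)(ival e s := rval f s))\<rparr>"
  "(Seq c d, s) \<Rightarrow> k \<Down> s' \<longleftrightarrow> (\<exists>i l t. k = i + l \<and> (c, s) \<Rightarrow> i \<Down> t \<and> (d, t) \<Rightarrow> l \<Down> s')"
  "(Cond b c d, s) \<Rightarrow> k \<Down> s' \<longleftrightarrow>
     (\<exists>l. k = 1 + bcost b + l \<and> (if bval b s then (c, s) \<Rightarrow> l \<Down> s' else (d, s) \<Rightarrow> l \<Down> s'))"
  by (subst big_step_t.simps; auto)+

lemma loop_iff:
  "(Loop b c, s) \<Rightarrow> k \<Down> s' \<longleftrightarrow>
     (if bval b s then \<exists>i l t. k = 1 + bcost b + i + l \<and> (c, s) \<Rightarrow> i \<Down> t \<and> (Loop b c, t) \<Rightarrow> l \<Down> s'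
      else k = 1 + bcost b \<and> s' = s)"
  by (subst big_step_t.simps; auto)

lemma runs_simps [simp]:
  "runs SKIP s Q \<longleftrightarrow> Q 1 s"
  "runs (IAssign x e) s Q \<longleftrightarrow> Q (1 + icost e) (s\<lparr>ivar := (ivar s)(x := ival e s)\<rparr>)"
  "runs (RAssign x f) s Q \<longleftrightarrow> Q (1 + rcost f) (s\<lparr>rvar := (rvar s)(x := rval f s)\<rparr>)"
  "runs (IStore x e e') s Q \<longleftrightarrow> Q (1 + icost e + icost e')
     (s\<lparr>iarr := (iarr s)(x := (iarr s x)(ival e s := ival e' s))\<rparr>)"
  "runs (RStore x e f) s Q \<longleftrightarrow> Q (1 + icost e + rcost f)
     (s\<lparr>rarr := (rarr s)(x := (rarr s x)(ival e s := rval f s))\<rparr>)"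
  "runs (Seq c d) s Q \<longleftrightarrow> runs c s (\<lambda>k s'. runs d s' (\<lambda>l. Q (k + l)))"
  "runs (Cond b c d) s Q \<longleftrightarrow>
     (if bval b s then runs c s (\<lambda>k. Q (1 + bcost b + k)) else runs d s (\<lambda>k. Q (1 + bcost b + k)))"
  by (simp_all only: runs_def step_iff) (blast | auto)+

lemma runs_When [simp]:
  "runs (When b c) s Q \<longleftrightarrow>
     (if bval b s then runs c s (\<lambda>k. Q (1 + bcost b + k)) else Q (2 + bcost b) s)"
  by (simp add: When_def)

text \<open>One unfolding of a loop. It is applied by explicit substitution, since as a
  simplification rule it would rewrite its own right-hand side forever.\<close>

lemma runs_Loop:
  "runs (Loop b c) s Q \<longleftrightarrow>
     (if bval b s then runs c s (\<lambda>k s'. runs (Loop b c) s' (\<lambda>l. Q (1 + bcost b + k + l)))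
      else Q (1 + bcost b) s)"
  unfolding runs_def
  by (subst loop_iff) (simp; blast)

section \<open>Names that a program may write\<close>

primrec wiv :: "com \<Rightarrow> vname set" where
  "wiv SKIP = {}"
| "wiv (IAssign x e) = {x}"
| "wiv (RAssign x f) = {}"
| "wiv (IStore x e e') = {}"
| "wiv (RStore x e f) = {}"
| "wiv (Seq c d) = wiv c \<union> wiv d"
| "wiv (Cond b c d) = wiv c \<union> wiv d"
| "wiv (Loop b c) = wiv c"

primrec wrv :: "com \<Rightarrow> vname set" where
  "wrv SKIP = {}"
| "wrv (IAssign x e) = {}"
| "wrv (RAssign x f) = {x}"
| "wrv (IStore x e e') = {}"
| "wrv (RStore x e f) = {}"
| "wrv (Seq c d) = wrv c \<union> wrv d"
| "wrv (Cond b c d) = wrv c \<union> wrv d"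
| "wrv (Loop b c) = wrv c"

primrec wia :: "com \<Rightarrow> vname set" where
  "wia SKIP = {}"
| "wia (IAssign x e) = {}"
| "wia (RAssign x f) = {}"
| "wia (IStore x e e') = {x}"
| "wia (RStore x e f) = {}"
| "wia (Seq c d) = wia c \<union> wia d"
| "wia (Cond b c d) = wia c \<union> wia d"
| "wia (Loop b c) = wia c"

primrec wra :: "com \<Rightarrow> vname set" where
  "wra SKIP = {}"
| "wra (IAssign x e) = {}"
| "wra (RAssign x f) = {}"
| "wra (IStore x e e') = {}"
| "wra (RStore x e f) = {x}"
| "wra (Seq c d) = wra c \<union> wra d"
| "wra (Cond b c d) = wra c \<union> wra d"
| "wra (Loop b c) = wra c"

lemma w_For [simp]:
  "wiv (For x a b c) = insert x (wiv c)" "wrv (For x a b c) = wrv c"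
  "wia (For x a b c) = wia c" "wra (For x a b c) = wra c"
  by (auto simp: For_def)

lemma w_When [simp]:
  "wiv (When b c) = wiv c" "wrv (When b c) = wrv c"
  "wia (When b c) = wia c" "wra (When b c) = wra c"
  by (auto simp: When_def)

text \<open>\<open>wiv\<close>, \<open>wrv\<close>, \<open>wia\<close>, \<open>wra\<close> bound
  from above the integer variables, real variables, integer arrays and real arrays that are
  assigned; an array counts as a whole. Invariants then only mention what a loop changes, and
  everything else is read off the frame.\<close>

definition frame :: "com \<Rightarrow> state \<Rightarrow> state \<Rightarrow> bool" where
  "frame c s s' \<longleftrightarrow>
     (\<forall>x. x \<notin> wiv c \<longrightarrow> ivar s' x = ivar s x) \<and> (\<forall>x. x \<notin> wrv c \<longrightarrow> rvar s' x = rvar s x) \<and>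
     (\<forall>x. x \<notin> wia c \<longrightarrow> iarr s' x = iarr s x) \<and> (\<forall>x. x \<notin> wra c \<longrightarrow> rarr s' x = rarr s x)"

lemma frame_refl: "frame c s s"
  by (simp add: frame_def)

lemma frame_trans: "frame c s s' \<Longrightarrow> frame c s' s'' \<Longrightarrow> frame c s s''"
  by (simp add: frame_def)

lemma frameD:
  assumes "frame c s s'"
  shows "x \<notin> wiv c \<Longrightarrow> ivar s' x = ivar s x" "x \<notin> wrv c \<Longrightarrow> rvar s' x = rvar s x"
    "x \<notin> wia c \<Longrightarrow> iarr s' x = iarr s x" "x \<notin> wra c \<Longrightarrow> rarr s' x = rarr s x"
  using assms by (simp_all add: frame_def)

lemma big_step_frame: "(c, s) \<Rightarrow> k \<Down> s' \<Longrightarrow> frame c s s'"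
  by (induction rule: big_step_t.induct[split_format(complete)]) (simp_all add: frame_def)

lemma runs_frame: "runs c s Q \<Longrightarrow> runs c s (\<lambda>k s'. Q k s' \<and> frame c s s')"
  unfolding runs_def using big_step_frame by blast

text \<open>The form of the consequence rule used throughout: the new postcondition may rely on the
  frame of the program just executed.\<close>

lemma runs_conseq: "runs c s P \<Longrightarrow> (\<And>k s'. P k s' \<Longrightarrow> frame c s s' \<Longrightarrow> Q k s') \<Longrightarrow> runs c s Q"
  by (rule runs_mono[OF runs_frame]) auto

text \<open>For loops whose number \<open>m\<close> of rounds is known beforehand: \<open>m\<close>
  successful tests with their bodies and one failing test. The frame relates each intermediate state
  to the start of the loop, so facts about the initial memory stay out of
  \<open>Inv\<close>.\<close>

lemma runs_While:
  assumes body: "\<And>i s'. i < m \<Longrightarrow> Inv i s' \<Longrightarrow> frame c s s' \<Longrightarrow>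
      bval b s' \<and> runs c s' (\<lambda>k s''. k \<le> K \<and> Inv (Suc i) s'')"
    and stop: "\<And>s'. Inv m s' \<Longrightarrow> frame c s s' \<Longrightarrow> \<not> bval b s'"
    and init: "Inv 0 s"
  shows "runs (Loop b c) s (\<lambda>k s'. k \<le> m * (1 + bcost b + K) + (1 + bcost b) \<and> Inv m s')"
proof -
  \<comment> \<open>Generalised to a run that begins with round \<open>i\<close>, so that the number
    of remaining rounds can serve for the induction.\<close>
  have "runs (Loop b c) s' (\<lambda>k s''. k \<le> (m - i) * (1 + bcost b + K) + (1 + bcost b) \<and> Inv m s'')"
    if "i \<le> m" "Inv i s'" "frame c s s'" for i s'
    using that
  proof (induction "m - i" arbitrary: i s')
    case 0
    then have "i = m" by simp
    with 0 stop show ?case by (subst runs_Loop) simp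
  next
    case (Suc d)
    have i: "i < m" using Suc by linarith
    from body[OF i Suc.prems(2,3)] have b: "bval b s'"
      and e: "runs c s' (\<lambda>k s''. k \<le> K \<and> Inv (Suc i) s'')" by auto
    from i obtain p where p: "m - i = Suc p" "m - Suc i = p" by (metis Suc_diff_Suc)
    have "runs c s' (\<lambda>k s''. runs (Loop b c) s'' (\<lambda>l r.
        1 + bcost b + k + l \<le> (m - i) * (1 + bcost b + K) + (1 + bcost b) \<and> Inv m r))"
    proof (rule runs_conseq[OF e])
      fix k s'' assume k: "k \<le> K \<and> Inv (Suc i) s''" and "frame c s' s''"
      with Suc.prems(3) have "frame c s s''" by (blast intro: frame_trans)
      from Suc.hyps(1)[of "Suc i" s''] this k i Suc.hyps(2)
      have "runs (Loop b c) s'' (\<lambda>k r. k \<le> (m - Suc i) * (1 + bcost b + K) + (1 + bcost b) \<and> Inv m r)"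
        by simp
      then show "runs (Loop b c) s'' (\<lambda>l r.
        1 + bcost b + k + l \<le> (m - i) * (1 + bcost b + K) + (1 + bcost b) \<and> Inv m r)"
        by (rule runs_mono) (use k in \<open>simp add: p\<close>)
    qed
    with b show ?case by (subst runs_Loop) simp
  qed
  from this[of 0 s] init show ?thesis by (simp add: frame_refl)
qed

text \<open>The constant 12 covers the initial assignment, the tests and the increment. Charging the
  start-up to every one of the \<open>M \<ge> 1\<close> iterations keeps the bound a product.\<close>

lemma runs_For:
  assumes init: "Inv (ival a s) (s\<lparr>ivar := (ivar s)(x := ival a s)\<rparr>)"
    and body: "\<And>i s'. ival a s \<le> i \<Longrightarrow> i < B \<Longrightarrow> Inv i s' \<Longrightarrow> ivar s' x = i \<Longrightarrow>
       frame (For x a b c) s s' \<Longrightarrow>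
       runs c s' (\<lambda>k s''. k + (icost a + 2 * icost b + 12) \<le> K \<and> ivar s'' x = i \<and>
         Inv (i + 1) (s''\<lparr>ivar := (ivar s'')(x := i + 1)\<rparr>))"
    and B: "\<And>s'. frame (For x a b c) s s' \<Longrightarrow> ival b s' = B"
    and aB: "ival a s \<le> B" and M: "nat (B - ival a s) \<le> M" "1 \<le> M"
    and K: "icost a + 2 * icost b + 12 \<le> K"
  shows "runs (For x a b c) s (\<lambda>k s'. k \<le> M * K \<and> Inv B s' \<and> ivar s' x = B)"
proof -
  define A where "A = ival a s"
  define s0 where "s0 = s\<lparr>ivar := (ivar s)(x := A)\<rparr>"
  let ?c = "c;; x :=\<^sub>i V x +\<^sub>i N 1" and ?b = "V x <\<^sub>i b"
  define m where "m = nat (B - A)"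
  \<comment> \<open>The part of the allowance \<open>K\<close> that is left for the body
    itself.\<close>
  define K0 where "K0 = K - (icost a + 2 * icost b + 12)"
  have fr: "frame (For x a b c) s s'" if "frame ?c s0 s'" for s'
    using that by (auto simp: frame_def s0_def For_def)
  have "runs (Loop ?b ?c) s0 (\<lambda>k s'. k \<le> m * (1 + bcost ?b + (K0 + 4)) + (1 + bcost ?b) \<and>
       (Inv (A + int m) s' \<and> ivar s' x = A + int m))"
  proof (rule runs_While)
    show "Inv (A + int 0) s0 \<and> ivar s0 x = A + int 0"
      using init by (simp add: s0_def A_def)
  next
    fix s' assume "Inv (A + int m) s' \<and> ivar s' x = A + int m" "frame ?c s0 s'"
    then show "\<not> bval ?b s'" using B[OF fr] aB by (auto simp: m_def A_def)
  next
    fix i s' assume i: "i < m" and I: "Inv (A + int i) s' \<and> ivar s' x = A + int i"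
      and f: "frame ?c s0 s'"
    have lt: "A + int i < B" using i by (simp add: m_def)
    have e: "runs c s' (\<lambda>k s''. k + (icost a + 2 * icost b + 12) \<le> K \<and> ivar s'' x = A + int i \<and>
         Inv (A + int i + 1) (s''\<lparr>ivar := (ivar s'')(x := A + int i + 1)\<rparr>))"
      using I lt fr[OF f] by (intro body) (auto simp: A_def)
    have "bval ?b s'" using I B[OF fr[OF f]] lt by simp
    moreover have "runs ?c s' (\<lambda>k s''. k \<le> K0 + 4 \<and>
        Inv (A + int (Suc i)) s'' \<and> ivar s'' x = A + int (Suc i))"
      by simp (rule runs_mono[OF e], auto simp: K0_def algebra_simps)
    ultimately show "bval ?b s' \<and> runs ?c s' (\<lambda>k s''. k \<le> K0 + 4 \<and>
        Inv (A + int (Suc i)) s'' \<and> ivar s'' x = A + int (Suc i))" by blast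
  qed
  moreover have "A + int m = B" using aB by (simp add: m_def A_def)
  moreover have "1 + icost a + (m * (1 + bcost ?b + (K0 + 4)) + (1 + bcost ?b)) \<le> M * K"
  proof -
    obtain M' where M': "M = Suc M'" using M by (cases M) auto
    have K': "K = K0 + (icost a + 2 * icost b + 12)" using K by (simp add: K0_def)
    \<comment> \<open>A round costs \<open>3 + icost b\<close> for the test, at most
      \<open>K0\<close> for the body and 4 for the increment. The initial assignment and the failing
      test cost \<open>4 + icost a + icost b\<close>; the bound is thus evaluated twice in the cost
      charged to one round.\<close>
    have "m * (7 + K0 + icost b) + (4 + icost a + icost b) \<le> M * (7 + K0 + icost b) + (4 + icost a + icost b)"
      using M by (simp add: m_def A_def)
    also have "\<dots> \<le> M * (7 + K0 + icost b) + M * (4 + icost a + icost b)" using M' by simp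
    also have "\<dots> = M * (7 + K0 + icost b + (4 + icost a + icost b))" by (simp only: distrib_left)
    also have "\<dots> \<le> M * K" by (rule mult_le_mono2) (simp add: K')
    finally show ?thesis by (simp add: algebra_simps)
  qed
  ultimately show ?thesis
    by (simp add: For_def flip: A_def s0_def) (erule runs_mono, simp)
qed

section \<open>Sets of time units\<close>

definition Units :: "int set \<Rightarrow> real set" where
  "Units A = (\<Union>t\<in>A. time_unit t)"

text \<open>An interior point of a unit lies in no other closed unit and so decides membership.
  Integer points belong to two neighbouring units and decide nothing.\<close>

lemma mem_Units_open:
  assumes "real_of_int t < x" "x < real_of_int t + 1"
  shows "x \<in> Units A \<longleftrightarrow> t \<in> A"
proof -
  have "x \<in> time_unit t' \<longleftrightarrow> t' = t" for t'
    using assms by (auto simp: time_unit_def)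
  then show ?thesis by (simp add: Units_def)
qed

lemma closed_unit_eq_floor:
  assumes "x \<notin> \<int>"
  shows "real_of_int \<lfloor>x\<rfloor> < x" "x < real_of_int \<lfloor>x\<rfloor> + 1"
proof -
  have "real_of_int \<lfloor>x\<rfloor> \<noteq> x" using assms by (metis Ints_of_int)
  then show "real_of_int \<lfloor>x\<rfloor> < x" "x < real_of_int \<lfloor>x\<rfloor> + 1" by linarith+
qed

lemma mem_Units_nonint:
  assumes "x \<notin> \<int>"
  shows "x \<in> Units A \<longleftrightarrow> \<lfloor>x\<rfloor> \<in> A"
  using assms by (intro mem_Units_open closed_unit_eq_floor)

lemma mem_interval_nonint:
  assumes "x \<notin> \<int>"
  shows "x \<in> {real_of_int a..real_of_int b} \<longleftrightarrow> \<lfloor>x\<rfloor> \<in> {a..<b}"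
proof -
  have "x \<noteq> real_of_int b" using assms by auto
  then show ?thesis by (auto simp: le_floor_iff floor_less_iff)
qed

text \<open>Midpoints of units give one direction. For the other, the floor of a point names a unit
  that contains it, except at the right end \<open>b\<close>, which is covered by the unit
  \<open>b - 1\<close>; this is where \<open>a < b\<close> enters.\<close>

lemma interval_subset_Units_iff:
  assumes "a < b"
  shows "{real_of_int a..real_of_int b} \<subseteq> Units A \<longleftrightarrow> {a..<b} \<subseteq> A"
proof
  assume l: "{real_of_int a..real_of_int b} \<subseteq> Units A"
  show "{a..<b} \<subseteq> A"
  proof
    fix t assume "t \<in> {a..<b}"
    then have "real_of_int a \<le> real_of_int t" "real_of_int t + 1 \<le> real_of_int b"
      by auto
    then have "real_of_int t + 1/2 \<in> Units A" using l by auto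
    then show "t \<in> A" by (subst (asm) mem_Units_open[of t]) auto
  qed
next
  assume r: "{a..<b} \<subseteq> A"
  show "{real_of_int a..real_of_int b} \<subseteq> Units A"
  proof
    fix x assume x: "x \<in> {real_of_int a..real_of_int b}"
    show "x \<in> Units A"
    proof (cases "x = real_of_int b")
      case True
      have "b - 1 \<in> A" using r assms by auto
      then show ?thesis unfolding Units_def time_unit_def using True by (intro UN_I[of "b - 1"]) auto
    next
      case False
      then have "\<lfloor>x\<rfloor> \<in> A" using x r by (intro subsetD[OF r]) (auto simp: le_floor_iff floor_less_iff)
      then show ?thesis unfolding Units_def time_unit_def by (intro UN_I[of "\<lfloor>x\<rfloor>"]) (simp_all add: real_of_int_floor_add_one_ge)
    qed
  qed
qed

lemma units_of_interval_diff:
  "units_of ({real_of_int a..real_of_int b} - Units A) = {a..<b} - A"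
proof -
  have "{real_of_int t<..<real_of_int t + 1} \<subseteq> {real_of_int a..real_of_int b} - Units A
      \<longleftrightarrow> t \<in> {a..<b} - A" (is "?l \<longleftrightarrow> ?r") for t
  proof
    assume l: ?l
    have "real_of_int t + 1/2 \<in> {real_of_int t<..<real_of_int t + 1}" by simp
    then have m: "real_of_int t + 1/2 \<in> {real_of_int a..real_of_int b} - Units A" using l by blast
    then have "t \<notin> A" by (subst (asm) Diff_iff, subst (asm) mem_Units_open[of t]) auto
    moreover have "a \<le> t" "t < b" using m by auto
    ultimately show ?r by simp
  next
    assume r: ?r
    then have "real_of_int a \<le> real_of_int t" "real_of_int t + 1 \<le> real_of_int b"
      by auto
    with r show ?l by (auto simp: mem_Units_open[of t])
  qed
  then show ?thesis by (auto simp: units_of_def)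
qed

text \<open>The integers are countable and hence a null set, so lengths can be compared on
  non-integral points, each of which belongs to exactly one unit.\<close>

lemma len_cong:
  assumes "S \<in> sets borel" "T \<in> sets borel" "S - \<int> = T - \<int>"
  shows "len S = len T"
proof -
  have "AE x in lborel. x \<notin> (\<int> :: real set)"
    by (rule AE_I'[of "\<int>"]) (auto intro!: countable_imp_null_set_lborel simp: Ints_def)
  then show ?thesis
    unfolding len_def using assms by (intro measure_eq_AE) (auto elim!: eventually_mono)
qed

lemma borel_Units [measurable]: "Units A \<in> sets borel"
  unfolding Units_def time_unit_def by (intro sets.countable_UN'') auto

text \<open>Neighbouring closed units share an end point, so additivity is applied to the open
  units, which are disjoint and differ from the closed ones only at integers.\<close>

lemma len_Units:
  assumes "finite A"
  shows "len (Units A) = card A"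
proof -
  let ?H = "\<Union>t\<in>A. {real_of_int t<..<real_of_int t + 1}"
  have "len (Units A) = len ?H"
  proof (rule len_cong)
    show "?H \<in> sets borel" by (intro sets.countable_UN'') auto
    have "x \<in> ?H \<longleftrightarrow> \<lfloor>x\<rfloor> \<in> A" if "x \<notin> \<int>" for x
    proof -
      have "x \<in> {real_of_int t<..<real_of_int t + 1} \<longleftrightarrow> t = \<lfloor>x\<rfloor>" for t
        using closed_unit_eq_floor[OF that] by (auto simp: floor_eq_iff) linarith+
      then show ?thesis by simp
    qed
    then show "Units A - \<int> = ?H - \<int>" using mem_Units_nonint by blast
  qed simp
  also have "\<dots> = (\<Sum>t\<in>A. measure lborel {real_of_int t<..<real_of_int t + 1})"
    unfolding len_def
  proof (rule measure_UNION'[OF assms])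
    show "pairwise (\<lambda>i j. disjnt {real_of_int i<..<real_of_int i + 1} {real_of_int j<..<real_of_int j + 1}) A"
    proof (rule pairwiseI)
      fix i j :: int assume "i \<noteq> j"
      then consider "i + 1 \<le> j" | "j + 1 \<le> i" by linarith
      then show "disjnt {real_of_int i<..<real_of_int i + 1} {real_of_int j<..<real_of_int j + 1}"
        by cases (auto simp: disjnt_def)
    qed
  qed (auto simp: fmeasurable_def)
  also have "\<dots> = card A" by simp
  finally show ?thesis .
qed

lemma len_interval_diff:
  "len ({real_of_int a..real_of_int b} - Units A) = card ({a..<b} - A)"
proof -
  have "len ({real_of_int a..real_of_int b} - Units A) = len (Units ({a..<b} - A))"
    by (rule len_cong) (auto simp: mem_Units_nonint mem_interval_nonint simp del: atLeastAtMost_iff)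
  then show ?thesis by (simp add: len_Units)
qed

section \<open>The earliest units of a finite set\<close>

definition firstn :: "nat \<Rightarrow> int set \<Rightarrow> int set" where
  "firstn q F = {t \<in> F. card {u \<in> F. u < t} < q}"

text \<open>In a strictly increasing list the entry at index \<open>i\<close> has exactly
  \<open>i\<close> smaller elements. Being among the first \<open>q\<close> is therefore a condition
  on ranks, which suits a program that scans the times upwards with a counter.\<close>

lemma take_sorted_list_of_set:
  assumes "finite F"
  shows "set (take q (sorted_list_of_set F)) = firstn q F"
proof -
  let ?xs = "sorted_list_of_set F"
  have xs: "sorted_wrt (<) ?xs" "set ?xs = F" "distinct ?xs" using assms by simp_all
  have less: "?xs ! i < ?xs ! j \<longleftrightarrow> i < j" if "i < length ?xs" "j < length ?xs" for i j
    using xs(1) that by (metis linorder_neqE_nat order_less_asym sorted_wrt_nth_less)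
  have c: "card {u \<in> F. u < ?xs ! i} = i" if i: "i < length ?xs" for i
  proof -
    have "{u \<in> F. u < ?xs ! i} = (\<lambda>j. ?xs ! j) ` {..<i}"
    proof
      show "{u \<in> F. u < ?xs ! i} \<subseteq> (\<lambda>j. ?xs ! j) ` {..<i}"
      proof
        fix u assume u: "u \<in> {u \<in> F. u < ?xs ! i}"
        then obtain j where "j < length ?xs" "u = ?xs ! j" using xs(2) by (metis (no_types, lifting) in_set_conv_nth mem_Collect_eq)
        with u less[OF this(1) i] show "u \<in> (\<lambda>j. ?xs ! j) ` {..<i}" by auto
      qed
      show "(\<lambda>j. ?xs ! j) ` {..<i} \<subseteq> {u \<in> F. u < ?xs ! i}"
        using less i xs(2) by (auto simp del: sorted_list_of_set.set_sorted_key_list_of_set) 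
    qed
    moreover have "inj_on (\<lambda>j. ?xs ! j) {..<i}"
      using xs(3) i by (auto simp: inj_on_def nth_eq_iff_index_eq simp del: sorted_list_of_set.distinct_sorted_key_list_of_set)
    ultimately show ?thesis by (simp add: card_image)
  qed
  show ?thesis
  proof (intro set_eqI iffI)
    fix t assume "t \<in> set (take q ?xs)"
    then obtain i where "i < q" "i < length ?xs" "t = ?xs ! i" by (auto simp: in_set_conv_nth)
    moreover have "?xs ! i \<in> F" using \<open>i < length ?xs\<close> xs(2) nth_mem by blast
    ultimately show "t \<in> firstn q F" using c[of i] by (simp add: firstn_def)
  next
    fix t assume t: "t \<in> firstn q F"
    then obtain i where "i < length ?xs" "t = ?xs ! i" using xs(2) by (metis (no_types, lifting) firstn_def in_set_conv_nth mem_Collect_eq)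
    then have "take q ?xs ! i = t" "i < length (take q ?xs)" using t c[of i] by (simp_all add: firstn_def)
    then show "t \<in> set (take q ?xs)" by (metis nth_mem)
  qed
qed

lemma first_units_interval_diff:
  "first_units q ({real_of_int a..real_of_int b} - Units A) = Units (firstn q ({a..<b} - A))"
  by (simp add: first_units_def units_of_interval_diff take_sorted_list_of_set flip: Units_def)

lemma firstn_subset: "firstn q F \<subseteq> F"
  by (auto simp: firstn_def)

lemma card_firstn:
  assumes "finite F"
  shows "card (firstn q F) = min q (card F)"
proof -
  have "card (firstn q F) = card (set (take q (sorted_list_of_set F)))"
    using assms by (simp add: take_sorted_list_of_set)
  also have "\<dots> = min q (card F)"
    by (subst distinct_card) (simp_all add: distinct_take)
  finally show ?thesis .
qed

text \<open>Cutting off at \<open>t\<close> and taking the first \<open>q\<close> commute, since the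
  rank of an element below \<open>t\<close> depends on smaller elements only.\<close>

lemma card_firstn_below:
  assumes "finite F"
  shows "card {u \<in> firstn q F. u < t} = min q (card {u \<in> F. u < t})"
proof -
  have "{v \<in> F. v < t \<and> v < u} = {v \<in> F. v < u}" if "u < t" for u
    using that by auto
  then have "{u \<in> firstn q F. u < t} = firstn q {u \<in> F. u < t}"
    by (auto simp: firstn_def)
  then show ?thesis using assms by (simp add: card_firstn)
qed

text \<open>One step of the scan. The program compares \<open>q\<close> with the number of units
  taken so far and not with the rank of \<open>t\<close> in \<open>F\<close>; by the minimum formula
  above the two tests agree.\<close>

lemma firstn_below_Suc:
  assumes "finite F"
  shows "{u \<in> firstn q F. u < t + 1} =
    (if t \<in> F \<and> card {u \<in> firstn q F. u < t} < q then insert t {u \<in> firstn q F. u < t}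
     else {u \<in> firstn q F. u < t})"
  by (auto simp: card_firstn_below[OF assms]) (auto simp: firstn_def order.order_iff_strict zless_add1_eq)

section \<open>The market in terms of time units\<close>

definition units :: "mcs \<Rightarrow> nat \<Rightarrow> int set" where
  "units I i = {start_time I i..<end_time I i}"

definition free :: "mcs \<Rightarrow> (nat \<Rightarrow> int set) \<Rightarrow> nat \<Rightarrow> int set" where
  "free I C i = units I i - C (user_task I i)"

definition coverage :: "mcs \<Rightarrow> (nat \<Rightarrow> int set) \<Rightarrow> nat \<Rightarrow> int set" where
  "coverage I D k = (\<Union>i\<in>{i \<in> users I. user_task I i = k}. D i)"

text \<open>No floor is left, because unions of units have integral length.\<close>

definition cov_revenue :: "mcs \<Rightarrow> (nat \<Rightarrow> int set) \<Rightarrow> real" where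
  "cov_revenue I C = (\<Sum>k = 1..num_tasks I. task_value I k * real (card (C k)))"

definition cov_quota :: "mcs \<Rightarrow> (nat \<Rightarrow> int set) \<Rightarrow> nat \<Rightarrow> int" where
  "cov_quota I C i = min (int (card (free I C i)))
     \<lfloor>budget I / (2 * unit_cost I i) - cov_revenue I C / user_value I i\<rfloor>"

text \<open>Demanding the empty set outside \<open>users I\<close> makes every \<open>D i\<close>
  finite and determines the schedule as a function on all indices.\<close>

definition unit_sched :: "mcs \<Rightarrow> (nat \<Rightarrow> int set) \<Rightarrow> bool" where
  "unit_sched I D \<longleftrightarrow> (\<forall>i. D i \<subseteq> (if i \<in> users I then units I i else {}))"

lemma finite_units [simp]: "finite (units I i)"
  by (simp add: units_def)

lemma finite_free [simp]: "finite (free I C i)"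
  by (simp add: free_def)

lemma finite_users [simp]: "finite (users I)"
  by (simp add: users_def)

lemma finite_sched: "unit_sched I D \<Longrightarrow> finite (D i)"
  unfolding unit_sched_def by (metis finite.emptyI finite_subset finite_units)

lemma finite_coverage: "unit_sched I D \<Longrightarrow> finite (coverage I D k)"
  by (auto simp: coverage_def finite_sched)

lemma covered_Units: "covered I (\<lambda>i. Units (D i)) k = Units (coverage I D k)"
  by (auto simp: covered_def coverage_def Units_def)

lemma free_time_Units:
  "free_time I (\<lambda>i. Units (D i)) j =
     {real_of_int (start_time I j)..real_of_int (end_time I j)} - Units (coverage I D (user_task I j))"
  by (simp add: free_time_def interval_def covered_Units)

lemma len_free_time: "len (free_time I (\<lambda>i. Units (D i)) j) = card (free I (coverage I D) j)"
  by (simp add: free_time_Units len_interval_diff free_def units_def)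

lemma first_units_free_time:
  "first_units q (free_time I (\<lambda>i. Units (D i)) j) = Units (firstn q (free I (coverage I D) j))"
  by (simp add: free_time_Units first_units_interval_diff free_def units_def)

lemma interval_covered_iff:
  "start_time I i < end_time I i \<Longrightarrow>
     interval I i \<subseteq> covered I (\<lambda>i. Units (D i)) (user_task I i) \<longleftrightarrow> free I (coverage I D) i = {}"
  by (simp add: covered_Units interval_def interval_subset_Units_iff free_def units_def)

lemma revenue_Units:
  "unit_sched I D \<Longrightarrow> revenue I (\<lambda>i. Units (D i)) = cov_revenue I (coverage I D)"
  by (simp add: revenue_def covered_Units len_Units finite_coverage cov_revenue_def)

lemma quota_Units:
  "unit_sched I D \<Longrightarrow> quota I (\<lambda>i. Units (D i)) j = real_of_int (cov_quota I (coverage I D) j)"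
  by (simp add: quota_def len_free_time revenue_Units cov_quota_def of_int_min)

lemma Units_upd: "(\<lambda>i. Units (D i))(j := Units A) = (\<lambda>i. Units ((D(j := A)) i))"
  by (simp add: fun_eq_iff)

lemma coverage_upd:
  assumes "i \<in> users I" "D i = {}"
  shows "coverage I (D(i := A)) =
    (coverage I D)(user_task I i := coverage I D (user_task I i) \<union> A)"
  using assms by (auto simp: coverage_def fun_eq_iff split: if_splits)

lemma cov_revenue_upd:
  assumes "k \<in> {1..num_tasks I}" "finite A" "finite (C k)" "A \<inter> C k = {}"
  shows "cov_revenue I (C(k := C k \<union> A)) = cov_revenue I C + task_value I k * card A"
proof -
  have "cov_revenue I (C(k := C k \<union> A)) =
      (\<Sum>l = 1..num_tasks I. task_value I l * real (card (C l)) + (if l = k then task_value I k * card A else 0))"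
    unfolding cov_revenue_def using assms
    by (intro sum.cong) (auto simp: card_Un_disjoint Int_commute distrib_left)
  then show ?thesis using assms(1) by (simp add: sum.distrib cov_revenue_def)
qed

lemma unit_sched_upd:
  "unit_sched I D \<Longrightarrow> j \<in> users I \<Longrightarrow> A \<subseteq> units I j \<Longrightarrow> unit_sched I (D(j := A))"
  unfolding unit_sched_def fun_upd_apply by (intro allI) presburger


section \<open>The order of the users and their ranks\<close>

lemma prec_irrefl: "\<not> prec I i i"
  by (simp add: prec_def)

lemma prec_trans: "prec I i j \<Longrightarrow> prec I j k \<Longrightarrow> prec I i k"
  by (auto simp: prec_def)

lemma prec_total: "i \<noteq> j \<Longrightarrow> prec I i j \<or> prec I j i"
  by (auto simp: prec_def)

lemma prec_asym: "prec I i j \<Longrightarrow> \<not> prec I j i"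
  using prec_irrefl prec_trans by blast

lemma prec_max_eqI:
  assumes "j \<in> S" "\<And>i. i \<in> S \<Longrightarrow> i \<noteq> j \<Longrightarrow> prec I i j"
  shows "prec_max I S = j"
  unfolding prec_max_def
proof (rule the_equality)
  fix k assume "k \<in> S \<and> (\<forall>i\<in>S - {k}. prec I i k)"
  then show "k = j" using assms prec_asym by (metis Diff_iff singletonD)
qed (use assms in auto)

text \<open>Ranks are counted from the top: the greatest user has rank 0. This is the intended
  content of the array \<open>rank\<close>.\<close>

definition prio :: "mcs \<Rightarrow> nat \<Rightarrow> nat" where
  "prio I i = card {j \<in> users I. prec I i j}"

lemma prio_mono: "i \<in> users I \<Longrightarrow> prec I j i \<Longrightarrow> prio I i < prio I j"
proof -
  assume i: "i \<in> users I" "prec I j i"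
  have "i \<notin> {j \<in> users I. prec I i j}" by (simp add: prec_irrefl)
  moreover have "i \<in> {k \<in> users I. prec I j k}" using i by simp
  moreover have "{j \<in> users I. prec I i j} \<subseteq> {k \<in> users I. prec I j k}"
    using i by (blast intro: prec_trans)
  ultimately show ?thesis unfolding prio_def by (intro psubset_card_mono) (simp, blast)
qed

lemma prio_less_iff:
  assumes "i \<in> users I" "j \<in> users I"
  shows "prio I i < prio I j \<longleftrightarrow> prec I j i"
  using assms prio_mono prec_total[of i j I] by (metis order_less_asym order_less_irrefl)

lemma prio_inj: "inj_on (prio I) (users I)"
  by (rule inj_onI) (metis prec_total prio_less_iff order_less_irrefl)

lemma prio_less_num_users:
  assumes "i \<in> users I"
  shows "prio I i < num_users I"
proof -
  have "i \<notin> {j \<in> users I. prec I i j}" by (simp add: prec_irrefl)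
  then have "prio I i < card (users I)"
    unfolding prio_def using assms by (intro psubset_card_mono) auto
  then show ?thesis by (simp add: users_def)
qed

text \<open>An injection into a set of the same size is onto. Hence the array \<open>ord\<close>,
  which is filled at the ranks of the users, has no gaps.\<close>

lemma prio_bij: "bij_betw (prio I) (users I) {..<num_users I}"
  unfolding bij_betw_def
proof
  show "prio I ` users I = {..<num_users I}"
    by (rule card_subset_eq) (auto simp: prio_less_num_users card_image prio_inj, simp add: users_def)
qed (rule prio_inj)

lemma ex_prio: "r < num_users I \<Longrightarrow> \<exists>j\<in>users I. prio I j = r"
  using bij_betw_imp_surj_on[OF prio_bij[of I]] by (metis imageE lessThan_iff)

text \<open>The users still to be examined for a payment always form such a set: at first all users
  below the winner, then one less, namely without the maximum, after each round that goes on. A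
  single index represents the set, and its size gives \<open>theta\<close>.\<close>

definition tail :: "mcs \<Rightarrow> nat \<Rightarrow> nat set" where
  "tail I r = {j \<in> users I. r \<le> prio I j}"

lemma card_tail: "card (tail I r) = num_users I - r"
proof -
  have "bij_betw (prio I) (tail I r) {r..<num_users I}"
    using prio_bij[of I] unfolding bij_betw_def tail_def
    by (auto simp: inj_on_def image_iff prio_less_num_users) (metis ex_prio)
  then show ?thesis by (simp add: bij_betw_same_card)
qed

lemma below_eq_tail: "w \<in> users I \<Longrightarrow> {j \<in> users I. prec I j w} = tail I (prio I w + 1)"
  by (auto simp: tail_def prio_less_iff Suc_le_eq)

lemma prec_max_tail: "j \<in> users I \<Longrightarrow> prec_max I (tail I (prio I j)) = j"
  by (rule prec_max_eqI)
     (auto simp: tail_def prio_less_iff[symmetric] order.order_iff_strict dest: inj_onD[OF prio_inj])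

lemma tail_remove: "j \<in> users I \<Longrightarrow> tail I (prio I j) - {j} = tail I (prio I j + 1)"
  by (auto simp: tail_def order.order_iff_strict Suc_le_eq dest: inj_onD[OF prio_inj])

lemma tail_empty_iff: "tail I r = {} \<longleftrightarrow> num_users I \<le> r"
proof -
  have "finite (tail I r)" by (simp add: tail_def)
  then have "tail I r = {} \<longleftrightarrow> card (tail I r) = 0" by simp
  then show ?thesis by (simp add: card_tail)
qed


section \<open>Array positions of time units\<close>

definition offset :: "mcs \<Rightarrow> nat \<Rightarrow> int" where
  "offset I i = (\<Sum>l = 1..<i. end_time I l - start_time I l)"

lemma position_offset: "position I i t = offset I i + (t - start_time I i)"
  by (simp add: position_def offset_def)

lemma offset_Suc: "1 \<le> i \<Longrightarrow> offset I (Suc i) = offset I i + (end_time I i - start_time I i)"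
  by (simp add: offset_def)

definition first_user :: "mcs \<Rightarrow> nat \<Rightarrow> int \<Rightarrow> nat" where
  "first_user I i t = (LEAST l. l \<in> users I \<and> user_task I l = user_task I i \<and> t \<in> units I l)"

text \<open>The intended value of \<open>cid\<close> at position \<open>position I i t\<close>.\<close>

definition canon :: "mcs \<Rightarrow> nat \<Rightarrow> int \<Rightarrow> int" where
  "canon I i t = position I (first_user I i t) t"

lemma first_user:
  assumes "i \<in> users I" "t \<in> units I i"
  shows "first_user I i t \<in> users I" "user_task I (first_user I i t) = user_task I i"
    "t \<in> units I (first_user I i t)" "first_user I i t \<le> i"
proof -
  let ?P = "\<lambda>l. l \<in> users I \<and> user_task I l = user_task I i \<and> t \<in> units I l"
  have "?P i" using assms by simp
  then have "?P (first_user I i t)" unfolding first_user_def by (rule LeastI)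
  then show "first_user I i t \<in> users I" "user_task I (first_user I i t) = user_task I i"
    "t \<in> units I (first_user I i t)" by auto
  show "first_user I i t \<le> i" unfolding first_user_def by (rule Least_le) fact
qed

section \<open>Consequences of validity\<close>

locale market =
  fixes lam :: int and I :: mcs
  assumes valid: "valid_mcs lam I"
begin

lemma num_users_pos: "1 \<le> num_users I" and budget_pos: "0 < budget I"
  using valid by (auto simp: valid_mcs_def)

lemma user_valid:
  assumes "i \<in> users I"
  shows "user_task I i \<in> {1..num_tasks I}" "0 < unit_cost I i" "start_time I i < end_time I i"
    "end_time I i - start_time I i \<le> lam" "0 < user_value I i"
  using valid assms by (auto simp: valid_mcs_def user_value_def)

lemma lam_pos: "1 \<le> lam"
proof -
  have "1 \<in> users I" using num_users_pos by (simp add: users_def)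
  from user_valid(3,4)[OF this] show ?thesis by linarith
qed

lemma offset_mono:
  assumes "1 \<le> i" "i \<le> j" "j \<le> num_users I + 1"
  shows "offset I i \<le> offset I j"
  using assms(2,3)
proof (induction j rule: dec_induct)
  case (step k)
  have "k \<in> users I" using step assms(1) by (auto simp: users_def)
  then show ?case using step user_valid(3)[of k] assms(1) by (simp add: offset_Suc)
qed simp

lemma position_bounds:
  assumes "i \<in> users I" "t \<in> units I i"
  shows "offset I i \<le> position I i t" "position I i t < offset I (Suc i)"
    "0 \<le> position I i t" "position I i t < offset I (num_users I + 1)"
proof -
  have i: "1 \<le> i" "i \<le> num_users I" using assms by (auto simp: users_def)
  show 1: "offset I i \<le> position I i t" "position I i t < offset I (Suc i)"
    using assms i by (auto simp: position_offset offset_Suc units_def)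
  have "offset I 1 \<le> offset I i" "offset I (Suc i) \<le> offset I (num_users I + 1)"
    using i by (auto intro!: offset_mono)
  moreover have "offset I 1 = 0" by (simp add: offset_def)
  ultimately show "0 \<le> position I i t" "position I i t < offset I (num_users I + 1)"
    using 1 by auto
qed

text \<open>User \<open>i\<close> owns the block of positions from \<open>offset I i\<close> up to
  but excluding \<open>offset I (Suc i)\<close>. Blocks of different users are disjoint by
  monotonicity of the offsets.\<close>

lemma position_eq_iff:
  assumes "i \<in> users I" "t \<in> units I i" "j \<in> users I" "t' \<in> units I j"
  shows "position I i t = position I j t' \<longleftrightarrow> i = j \<and> t = t'"
proof -
  have "i = j" if eq: "position I i t = position I j t'"
  proof (rule ccontr)
    have ij: "1 \<le> i" "i \<le> num_users I" "1 \<le> j" "j \<le> num_users I"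
      using assms by (auto simp: users_def)
    assume "i \<noteq> j"
    then consider "Suc i \<le> j" | "Suc j \<le> i" by linarith
    then show False
    proof cases
      case 1
      then have "offset I (Suc i) \<le> offset I j" using ij by (intro offset_mono) auto
      then show False using position_bounds(2)[OF assms(1,2)] position_bounds(1)[OF assms(3,4)] eq by simp
    next
      case 2
      then have "offset I (Suc j) \<le> offset I i" using ij by (intro offset_mono) auto
      then show False using position_bounds(1)[OF assms(1,2)] position_bounds(2)[OF assms(3,4)] eq by simp
    qed
  qed
  then show ?thesis by (auto simp: position_offset)
qed

text \<open>Each block has length at most \<open>lam\<close>; this keeps a pass over all positions
  linear in the number of users.\<close>

lemma offset_le: "i \<le> num_users I \<Longrightarrow> offset I (Suc i) \<le> int i * lam"
proof (induction i)
  case (Suc i)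
  then show ?case using user_valid(4)[of "Suc i"]
    by (simp add: offset_Suc users_def algebra_simps)
qed (simp add: offset_def)

text \<open>\<open>first_user\<close> depends on the user through her task only, so equivalent
  positions share a cell; conversely a cell is a position and reveals the task and the time. One
  write to \<open>occ\<close> thus marks a unit for all users of the task and for nobody
  else.\<close>

lemma canon_eq_iff:
  assumes "i \<in> users I" "t \<in> units I i" "j \<in> users I" "t' \<in> units I j"
  shows "canon I i t = canon I j t' \<longleftrightarrow> user_task I i = user_task I j \<and> t = t'"
proof
  assume "canon I i t = canon I j t'"
  then have "first_user I i t = first_user I j t' \<and> t = t'"
    unfolding canon_def by (subst (asm) position_eq_iff) (use assms first_user in auto)
  then show "user_task I i = user_task I j \<and> t = t'"
    using first_user(2)[OF assms(1,2)] first_user(2)[OF assms(3,4)] by metis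
next
  assume "user_task I i = user_task I j \<and> t = t'"
  then show "canon I i t = canon I j t'" by (simp add: canon_def first_user_def)
qed

lemma canon_bounds:
  assumes "i \<in> users I" "t \<in> units I i"
  shows "0 \<le> canon I i t" "canon I i t < offset I (num_users I + 1)"
  unfolding canon_def using first_user[OF assms] position_bounds by blast+

lemma cov_revenue_nonneg: "0 \<le> cov_revenue I C"
  unfolding cov_revenue_def using valid
  by (intro sum_nonneg mult_nonneg_nonneg) (auto simp: valid_mcs_def intro: less_imp_le)

end


section \<open>The payment integral as a finite sum\<close>

definition clip :: "ereal \<Rightarrow> real \<Rightarrow> real" where
  "clip g c = (if g < ereal c then real_of_ereal g else c)"

text \<open>Both sides count the \<open>a \<in> {1..z}\<close> with \<open>real a \<le> x\<close>,
  which slices the integrand into layers. A negative \<open>x\<close> would make the left side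
  negative but the sum 0, hence the assumption.\<close>

lemma min_floor_eq_sum:
  assumes "0 \<le> x"
  shows "min (real z) (real_of_int \<lfloor>x\<rfloor>) = (\<Sum>a = 1..z. of_bool (real a \<le> x))"
proof -
  have "(\<Sum>a = 1..z. of_bool (real a \<le> x) :: real) = real (card {a \<in> {1..z}. real a \<le> x})"
    by (simp add: of_bool_def sum.If_cases Int_def)
  also have "{a \<in> {1..z}. real a \<le> x} = {1..min z (nat \<lfloor>x\<rfloor>)}"
    using assms by (auto simp: le_nat_floor le_nat_iff le_floor_iff)
  finally show ?thesis using assms by (simp add: of_nat_min)
qed

text \<open>The slice ends at the smaller of \<open>g2\<close> and \<open>c\<close>. It is open
  there if \<open>g2\<close> cuts it off and closed if \<open>c\<close> does, which has no effect on
  the length; the maximum with 0 accounts for an empty slice.\<close>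

lemma measure_payment_slice:
  assumes "ereal g1 \<le> g2"
  shows "measure lborel (einterval (ereal g1) g2 \<inter> {..c}) = max 0 (clip g2 c - g1)"
    and "emeasure lborel (einterval (ereal g1) g2 \<inter> {..c}) < \<infinity>"
proof -
  have m: "measure lborel S = max 0 (d - g1) \<and> emeasure lborel S < \<infinity>"
    if "S = {g1<..<d} \<or> S = {g1<..d}" for S d
    using that by (cases "g1 \<le> d") auto
  have "(einterval (ereal g1) g2 \<inter> {..c} = {g1<..<clip g2 c}) \<or>
      einterval (ereal g1) g2 \<inter> {..c} = {g1<..clip g2 c}"
    using assms by (cases g2) (auto simp: einterval_def clip_def)
  from m[OF this] show "measure lborel (einterval (ereal g1) g2 \<inter> {..c}) = max 0 (clip g2 c - g1)"
    "emeasure lborel (einterval (ereal g1) g2 \<inter> {..c}) < \<infinity>" by auto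
qed

text \<open>The last assumption keeps the argument of the floor nonnegative on the whole range, so
  the integrand splits into layers. Layer \<open>a\<close> is the indicator of the points up to
  \<open>G / (2 * (a + R / mu))\<close>, and sum and integral are exchanged.\<close>

lemma payment_integral:
  fixes mu G R g1 :: real and g2 :: ereal
  assumes "0 < mu" "0 < G" "0 \<le> R" "0 < g1" "ereal g1 \<le> g2"
    and "R \<noteq> 0 \<Longrightarrow> g2 \<le> ereal (mu * G / (2 * R))"
  shows "(LBINT v=ereal g1..g2. min (real z) (real_of_int \<lfloor>G / (2 * v) - R / mu\<rfloor>)) =
    (\<Sum>a = 1..z. max 0 (clip g2 (G / (2 * (real a + R / mu))) - g1))"
proof -
  let ?S = "einterval (ereal g1) g2" and ?c = "\<lambda>a. G / (2 * (real a + R / mu))"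
  have *: "indicator ?S v *\<^sub>R min (real z) (real_of_int \<lfloor>G / (2 * v) - R / mu\<rfloor>) =
      (\<Sum>a = 1..z. indicator (?S \<inter> {..?c a}) v :: real)" for v
  proof (cases "v \<in> ?S")
    case True
    then have v: "g1 < v" "ereal v < g2" by (auto simp: einterval_def)
    then have "0 < v" using assms by simp
    have "R / mu \<le> G / (2 * v)"
    proof (cases "R = 0")
      case False
      then have "ereal v < ereal (mu * G / (2 * R))" using assms(6) v by (meson less_le_trans)
      then show ?thesis using \<open>0 < v\<close> assms False by (simp add: field_simps)
    qed (use assms \<open>0 < v\<close> in auto)
    then have "min (real z) (real_of_int \<lfloor>G / (2 * v) - R / mu\<rfloor>) =
        (\<Sum>a = 1..z. of_bool (real a \<le> G / (2 * v) - R / mu))"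
      by (intro min_floor_eq_sum) simp
    also have "\<dots> = (\<Sum>a = 1..z. of_bool (v \<le> ?c a))"
    proof (rule sum.cong)
      fix a assume "a \<in> {1..z}"
      then have "0 < real a + R / mu" using assms by (auto intro: add_pos_nonneg)
      moreover have "k \<le> G / (2 * v) \<longleftrightarrow> v \<le> G / (2 * k)" if "0 < k" for k
        using \<open>0 < v\<close> that by (simp add: field_simps)
      ultimately have "real a + R / mu \<le> G / (2 * v) \<longleftrightarrow> v \<le> ?c a" by blast
      then show "of_bool (real a \<le> G / (2 * v) - R / mu) = (of_bool (v \<le> ?c a) :: real)"
        by (simp add: le_diff_eq)
    qed simp
    finally show ?thesis using True by (simp add: indicator_def)
  qed simp
  have "(LBINT v=ereal g1..g2. min (real z) (real_of_int \<lfloor>G / (2 * v) - R / mu\<rfloor>)) =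
      (LINT v|lborel. (\<Sum>a = 1..z. indicator (?S \<inter> {..?c a}) v))"
    unfolding interval_lebesgue_integral_def set_lebesgue_integral_def * using assms(5) by simp
  \<comment> \<open>Every layer has finite measure even for \<open>g2 = \<infinity>\<close>, because
    it is cut off at \<open>?c a\<close>.\<close>
  also have "\<dots> = (\<Sum>a = 1..z. (LINT v|lborel. indicator (?S \<inter> {..?c a}) v))"
    by (rule Bochner_Integration.integral_sum)
       (auto intro!: integrable_real_indicator measure_payment_slice(2)[OF assms(5), unfolded infinity_ennreal_def])
  also have "\<dots> = (\<Sum>a = 1..z. max 0 (clip g2 (?c a) - g1))"
    by (simp add: measure_payment_slice(1)[OF assms(5)])
  finally show ?thesis .
qed

section \<open>The elementary subprograms\<close>

text \<open>These predicates take the contents of the arrays instead of the state, so that rewriting with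
  the equations of a frame carries them over to a later state.\<close>

definition input_ok :: "mcs \<Rightarrow> int \<Rightarrow> real \<Rightarrow> (int \<Rightarrow> real) \<Rightarrow> (int \<Rightarrow> real) \<Rightarrow> (int \<Rightarrow> int) \<Rightarrow>
    (int \<Rightarrow> int) \<Rightarrow> (int \<Rightarrow> int) \<Rightarrow> bool" where
  "input_ok I n G u d s e ka \<longleftrightarrow> n = int (num_users I) \<and> G = budget I \<and>
     (\<forall>k\<in>{1..num_tasks I}. u (int k) = task_value I k) \<and>
     (\<forall>i\<in>users I. s (int i) = start_time I i \<and> e (int i) = end_time I i \<and>
        ka (int i) = int (user_task I i) \<and> d (int i) = unit_cost I i)"

definition off_ok :: "mcs \<Rightarrow> (int \<Rightarrow> int) \<Rightarrow> bool" where
  "off_ok I a \<longleftrightarrow> (\<forall>i\<in>{1..num_users I + 1}. a (int i) = offset I i)"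

definition cid_ok :: "mcs \<Rightarrow> (int \<Rightarrow> int) \<Rightarrow> bool" where
  "cid_ok I a \<longleftrightarrow> (\<forall>i\<in>users I. \<forall>t\<in>units I i. a (position I i t) = canon I i t)"

definition prio_ok :: "mcs \<Rightarrow> (int \<Rightarrow> int) \<Rightarrow> (int \<Rightarrow> int) \<Rightarrow> bool" where
  "prio_ok I rk od \<longleftrightarrow>
     (\<forall>i\<in>users I. rk (int i) = int (prio I i) \<and> od (int (prio I i)) = int i)"

text \<open>Only canonical cells are constrained, and the program reads no others.\<close>

definition occ_ok :: "mcs \<Rightarrow> (nat \<Rightarrow> int set) \<Rightarrow> (int \<Rightarrow> int) \<Rightarrow> bool" where
  "occ_ok I C a \<longleftrightarrow>
     (\<forall>i\<in>users I. \<forall>t\<in>units I i. a (canon I i t) = of_bool (t \<in> C (user_task I i)))"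

definition marks_ok :: "mcs \<Rightarrow> (nat \<Rightarrow> int set) \<Rightarrow> (int \<Rightarrow> int) \<Rightarrow> bool" where
  "marks_ok I D a \<longleftrightarrow> (\<forall>i\<in>users I. \<forall>t\<in>units I i. a (position I i t) = of_bool (t \<in> D i))"

abbreviation inputs :: "mcs \<Rightarrow> state \<Rightarrow> bool" where
  "inputs I s \<equiv> input_ok I (ivar s ''n'') (rvar s ''G'') (rarr s ''u'') (rarr s ''d'')
     (iarr s ''s'') (iarr s ''e'') (iarr s ''kappa'')"

abbreviation env :: "mcs \<Rightarrow> state \<Rightarrow> bool" where
  "env I s \<equiv> inputs I s \<and> off_ok I (iarr s ''off'') \<and> cid_ok I (iarr s ''cid'') \<and>
     prio_ok I (iarr s ''rank'') (iarr s ''ord'')"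

context market
begin

abbreviation la :: nat where "la \<equiv> nat lam"
abbreviation nu :: nat where "nu \<equiv> num_users I"

lemma la_pos: "1 \<le> la"
  using lam_pos by simp

lemma inputsD:
  assumes "input_ok I n G u d s e ka"
  shows "n = int nu" "G = budget I"
    "i \<in> users I \<Longrightarrow> s (int i) = start_time I i" "i \<in> users I \<Longrightarrow> e (int i) = end_time I i"
    "i \<in> users I \<Longrightarrow> d (int i) = unit_cost I i"
    "i \<in> users I \<Longrightarrow> ka (int i) = int (user_task I i)"
    "i \<in> users I \<Longrightarrow> u (int (user_task I i)) = user_value I i"
  using assms user_valid(1)[of i] by (auto simp: input_ok_def user_value_def)

lemma off_okD:
  assumes "off_ok I a"
  shows "i \<in> users I \<Longrightarrow> a (int i) = offset I i" "a (int nu + 1) = offset I (nu + 1)"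
proof -
  show "a (int i) = offset I i" if "i \<in> users I"
    using assms that by (auto simp: off_ok_def users_def)
  have "nu + 1 \<in> {1..nu + 1}" by simp
  then have "a (int (nu + 1)) = offset I (nu + 1)" using assms unfolding off_ok_def by blast
  then show "a (int nu + 1) = offset I (nu + 1)" by (simp add: add.commute)
qed

lemma cid_okD: "cid_ok I a \<Longrightarrow> i \<in> users I \<Longrightarrow> t \<in> units I i \<Longrightarrow>
    a (offset I i + (t - start_time I i)) = canon I i t"
  by (simp add: cid_ok_def position_offset)

lemma prio_okD:
  assumes "prio_ok I rk od" "i \<in> users I"
  shows "rk (int i) = int (prio I i)" "od (int (prio I i)) = int i"
  using assms by (simp_all add: prio_ok_def)

lemma occ_okD: "occ_ok I C a \<Longrightarrow> i \<in> users I \<Longrightarrow> t \<in> units I i \<Longrightarrow>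
    a (canon I i t) = of_bool (t \<in> C (user_task I i))"
  by (simp add: occ_ok_def)

lemma occ_ok_insert:
  assumes "occ_ok I C a" "i \<in> users I" "t \<in> units I i"
  shows "occ_ok I (C(user_task I i := insert t (C (user_task I i)))) (a(canon I i t := 1))"
  using assms unfolding occ_ok_def by (auto simp: canon_eq_iff)

text \<open>Marks are set and never withdrawn by an award, so the user must have held nothing
  before. Positions of other users lie outside the image.\<close>

lemma marks_ok_upd:
  assumes "marks_ok I D a" "i \<in> users I" "A \<subseteq> units I i" "D i = {}"
  shows "marks_ok I (D(i := A)) (\<lambda>x. if x \<in> position I i ` A then 1 else a x)"
  unfolding marks_ok_def
proof (intro ballI)
  fix j t assume j: "j \<in> users I" "t \<in> units I j"
  have "position I j t \<in> position I i ` A \<longleftrightarrow> j = i \<and> t \<in> A"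
    using position_eq_iff[OF j assms(2)] assms(3) by (auto simp: image_iff)
  then show "(if position I j t \<in> position I i ` A then 1 else a (position I j t)) =
      of_bool (t \<in> (D(i := A)) j)"
    using assms j by (auto simp: marks_ok_def)
qed

lemma bval_prec_test:
  assumes "inputs I s" "i \<in> users I" "j \<in> users I" "ivar s v = int i" "ivar s w = int j"
  shows "bval (prec_test (V v) (V w)) s \<longleftrightarrow> prec I i j"
  using inputsD[OF assms(1)] assms(2-) by (simp add: prec_test_def prec_def)

lemma bcost_prec_test: "bcost (prec_test (V v) (V w)) = 31"
  by (simp add: prec_test_def)

lemma wiv_count_free [simp]:
  "wiv (count_free_com x i) = {x, ''t''}" "wrv (count_free_com x i) = {}"
  "wia (count_free_com x i) = {}" "wra (count_free_com x i) = {}"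
  by (auto simp: count_free_com_def)

lemma int_of_user:
  assumes "1 \<le> i" "i < int nu + 1"
  obtains j where "j \<in> users I" "i = int j"
  using assms by (intro that[of "nat i"]) (auto simp: users_def)

text \<open>The invariant counts the free units before \<open>t\<close>. The variable
  \<open>v\<close> that names the user must survive the loop, which writes \<open>x\<close> and
  \<open>t\<close> only.\<close>

lemma runs_count_free:
  assumes E: "env I s" and i: "i \<in> users I" "ivar s v = int i"
    and v: "v \<noteq> x" "v \<noteq> ''t''" "x \<noteq> ''t''" and O: "occ_ok I C (iarr s ''occ'')"
  shows "runs (count_free_com x (V v)) s (\<lambda>k s'. k \<le> 50 * la \<and> ivar s' x = int (card (free I C i)))"
proof -
  let ?F = "free I C i"
  note [simp] = inputsD[OF conjunct1[OF E]] off_okD[OF conjunct1[OF conjunct2[OF E]]]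
    cid_okD[OF conjunct1[OF conjunct2[OF conjunct2[OF E]]]] occ_okD[OF O] i
  have st: "start_time I i < end_time I i" "nat (end_time I i - start_time I i) \<le> la"
    using user_valid[OF i(1)] by auto
  have step: "card {u \<in> ?F. u < t + 1} = of_bool (t \<in> ?F) + card {u \<in> ?F. u < t}" for t
  proof -
    have "{u \<in> ?F. u < t + 1} = (if t \<in> ?F then insert t {u \<in> ?F. u < t} else {u \<in> ?F. u < t})"
      by (auto simp: le_less)
    then show ?thesis by simp
  qed
  have F0: "{u \<in> ?F. u < start_time I i} = {}" and F1: "{u \<in> ?F. u < end_time I i} = ?F"
    by (auto simp: free_def units_def)
  show ?thesis
    unfolding count_free_com_def
    apply simp
    apply (rule runs_conseq[OF runs_For[where B = "end_time I i" and M = la and K = 40 and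
          Inv = "\<lambda>t s'. ivar s' x = int (card {u \<in> ?F. u < t})"]])
    subgoal using v F0 by simp
    subgoal premises p for t s'
    proof -
      have "t \<in> units I i" using p v by (simp add: units_def)
      then show ?thesis using p v frameD[OF p(5)] step[of t] by (auto simp: free_def)
    qed
    subgoal premises p for s' using frameD[OF p] v by simp
    subgoal using st v by simp
    subgoal using st v by simp
    subgoal using la_pos .
    subgoal by simp
    subgoal using la_pos F1 by simp
    done
qed

lemma w_take [simp]:
  "wiv (take_com y i) = {''c'', ''t''}" "wrv (take_com y i) = {''rev''}"
  "wia (take_com y i) = {''occ'', y}" "wra (take_com y i) = {}"
  by (auto simp: take_com_def)

lemma w_quota [simp]:
  "wiv (quota_com i z) = {''q''}" "wrv (quota_com i z) = {}"
  "wia (quota_com i z) = {}" "wra (quota_com i z) = {}"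
  by (auto simp: quota_com_def)

lemma w_clear [simp]:
  "wiv (clear_com y) = {''x''}" "wrv (clear_com y) = {''rev''}"
  "wia (clear_com y) = {''occ'', y}" "wra (clear_com y) = {}"
  by (auto simp: clear_com_def)

lemma runs_quota:
  assumes E: "inputs I s" and i: "i \<in> users I" "ivar s v = int i" "v \<noteq> ''q''" "z \<noteq> ''q''"
    and z: "ivar s z = int (card (free I C i))" and rev: "rvar s ''rev'' = cov_revenue I C"
  shows "runs (quota_com (V v) z) s (\<lambda>k s'. k \<le> 30 \<and> ivar s' ''q'' = cov_quota I C i)"
  using inputsD[OF E] i z rev by (auto simp: quota_com_def cov_quota_def)

text \<open>After the units before \<open>t\<close> have been scanned, exactly those of them in
  \<open>firstn q F\<close> are marked. The array name is restricted to two values so that it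
  differs from every array that the loop reads.\<close>

lemma runs_take:
  assumes E: "env I s" and i: "i \<in> users I" "ivar s v = int i" "v \<noteq> ''c''" "v \<noteq> ''t''"
    and O: "occ_ok I C (iarr s ''occ'')"
    and q: "ivar s ''q'' = int q" "q \<le> card (free I C i)"
    and y0: "y \<in> {''y'', ''tt''}"
  shows "runs (take_com y (V v)) s (\<lambda>k s'. k \<le> 90 * la \<and>
     occ_ok I (C(user_task I i := C (user_task I i) \<union> firstn q (free I C i))) (iarr s' ''occ'') \<and>
     iarr s' y = (\<lambda>x. if x \<in> position I i ` firstn q (free I C i) then 1 else iarr s y x) \<and>
     rvar s' ''rev'' = rvar s ''rev'' + user_value I i * q)"
proof -
  let ?F = "free I C i" and ?k = "user_task I i"
  have y: "y \<noteq> ''occ''" "''occ'' \<noteq> y" "''off'' \<noteq> y" "''s'' \<noteq> y" "''e'' \<noteq> y" "''cid'' \<noteq> y" "''kappa'' \<noteq> y"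
    using y0 by auto
  define T where "T t = {u \<in> firstn q ?F. u < t}" for t
  note [simp] = inputsD[OF conjunct1[OF E]] off_okD[OF conjunct1[OF conjunct2[OF E]]]
    cid_okD[OF conjunct1[OF conjunct2[OF conjunct2[OF E]]]] i q
  have st: "start_time I i < end_time I i" "nat (end_time I i - start_time I i) \<le> la"
    using user_valid[OF i(1)] by auto
  have FU: "firstn q ?F \<subseteq> units I i" using firstn_subset[of q ?F] by (auto simp: free_def)
  have T0: "T (start_time I i) = {}" and T1: "T (end_time I i) = firstn q ?F"
    using FU by (auto simp: T_def units_def)
  have fT: "finite (T t)" for t
    unfolding T_def by (rule finite_subset[of _ ?F]) (use firstn_subset in auto)
  define Inv where "Inv t s' \<longleftrightarrow> ivar s' ''c'' = int (card (T t)) \<and>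
      occ_ok I (C(?k := C ?k \<union> T t)) (iarr s' ''occ'') \<and>
      iarr s' y = (\<lambda>x. if x \<in> position I i ` T t then 1 else iarr s y x)" for t and s' :: state
  show ?thesis
    unfolding take_com_def
    apply simp
    apply (rule runs_conseq[OF runs_For[where B = "end_time I i" and M = la and K = 70 and Inv = Inv]])
    subgoal using y O by (simp add: Inv_def T0)
    subgoal premises p for t s'
    proof -
      have t: "t \<in> units I i" using p y by (simp add: units_def)
      have nT: "t \<notin> T t" by (simp add: T_def)
      \<comment> \<open>Earlier rounds have changed \<open>occ\<close>, but for this task only at
        units before \<open>t\<close>; at \<open>t\<close> it still decides membership in
        \<open>?F\<close>.\<close>
      have occ: "iarr s' ''occ'' (canon I i t) = of_bool (t \<notin> ?F)"
        using occ_okD[OF p(3)[unfolded Inv_def, THEN conjunct2, THEN conjunct1] i(1) t] t nT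
        by (simp add: free_def)
      have TS: "T (t + 1) = (if t \<in> ?F \<and> card (T t) < q then insert t (T t) else T t)"
        unfolding T_def by (rule firstn_below_Suc) simp
      show ?thesis
      proof (cases "t \<in> ?F \<and> card (T t) < q")
        case True
        have o: "occ_ok I (C(?k := insert t (C ?k \<union> T t))) ((iarr s' ''occ'')(canon I i t := 1))"
          using occ_ok_insert[OF p(3)[unfolded Inv_def, THEN conjunct2, THEN conjunct1] i(1) t] by simp
        show ?thesis
          using True p(3,4) y frameD[OF p(5)] TS fT nT occ t o
          by (auto simp: Inv_def position_offset fun_eq_iff)
      next
        case False
        then show ?thesis
          using p(3,4) y frameD[OF p(5)] TS occ t by (auto simp: Inv_def)
      qed
    qed
    subgoal premises p for s' using frameD[OF p] y by simp
    subgoal using st by simp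
    subgoal using st by simp
    subgoal using la_pos .
    subgoal by simp
    subgoal premises p for k s'
      using p frameD[OF p(2)] la_pos T1 y by (simp add: Inv_def)
    done
qed

lemma past_positions_le: "nat (offset I (nu + 1)) \<le> nu * la"
  using offset_le[of nu] lam_pos by (simp add: nat_le_iff)

lemma prod_pos: "1 \<le> nu * la" "nu \<le> nu * la" "la \<le> nu * la"
  using num_users_pos la_pos by (simp_all del: nat_0_less_mult_iff)

text \<open>Canonical cells are themselves positions, so one pass over all positions resets every
  cell of \<open>occ\<close> that matters, along with all marks in \<open>y\<close>.\<close>

lemma runs_clear:
  assumes E: "inputs I s" "off_ok I (iarr s ''off'')"
    and y0: "y \<in> {''y'', ''tt''}"
  shows "runs (clear_com y) s (\<lambda>k s'. k \<le> 60 * (nu * la) \<and> occ_ok I (\<lambda>_. {}) (iarr s' ''occ'') \<and>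
     marks_ok I (\<lambda>_. {}) (iarr s' y) \<and> rvar s' ''rev'' = 0)"
proof -
  have y: "y \<noteq> ''occ''" "''occ'' \<noteq> y" "''off'' \<noteq> y" "''s'' \<noteq> y" "''e'' \<noteq> y" "''cid'' \<noteq> y" "''kappa'' \<noteq> y"
    using y0 by auto
  note [simp] = inputsD[OF E(1)] off_okD[OF E(2)]
  have o: "0 \<le> offset I (nu + 1)"
    using offset_mono[of 1 "nu + 1"] by (simp add: offset_def)
  show ?thesis
    unfolding clear_com_def
    apply simp
    apply (rule runs_conseq[OF runs_For[where B = "offset I (nu + 1)" and M = "nu * la" and K = 40 and
      Inv = "\<lambda>x s'. \<forall>p\<in>{0..<x}. iarr s' ''occ'' p = 0 \<and> iarr s' y p = 0"]])
    subgoal by simp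
    subgoal premises p for t s' using p(3,4) y by auto
    subgoal premises p for s' using frameD[OF p] y by simp
    subgoal using o by simp
    subgoal using past_positions_le by simp
    subgoal by (rule prod_pos)
    subgoal by simp
    subgoal premises p for k s'
    proof -
      have "k + 3 \<le> 60 * (nu * la)" using p prod_pos(1) by linarith
      then show ?thesis using p position_bounds canon_bounds by (simp add: occ_ok_def marks_ok_def)
    qed
    done
qed

end

section \<open>Tables\<close>

context market
begin

lemma users_less_1: "\<not> (l \<in> users I \<and> int l < 1)"
  by (auto simp: users_def)

lemma users_less_past: "l \<in> users I \<Longrightarrow> int l < int nu + 1"
  by (auto simp: users_def)

lemma w_offsets [simp]:
  "wiv offsets_com = {''i''}" "wrv offsets_com = {}"
  "wia offsets_com = {''off''}" "wra offsets_com = {}"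
  by (auto simp: offsets_com_def)

lemma runs_offsets:
  assumes E: "inputs I s"
  shows "runs offsets_com s (\<lambda>k s'. k \<le> 50 * nu \<and> off_ok I (iarr s' ''off''))"
proof -
  note [simp] = inputsD[OF E]
  show ?thesis
    unfolding offsets_com_def
    apply simp
    \<comment> \<open>The entry at the loop variable itself is already known when a round begins,
      hence \<open>\<le>\<close> in the invariant.\<close>
    apply (rule runs_conseq[OF runs_For[where B = "int nu + 1" and M = nu and K = 40 and
      Inv = "\<lambda>x s'. \<forall>l. 1 \<le> l \<and> int l \<le> x \<longrightarrow> iarr s' ''off'' (int l) = offset I l"]])
    subgoal by (auto simp: offset_def)
    subgoal premises p for i s'
    proof -
      obtain j where j: "j \<in> users I" "i = int j" using p(1,2) by (auto elim: int_of_user)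
      then have "1 \<le> j" by (simp add: users_def)
      have eq: "int l = int j + 1 \<longleftrightarrow> l = Suc j" "int l \<le> int j + 1 \<longleftrightarrow> int l \<le> int j \<or> l = Suc j" for l
        by auto
      have "iarr s' ''off'' (int j) = offset I j" using p(3) j \<open>1 \<le> j\<close> by simp
      then show ?thesis
        using p(3,4) frameD[OF p(5)] j \<open>1 \<le> j\<close> by (simp add: offset_Suc eq del: of_nat_Suc)
    qed
    subgoal premises p for s' using frameD[OF p] by simp
    subgoal by simp
    subgoal by simp
    subgoal by (rule num_users_pos)
    subgoal by simp
    subgoal premises p for k s'
      using p num_users_pos by (auto simp: off_ok_def)
    done
qed

lemma w_cells [simp]:
  "wiv cells_com = {''i'', ''t'', ''l''}" "wrv cells_com = {}"
  "wia cells_com = {''cid''}" "wra cells_com = {}"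
  by (auto simp: cells_com_def)

lemma not_first_user: "l < first_user I i t \<Longrightarrow> l \<in> users I \<Longrightarrow>
    \<not> (user_task I l = user_task I i \<and> t \<in> units I l)"
  unfolding first_user_def using not_less_Least by blast

text \<open>User \<open>i\<close> herself passes the test, so the search ends at the latest with
  her. Cells beyond the users, whose content is arbitrary, are never inspected.\<close>

lemma runs_find_first:
  assumes E: "inputs I s" and i: "i \<in> users I" "ivar s ''i'' = int i"
    and t: "t \<in> units I i" "ivar s ''t'' = t" and l: "ivar s ''l'' = 1"
  shows "runs (WHILE NOT (kappa (V ''l'') =\<^sub>i kappa (V ''i'') AND
                      NOT (V ''t'' <\<^sub>i start (V ''l'')) AND V ''t'' <\<^sub>i finish (V ''l'')) DO
             ''l'' :=\<^sub>i V ''l'' +\<^sub>i N 1) s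
     (\<lambda>k s'. k \<le> 60 * nu \<and> ivar s' ''l'' = int (first_user I i t))"
proof -
  note [simp] = inputsD[OF E] i
  note fu = first_user[OF i(1) t(1)]
  have f1: "1 \<le> first_user I i t" "first_user I i t \<le> nu" using fu(1) by (auto simp: users_def)
  show ?thesis
    apply (rule runs_conseq[OF runs_While[where m = "first_user I i t - 1" and K = 4 and
      Inv = "\<lambda>m s'. ivar s' ''l'' = int m + 1"]])
    subgoal premises p for m s'
    proof -
      have m: "m + 1 < first_user I i t" "m + 1 \<in> users I" using p(1) f1 by (auto simp: users_def)
      have lv: "ivar s' ''l'' = int (m + 1)" using p(2) by simp
      show ?thesis using frameD[OF p(3)] t lv inputsD(3-7)[OF E, of "m + 1"] m not_first_user[OF m]
        by (auto simp: units_def)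
    qed
    subgoal premises p for s'
    proof -
      have lv: "ivar s' ''l'' = int (first_user I i t)" using p(1) f1 by simp
      show ?thesis using frameD[OF p(2)] t lv inputsD(3-7)[OF E, of "first_user I i t"] fu
        by (auto simp: units_def)
    qed
    subgoal using l by simp
    subgoal premises p for k s'
    proof -
      have "(first_user I i t - 1) * 30 \<le> (nu - 1) * 30" using f1 by (intro mult_le_mono1) simp
      then show ?thesis using p f1 by auto
    qed
    done
qed

text \<open>A linear search for each of at most \<open>nu * la\<close> positions. Finished entries
  survive later writes because positions determine user and time.\<close>

lemma runs_cells:
  assumes E: "inputs I s" "off_ok I (iarr s ''off'')"
  shows "runs cells_com s (\<lambda>k s'. k \<le> 300 * (nu * nu * la) \<and> cid_ok I (iarr s' ''cid''))"
proof -
  note [simp] = inputsD[OF E(1)] off_okD[OF E(2)]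
  define Done where "Done i a \<longleftrightarrow> (\<forall>l\<in>users I. int l < i \<longrightarrow> (\<forall>t\<in>units I l. a (position I l t) = canon I l t))"
    for i and a :: "int \<Rightarrow> int"
  show ?thesis
    unfolding cells_com_def
    apply (rule runs_conseq[OF runs_For[where B = "int nu + 1" and M = nu and K = "300 * (nu * la)" and
      Inv = "\<lambda>i s'. Done i (iarr s' ''cid'')"]])
    subgoal using users_less_1 by (auto simp: Done_def)
    subgoal premises p for i' s1
    proof -
      obtain i where i: "i \<in> users I" "i' = int i" using p(1,2) by (auto elim: int_of_user)
      note f1 = frameD[OF p(5)]
      have st: "start_time I i < end_time I i" "nat (end_time I i - start_time I i) \<le> la"
        using user_valid[OF i(1)] by auto
      show ?thesis
        apply (rule runs_conseq[OF runs_For[where B = "end_time I i" and M = la and K = "200 * nu" and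
          Inv = "\<lambda>t s'. Done i' (iarr s' ''cid'') \<and>
             (\<forall>t'\<in>units I i. t' < t \<longrightarrow> iarr s' ''cid'' (position I i t') = canon I i t')"]])
        subgoal using p(3,4) f1 i by (simp add: units_def)
        subgoal premises q for t s2
        proof -
          note f2 = frameD[OF q(5)]
          have t: "t \<in> units I i" using q(1,2) f1 p(4) i by (simp add: units_def)
          show ?thesis
            apply simp
            apply (rule runs_conseq[OF runs_find_first[OF _ i(1) _ t]])
            subgoal using f1 f2 E(1) by simp
            subgoal using f1 f2 p(4) i by simp
            subgoal using q(4) by simp
            subgoal by simp
            subgoal premises r for k s3
            proof -
              note f3 = frameD[OF r(2)]
              have fu: "first_user I i t \<in> users I" using first_user(1)[OF i(1) t] .
              have "ivar s3 ''t'' = t" "ivar s3 ''i'' = int i" "iarr s3 ''s'' = iarr s ''s''"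
                "iarr s3 ''off'' = iarr s ''off''" "iarr s3 ''cid'' = iarr s2 ''cid''"
                using f1 f2 f3 q(4) p(4) i by simp_all
              moreover have "offset I i + (t - start_time I i) = position I i t"
                "offset I (first_user I i t) + (t - start_time I (first_user I i t)) = canon I i t"
                by (simp_all add: canon_def position_offset)
              moreover have "k + 50 \<le> 200 * nu" using r(1) num_users_pos by linarith
              ultimately show ?thesis
                using q(3) i r(1) inputsD[OF E(1)] off_okD[OF E(2)] fu
                by (auto simp: Done_def position_eq_iff[OF _ _ i(1) t] le_less)
            qed
            done
        qed
        subgoal premises q for s' using frameD[OF q] f1 p(4) i by simp
        subgoal using f1 p(4) i st by simp
        subgoal using f1 p(4) i st by simp
        subgoal by (rule la_pos)
        subgoal using num_users_pos by simp
        subgoal premises q for k s2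
        proof -
          have "k \<le> 200 * (nu * la)" using q(1) by (simp add: mult.commute mult.left_commute)
          then have "k + 30 \<le> 300 * (nu * la)" using prod_pos(1) by linarith
          moreover have "ivar s2 ''i'' = int i" using frameD[OF q(2)] i p(4) by simp
          moreover have "l \<le> i \<longleftrightarrow> l < i \<or> l = i" for l by auto
          ultimately show ?thesis using q(1) i by (auto simp: Done_def units_def)
        qed
        done
    qed
    subgoal premises p for s' using frameD[OF p] by simp
    subgoal by simp
    subgoal by simp
    subgoal by (rule num_users_pos)
    subgoal
    proof -
      have "19 \<le> 300 * (nu * la)" using prod_pos(1) by linarith
      then show ?thesis by simp
    qed
    subgoal premises p for k s'
      using p users_less_past by (simp add: cid_ok_def Done_def)
    done
qed

lemma w_ranks [simp]:
  "wiv ranks_com = {''i'', ''r'', ''j''}" "wrv ranks_com = {}"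
  "wia ranks_com = {''rank'', ''ord''}" "wra ranks_com = {}"
  by (auto simp: ranks_com_def)

text \<open>Sorting by counting: every pair of users is compared once in each direction, which stays
  within the quadratic bound. Injectivity of \<open>prio\<close> protects earlier entries of
  \<open>ord\<close>.\<close>

lemma runs_ranks:
  assumes E: "inputs I s"
  shows "runs ranks_com s (\<lambda>k s'. k \<le> 100 * (nu * nu) \<and> prio_ok I (iarr s' ''rank'') (iarr s' ''ord''))"
proof -
  note [simp] = inputsD[OF E]
  define Done where "Done i rk od \<longleftrightarrow> (\<forall>l\<in>users I. int l < i \<longrightarrow>
      rk (int l) = int (prio I l) \<and> od (int (prio I l)) = int l)"
    for i and rk od :: "int \<Rightarrow> int"
  show ?thesis
    unfolding ranks_com_def
    apply (rule runs_conseq[OF runs_For[where B = "int nu + 1" and M = nu and K = "100 * nu" and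
      Inv = "\<lambda>i s'. Done i (iarr s' ''rank'') (iarr s' ''ord'')"]])
    subgoal using users_less_1 by (auto simp: Done_def)
    subgoal premises p for i' s1
    proof -
      obtain i where i: "i \<in> users I" "i' = int i" using p(1,2) by (auto elim: int_of_user)
      note f1 = frameD[OF p(5)]
      define A where "A j = {l \<in> users I. int l < j \<and> prec I i l}" for j
      show ?thesis
        apply simp
        apply (rule runs_conseq[OF runs_For[where B = "int nu + 1" and M = nu and K = 60 and
          Inv = "\<lambda>j s'. ivar s' ''r'' = int (card (A j))"]])
        subgoal using users_less_1 by (auto simp: A_def)
        subgoal premises q for j' s2
        proof -
          obtain j where j: "j \<in> users I" "j' = int j" using q(1,2) by (auto elim: int_of_user)
          note f2 = frameD[OF q(5)]
          have b: "bval (prec_test (V ''i'') (V ''j'')) s2 \<longleftrightarrow> prec I i j"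
            using bval_prec_test[OF _ i(1) j(1)] f1 f2 E p(4) q(4) i j by simp
          have "A (j' + 1) = (if prec I i j then insert j (A j') else A j')"
            using j by (auto simp: A_def le_less)
          moreover have "j \<notin> A j'" "finite (A j')" using j by (auto simp: A_def)
          ultimately show ?thesis using b q(3,4) by (simp add: bcost_prec_test)
        qed
        subgoal premises q for s' using frameD[OF q] f1 by simp
        subgoal by simp
        subgoal by simp
        subgoal by (rule num_users_pos)
        subgoal by simp
        subgoal premises q for k s2
        proof -
          note f2 = frameD[OF q(2)]
          have "A (int nu + 1) = {l \<in> users I. prec I i l}" using users_less_past by (auto simp: A_def)
          then have r: "ivar s2 ''r'' = int (prio I i)" using q(1) by (simp add: prio_def)
          have "l \<in> users I \<Longrightarrow> prio I l = prio I i \<Longrightarrow> l = i" for l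
            using i prio_inj by (auto dest: inj_onD)
          moreover have "k + 40 \<le> 100 * nu" using q(1) num_users_pos by linarith
          moreover have "ivar s2 ''i'' = int i" "iarr s2 ''rank'' = iarr s1 ''rank''" "iarr s2 ''ord'' = iarr s1 ''ord''"
            using f2 p(4) i by simp_all
          moreover have "l \<le> i \<longleftrightarrow> l < i \<or> l = i" for l by auto
          ultimately show ?thesis using p(3) i r by (auto simp: Done_def)
        qed
        done
    qed
    subgoal premises p for s' using frameD[OF p] by simp
    subgoal by simp
    subgoal by simp
    subgoal by (rule num_users_pos)
    subgoal using num_users_pos by simp
    subgoal premises p for k s'
      using p users_less_past by (simp add: prio_ok_def Done_def)
    done
qed

end

section \<open>Algorithm 1\<close>

lemma firstn_all:
  assumes "finite F" "card F \<le> q"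
  shows "firstn q F = F"
  using assms by (intro card_subset_eq firstn_subset) (simp_all add: card_firstn)

definition cand_ok :: "mcs \<Rightarrow> nat set \<Rightarrow> (int \<Rightarrow> int) \<Rightarrow> bool" where
  "cand_ok I X a \<longleftrightarrow> (\<forall>i\<in>users I. a (int i) = of_bool (i \<in> X))"

text \<open>The array counts from 1 and the list from 0, hence the index
  \<open>k + 1\<close>.\<close>

definition wins_ok :: "nat list \<Rightarrow> int \<Rightarrow> (int \<Rightarrow> int) \<Rightarrow> bool" where
  "wins_ok W h a \<longleftrightarrow> h = int (length W) \<and> (\<forall>k<length W. a (int k + 1) = int (W ! k))"

lemma wins_ok_snoc: "wins_ok W h a \<Longrightarrow> wins_ok (W @ [j]) (h + 1) (a(h + 1 := int j))"
  by (auto simp: wins_ok_def nth_append less_Suc_eq)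

text \<open>What the payments need from the selection. By the decreasing order, everyone selected
  before a winner lies above her; by disjointness within a task, the revenue of the earlier winners
  can be summed unit by unit.\<close>

definition sched_wf :: "mcs \<Rightarrow> (nat \<Rightarrow> int set) \<Rightarrow> nat list \<Rightarrow> bool" where
  "sched_wf I D W \<longleftrightarrow> unit_sched I D \<and> set W \<subseteq> users I \<and> sorted_wrt (\<lambda>v w. prec I w v) W \<and>
     (\<forall>i. i \<notin> set W \<longrightarrow> D i = {}) \<and>
     (\<forall>i\<in>users I. \<forall>j\<in>users I. i \<noteq> j \<longrightarrow> user_task I i = user_task I j \<longrightarrow> D i \<inter> D j = {})"

lemma sched_wf_snoc:
  assumes "sched_wf I D W" "j \<in> users I" "\<And>w. w \<in> set W \<Longrightarrow> prec I j w"
  shows "sched_wf I (D(j := firstn q (free I (coverage I D) j))) (W @ [j])"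
proof -
  let ?A = "firstn q (free I (coverage I D) j)"
  have A: "?A \<subseteq> units I j" "?A \<inter> coverage I D (user_task I j) = {}"
    using firstn_subset[of q "free I (coverage I D) j"] by (auto simp: free_def)
  have dis: "?A \<inter> D i = {}" if "i \<in> users I" "user_task I i = user_task I j" for i
    using A(2) that by (auto simp: coverage_def)
  have "unit_sched I (D(j := ?A))"
    using assms(1,2) A(1) by (intro unit_sched_upd) (auto simp: sched_wf_def)
  then show ?thesis
    using assms dis by (simp add: sched_wf_def sorted_wrt_append) (metis Int_commute)
qed

text \<open>From here on a round involves integer sets only. The nondegenerate intervals are
  required to read off from the units whether a candidate is exhausted.\<close>

lemma approx_step_Units:
  assumes "unit_sched I D" "sched st = (\<lambda>i. Units (D i))"
    and "\<And>i. i \<in> candidates st \<Longrightarrow> start_time I i < end_time I i"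
    and j: "j = prec_max I (candidates st)" and q: "q = cov_quota I (coverage I D) j"
    and F: "F = free I (coverage I D) j"
  shows "approx_step I st =
    (if 0 < q then
       let D' = D(j := firstn (nat q) F); X = {i \<in> candidates st. free I (coverage I D') i \<noteq> {}}
       in \<lparr>candidates = X, winners = winners st @ [j], sched = (\<lambda>i. Units (D' i)),
            stop = (q < int (card F) \<or> X = {})\<rparr>
     else st\<lparr>stop := q < int (card F) \<or> candidates st = {}\<rparr>)"
proof (cases "0 < q")
  case True
  define D' where "D' = D(j := firstn (nat q) F)"
  have upd: "(sched st)(j := first_units (nat q) (free_time I (sched st) j)) = (\<lambda>i. Units (D' i))"
    by (simp add: assms(2) first_units_free_time D'_def Units_upd F)
  have X: "i \<in> candidates st \<Longrightarrow>
      interval I i \<subseteq> covered I (\<lambda>i. Units (D' i)) (user_task I i) \<longleftrightarrow> free I (coverage I D') i = {}" for i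
    using assms(3) interval_covered_iff by blast
  have lt: "real_of_int q < real (card F) \<longleftrightarrow> q < int (card F)" by linarith
  have Q: "quota I (sched st) j = real_of_int q" "len (free_time I (sched st) j) = real (card F)"
    by (simp_all add: assms(2) quota_Units[OF assms(1)] q len_free_time F)
  show ?thesis
    using True unfolding approx_step_def Let_def j[symmetric] Q
    by (cases st) (use upd X lt in \<open>simp add: D'_def[symmetric] cong: conj_cong\<close>)
next
  case False
  have lt: "real_of_int q < real (card F) \<longleftrightarrow> q < int (card F)" by linarith
  have Q: "quota I (sched st) j = real_of_int q" "len (free_time I (sched st) j) = real (card F)"
    by (simp_all add: assms(2) quota_Units[OF assms(1)] q len_free_time F)
  show ?thesis using False unfolding approx_step_def Let_def j[symmetric] Q by (simp add: lt)
qed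

text \<open>\<open>prec_max\<close> is a definite description. Existence of a maximum follows by
  induction on the finite set from totality and transitivity; uniqueness is asymmetry of the
  order.\<close>

lemma prec_max_works:
  assumes "finite S" "S \<noteq> {}"
  shows "prec_max I S \<in> S \<and> (\<forall>i\<in>S. i \<noteq> prec_max I S \<longrightarrow> prec I i (prec_max I S))"
proof -
  have "\<exists>m\<in>S. \<forall>i\<in>S. i \<noteq> m \<longrightarrow> prec I i m"
    using assms
  proof (induction rule: finite_ne_induct)
    case (insert x S)
    then obtain m where m: "m \<in> S" "\<forall>i\<in>S. i \<noteq> m \<longrightarrow> prec I i m" by blast
    have "x \<noteq> m" using insert m by auto
    from prec_total[OF this] show ?case
    proof
      assume "prec I x m" then show ?thesis using m by blast
    next
      assume "prec I m x"
      then have "prec I i x" if "i \<in> S" for i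
        using m that prec_trans[of I i m x] by (cases "i = m") auto
      then show ?thesis by blast
    qed
  qed simp
  then obtain m where m: "m \<in> S" "\<forall>i\<in>S. i \<noteq> m \<longrightarrow> prec I i m" by blast
  then have "prec_max I S = m" by (intro prec_max_eqI) auto
  then show ?thesis using m by simp
qed

context market
begin

lemma cand_okD: "cand_ok I X a \<Longrightarrow> i \<in> users I \<Longrightarrow> a (int i) = of_bool (i \<in> X)"
  by (simp add: cand_ok_def)

text \<open>This and the later \<open>_com\<close> abbreviations repeat fragments of the program, so
  that each fragment has its own lemma.\<close>

abbreviation select_com :: com where
  "select_com \<equiv> FOR ''i'' FROM N 1 UNTO past_users DO
            WHEN (''cand''.[V ''i'']\<^sub>i =\<^sub>i N 1 AND
                  (V ''j'' =\<^sub>i N 0 OR prec_test (V ''j'') (V ''i''))) DO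
              ''j'' :=\<^sub>i V ''i''"

lemma runs_select:
  assumes E: "inputs I s" and X: "cand_ok I X (iarr s ''cand'')" "X \<subseteq> users I" "X \<noteq> {}"
    and j: "ivar s ''j'' = 0"
  shows "runs select_com s (\<lambda>k s'. k \<le> 80 * nu \<and> ivar s' ''j'' = int (prec_max I X))"
proof -
  note [simp] = inputsD[OF E]
  \<comment> \<open>Users are numbered from 1, so \<open>j = 0\<close> can encode that no candidate
    below \<open>i\<close> has been met.\<close>
  define Best where "Best i j \<longleftrightarrow>
     (j = 0 \<and> (\<forall>l\<in>X. \<not> int l < i)) \<or>
     (\<exists>m\<in>X. int m < i \<and> j = int m \<and> (\<forall>l\<in>X. int l < i \<longrightarrow> l \<noteq> m \<longrightarrow> prec I l m))" for i j
  have Xpos: "l \<in> X \<Longrightarrow> 1 \<le> l \<and> l \<le> nu" for l using X(2) by (auto simp: users_def)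
  show ?thesis
    apply (rule runs_conseq[OF runs_For[where B = "int nu + 1" and M = nu and K = 80 and
          Inv = "\<lambda>i s'. Best i (ivar s' ''j'')"]])
    subgoal using j Xpos by (force simp: Best_def)
    subgoal premises p for i' s'
    proof -
      obtain i where i: "i \<in> users I" "i' = int i" using p(1,2) by (auto elim: int_of_user)
      note f = frameD[OF p(5)]
      have c: "iarr s' ''cand'' (int i) = of_bool (i \<in> X)"
        using cand_okD[OF X(1) i(1)] f by simp
      have E': "inputs I s'" using f E by simp
      have iv: "ivar s' ''i'' = int i" using p(4) i by simp
      have le: "int l < int i + 1 \<longleftrightarrow> int l < int i \<or> l = i" for l by auto
      consider (out) "i \<notin> X" | (first) "i \<in> X" "ivar s' ''j'' = 0" "\<forall>l\<in>X. \<not> int l < int i"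
        | (better) m where "i \<in> X" "m \<in> X" "int m < int i" "ivar s' ''j'' = int m"
          "\<forall>l\<in>X. int l < int i \<longrightarrow> l \<noteq> m \<longrightarrow> prec I l m"
        using p(3) i by (auto simp: Best_def)
      then show ?thesis
      proof cases
        case out
        then have "Best (int i + 1) (ivar s' ''j'')" using p(3) i unfolding Best_def le by blast
        then show ?thesis using out c iv i by (simp add: bcost_prec_test)
      next
        case first
        then have "Best (int i + 1) (int i)" unfolding Best_def le by auto
        then show ?thesis using first c iv i by (simp add: bcost_prec_test)
      next
        case (better m)
        have b: "bval (prec_test (V ''j'') (V ''i'')) s' \<longleftrightarrow> prec I m i"
          using bval_prec_test[OF E' _ i(1) better(4) iv] better X(2) by blast
        have m0: "0 < m" using Xpos[OF better(2)] by simp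
        show ?thesis
        proof (cases "prec I m i")
          case True
          then have "Best (int i + 1) (int i)" using better prec_trans[OF _ True] unfolding Best_def le
            by (intro disjI2 bexI[of _ i]) auto
          then show ?thesis using better c iv i b True m0 by (simp add: bcost_prec_test)
        next
          case False
          then have "prec I i m" using better(3) prec_total[of i m I] by auto
          then have "Best (int i + 1) (int m)" using better unfolding Best_def le
            by (intro disjI2 bexI[of _ m]) auto
          then show ?thesis using better c iv i b False m0 by (simp add: bcost_prec_test)
        qed
      qed
    qed
    subgoal premises p for s' using frameD[OF p] by simp
    subgoal by simp
    subgoal by simp
    subgoal by (rule num_users_pos)
    subgoal by simp
    subgoal premises p for k s'
    proof -
      obtain l where "l \<in> X" using X by blast
      with users_less_past X(2) have "\<not> (\<forall>l\<in>X. \<not> int l < int nu + 1)" by blast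
      then obtain m where m: "m \<in> X" "ivar s' ''j'' = int m" "\<forall>l\<in>X. l \<noteq> m \<longrightarrow> prec I l m"
        using p(1) users_less_past X(2) unfolding Best_def by blast
      then have "prec_max I X = m" by (intro prec_max_eqI) auto
      then show ?thesis using p(1) m by simp
    qed
    done
qed

abbreviation filter_com :: com where
  "filter_com \<equiv> FOR ''i'' FROM N 1 UNTO past_users DO
               WHEN ''cand''.[V ''i'']\<^sub>i =\<^sub>i N 1 DO
                 (count_free_com ''z1'' (V ''i'');;
                  WHEN V ''z1'' =\<^sub>i N 0 DO
                    (''cand''.[V ''i''] :=\<^sub>i N 0;; ''ncand'' :=\<^sub>i V ''ncand'' -\<^sub>i N 1))"

text \<open>The costliest part of a round: up to \<open>nu\<close> intervals are inspected, while
  the award itself concerns a single interval.\<close>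

lemma runs_filter:
  assumes E: "env I s" and X: "cand_ok I X (iarr s ''cand'')" "X \<subseteq> users I"
    and n: "ivar s ''ncand'' = int (card X)" and O: "occ_ok I C (iarr s ''occ'')"
  shows "runs filter_com s (\<lambda>k s'. k \<le> 100 * (nu * la) \<and>
    cand_ok I {i \<in> X. free I C i \<noteq> {}} (iarr s' ''cand'') \<and>
    ivar s' ''ncand'' = int (card {i \<in> X. free I C i \<noteq> {}}))"
proof -
  note [simp] = inputsD[OF conjunct1[OF E]]
  define Y where "Y i = {l \<in> X. \<not> (int l < i \<and> free I C l = {})}" for i
  have fX: "finite X" using X(2) finite_users finite_subset by blast
  have Y1: "Y 1 = X" using X(2) by (auto simp: Y_def users_def)
  have Yn: "Y (int nu + 1) = {i \<in> X. free I C i \<noteq> {}}"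
    using X(2) users_less_past by (auto simp: Y_def)
  show ?thesis
    apply (rule runs_conseq[OF runs_For[where B = "int nu + 1" and M = nu and K = "100 * la" and
          Inv = "\<lambda>i s'. cand_ok I (Y i) (iarr s' ''cand'') \<and> ivar s' ''ncand'' = int (card (Y i))"]])
    subgoal using X(1) n by (simp add: Y1)
    subgoal premises p for i' s'
    proof -
      obtain i where i: "i \<in> users I" "i' = int i" using p(1,2) by (auto elim: int_of_user)
      note f = frameD[OF p(5)]
      have c: "iarr s' ''cand'' (int i) = of_bool (i \<in> X)"
        using cand_okD[OF conjunct1[OF p(3)] i(1)] i by (simp add: Y_def)
      have iv: "ivar s' ''i'' = int i" using p(4) i by simp
      have YS: "Y (int i + 1) = (if i \<in> X \<and> free I C i = {} then Y (int i) - {i} else Y (int i))"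
        by (auto simp: Y_def le_less)
      show ?thesis
      proof (cases "i \<in> X")
        case False
        then show ?thesis using c iv i p(3) YS la_pos by simp
      next
        case True
        have iY: "i \<in> Y (int i)" "finite (Y (int i))" using True fX by (auto simp: Y_def)
        have cy: "card (Y (int i)) = Suc (card (Y (int i) - {i}))" using iY by (metis card.remove)
        have E': "env I s'" "occ_ok I C (iarr s' ''occ'')" using f E O by simp_all
        show ?thesis
          apply (simp add: c iv True)
          apply (rule runs_conseq[OF runs_count_free[OF E'(1) i(1) iv _ _ _ E'(2)]])
          subgoal by simp
          subgoal by simp
          subgoal by simp
          subgoal premises q for k s2
          proof -
            have "ivar s2 ''i'' = int i" "iarr s2 ''cand'' = iarr s' ''cand''" "ivar s2 ''ncand'' = ivar s' ''ncand''"
              using frameD[OF q(2)] iv by simp_all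
            moreover have "k + 50 \<le> 100 * la" using q(1) la_pos by linarith
            moreover have "cand_ok I (Y (int i) - {i}) ((iarr s' ''cand'')(int i := 0))"
              using p(3) i by (simp add: cand_ok_def)
            ultimately show ?thesis using q(1) i p(3) YS True cy by simp
          qed
          done
      qed
    qed
    subgoal premises p for s' using frameD[OF p] by simp
    subgoal by simp
    subgoal by simp
    subgoal by (rule num_users_pos)
    subgoal using la_pos by simp
    subgoal premises p for k s'
      using p Yn by (simp add: mult.left_commute)
    done
qed

text \<open>Free units are disjoint from what the task already covers, so only one summand of the
  revenue changes, by the value of the user per unit. Hence one addition keeps \<open>rev\<close> up
  to date.\<close>

lemma coverage_award:
  assumes "unit_sched I D" "j \<in> users I" "D j = {}" "A \<subseteq> free I (coverage I D) j"
  shows "coverage I (D(j := A)) = (coverage I D)(user_task I j := coverage I D (user_task I j) \<union> A)"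
    and "cov_revenue I (coverage I (D(j := A))) = cov_revenue I (coverage I D) + user_value I j * card A"
proof -
  show c: "coverage I (D(j := A)) = (coverage I D)(user_task I j := coverage I D (user_task I j) \<union> A)"
    using assms(2,3) by (rule coverage_upd)
  have "finite A" using assms(4) finite_free by (rule finite_subset)
  moreover have "A \<inter> coverage I D (user_task I j) = {}" using assms(4) by (auto simp: free_def)
  ultimately show "cov_revenue I (coverage I (D(j := A))) = cov_revenue I (coverage I D) + user_value I j * card A"
    unfolding c user_value_def
    using finite_coverage[OF assms(1)] user_valid(1)[OF assms(2)] by (intro cov_revenue_upd) auto
qed

text \<open>A quota never exceeds the free length. This is why \<open>take_com\<close> may add
  \<open>q\<close> times the value to \<open>rev\<close> without counting the units it has
  marked.\<close>

lemma card_award: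
  assumes "0 < cov_quota I C j"
  shows "nat (cov_quota I C j) \<le> card (free I C j)"
    "card (firstn (nat (cov_quota I C j)) (free I C j)) = nat (cov_quota I C j)"
proof -
  show "nat (cov_quota I C j) \<le> card (free I C j)" by (simp add: cov_quota_def)
  then show "card (firstn (nat (cov_quota I C j)) (free I C j)) = nat (cov_quota I C j)"
    by (simp add: card_firstn)
qed

lemma runs_award:
  assumes E: "env I s" and j: "j \<in> users I" "ivar s ''j'' = int j"
    and W: "wins_ok W (ivar s ''h'') (iarr s ''W'')" and D: "unit_sched I D" "D j = {}"
    and y: "marks_ok I D (iarr s ''y'')" and O: "occ_ok I (coverage I D) (iarr s ''occ'')"
    and X: "cand_ok I X (iarr s ''cand'')" "X \<subseteq> users I" "ivar s ''ncand'' = int (card X)"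
    and rev: "rvar s ''rev'' = cov_revenue I (coverage I D)"
    and q: "ivar s ''q'' = cov_quota I (coverage I D) j" "0 < cov_quota I (coverage I D) j"
    and D': "D' = D(j := firstn (nat (cov_quota I (coverage I D) j)) (free I (coverage I D) j))"
    and X': "X' = {i \<in> X. free I (coverage I D') i \<noteq> {}}"
  shows "runs (''h'' :=\<^sub>i V ''h'' +\<^sub>i N 1;;
             ''W''.[V ''h''] :=\<^sub>i V ''j'';;
             take_com ''y'' (V ''j'');; filter_com) s
    (\<lambda>k s'. k \<le> 250 * (nu * la) \<and> wins_ok (W @ [j]) (ivar s' ''h'') (iarr s' ''W'') \<and>
       marks_ok I D' (iarr s' ''y'') \<and> occ_ok I (coverage I D') (iarr s' ''occ'') \<and>
       cand_ok I X' (iarr s' ''cand'') \<and> ivar s' ''ncand'' = int (card X') \<and>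
       rvar s' ''rev'' = cov_revenue I (coverage I D'))"
proof -
  let ?C = "coverage I D" and ?q = "nat (cov_quota I (coverage I D) j)"
  let ?A = "firstn ?q (free I ?C j)"
  note cov = coverage_award[OF D(1) j(1) D(2) firstn_subset[of ?q], folded D']
  note card = card_award[OF q(2)]
  define s1 where "s1 = s\<lparr>ivar := (ivar s)(''h'' := ivar s ''h'' + 1),
      iarr := (iarr s)(''W'' := (iarr s ''W'')(ivar s ''h'' + 1 := int j))\<rparr>"
  have 1: "env I s1" "ivar s1 ''j'' = int j" "occ_ok I ?C (iarr s1 ''occ'')" "ivar s1 ''q'' = int ?q"
    using E j O q by (simp_all add: s1_def)
  have A: "?A \<subseteq> units I j" using firstn_subset[of ?q "free I ?C j"] by (auto simp: free_def)
  have t: "runs (take_com ''y'' (V ''j'')) s1 (\<lambda>k s'. k \<le> 90 * la \<and>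
     occ_ok I (coverage I D') (iarr s' ''occ'') \<and> marks_ok I D' (iarr s' ''y'') \<and>
     rvar s' ''rev'' = cov_revenue I (coverage I D'))"
  proof (rule runs_mono[OF runs_take[OF 1(1) j(1) 1(2) _ _ 1(3,4)]])
    fix k s'
    assume k: "k \<le> 90 * la \<and> occ_ok I (?C(user_task I j := ?C (user_task I j) \<union> ?A)) (iarr s' ''occ'') \<and>
       iarr s' ''y'' = (\<lambda>x. if x \<in> position I j ` ?A then 1 else iarr s1 ''y'' x) \<and>
       rvar s' ''rev'' = rvar s1 ''rev'' + user_value I j * real ?q"
    have "marks_ok I D (iarr s1 ''y'')" using y by (simp add: s1_def)
    from marks_ok_upd[OF this j(1) A D(2)] have "marks_ok I D' (iarr s' ''y'')"
      using k by (simp add: D')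
    moreover have "rvar s' ''rev'' = cov_revenue I (coverage I D')"
      using k rev cov(2) card(2) by (simp add: s1_def)
    moreover have "occ_ok I (coverage I D') (iarr s' ''occ'')" using k cov(1) by simp
    ultimately show "k \<le> 90 * la \<and> occ_ok I (coverage I D') (iarr s' ''occ'') \<and>
      marks_ok I D' (iarr s' ''y'') \<and> rvar s' ''rev'' = cov_revenue I (coverage I D')"
      using k by simp
  qed (use card(1) in auto)
  show ?thesis
    apply (simp add: j(2) flip: s1_def)
    apply (rule runs_conseq[OF t])
    subgoal premises p for k s2
    proof -
      note f = frameD[OF p(2)]
      have 2: "env I s2" "cand_ok I X (iarr s2 ''cand'')" "ivar s2 ''ncand'' = int (card X)"
        "wins_ok (W @ [j]) (ivar s2 ''h'') (iarr s2 ''W'')"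
        using f 1(1) X wins_ok_snoc[OF W] by (simp_all add: s1_def)
      show ?thesis
        apply (rule runs_conseq[OF runs_filter[OF 2(1,2) X(2) 2(3) conjunct1[OF conjunct2[OF p(1)]], folded X']])
        subgoal premises r for l s3
        proof -
          have "l + k + 50 \<le> 250 * (nu * la)" using r(1) p(1) prod_pos by linarith
          then show ?thesis using r(1) p(1) 2(4) frameD[OF r(2)] by simp
        qed
        done
    qed
    done
qed

text \<open>When the loop stops because of \<open>q < |Z|\<close>, the last winner may still be a candidate, so the
  statements about candidates are restricted to states in which the loop goes on.\<close>

definition approx_rel :: "(nat \<Rightarrow> int set) \<Rightarrow> approx_state \<Rightarrow> state \<Rightarrow> bool" where
  "approx_rel D st s \<longleftrightarrow> sched st = (\<lambda>i. Units (D i)) \<and> sched_wf I D (winners st) \<and>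
     candidates st \<subseteq> users I \<and> cand_ok I (candidates st) (iarr s ''cand'') \<and>
     ivar s ''ncand'' = int (card (candidates st)) \<and> wins_ok (winners st) (ivar s ''h'') (iarr s ''W'') \<and>
     marks_ok I D (iarr s ''y'') \<and> occ_ok I (coverage I D) (iarr s ''occ'') \<and>
     rvar s ''rev'' = cov_revenue I (coverage I D) \<and>
     (\<not> stop st \<longrightarrow> candidates st \<noteq> {} \<and>
       (\<forall>i\<in>candidates st. free I (coverage I D) i \<noteq> {} \<and> (\<forall>w\<in>set (winners st). prec I i w))) \<and> ivar s ''stop'' = of_bool (stop st)"

abbreviation approx_body :: com where
  "approx_body \<equiv>
        (''j'' :=\<^sub>i N 0;;
         select_com;;
         count_free_com ''z'' (V ''j'');;
         quota_com (V ''j'') ''z'';;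
         (WHEN N 0 <\<^sub>i V ''q'' DO
            (''h'' :=\<^sub>i V ''h'' +\<^sub>i N 1;;
             ''W''.[V ''h''] :=\<^sub>i V ''j'';;
             take_com ''y'' (V ''j'');;
             filter_com));;
         WHEN (V ''q'' <\<^sub>i V ''z'' OR V ''ncand'' =\<^sub>i N 0) DO ''stop'' :=\<^sub>i N 1)"

lemma runs_approx_body:
  assumes E: "env I s" and R: "approx_rel D st s" and go: "\<not> stop st"
  shows "runs approx_body s (\<lambda>k s'. k \<le> 500 * (nu * la) \<and>
     (\<exists>D'. approx_rel D' (approx_step I st) s') \<and>
     (stop (approx_step I st) \<or> card (candidates (approx_step I st)) < card (candidates st)))"
proof -
  let ?X = "candidates st" and ?C = "coverage I D" and ?W = "winners st"
  from R go have r: "sched st = (\<lambda>i. Units (D i))" "sched_wf I D ?W" "?X \<subseteq> users I"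
    "cand_ok I ?X (iarr s ''cand'')" "ivar s ''ncand'' = int (card ?X)"
    "wins_ok ?W (ivar s ''h'') (iarr s ''W'')" "marks_ok I D (iarr s ''y'')"
    "occ_ok I ?C (iarr s ''occ'')" "rvar s ''rev'' = cov_revenue I ?C"
    "\<And>i w. i \<in> ?X \<Longrightarrow> w \<in> set ?W \<Longrightarrow> prec I i w" "\<And>i. i \<in> ?X \<Longrightarrow> free I ?C i \<noteq> {}"
    "?X \<noteq> {}" "ivar s ''stop'' = 0"
    by (auto simp: approx_rel_def)
  have fX: "finite ?X" using r(3) finite_users by (rule finite_subset)
  define j where "j = prec_max I ?X"
  define q where "q = cov_quota I ?C j"
  define F where "F = free I ?C j"
  define D' where "D' = D(j := firstn (nat q) F)"
  define X' where "X' = {i \<in> ?X. free I (coverage I D') i \<noteq> {}}"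
  have jX: "j \<in> ?X" "\<And>i. i \<in> ?X \<Longrightarrow> i \<noteq> j \<Longrightarrow> prec I i j"
    using prec_max_works[OF fX r(12), of I] by (auto simp: j_def)
  have ju: "j \<in> users I" using jX r(3) by blast
  have us: "unit_sched I D" using r(2) by (simp add: sched_wf_def)
  have jW: "j \<notin> set ?W" using r(10)[OF jX(1)] prec_irrefl by blast
  have Dj: "D j = {}" using r(2) jW by (simp add: sched_wf_def)
  \<comment> \<open>In a running state every candidate has free units. A quota
    \<open>q \<le> 0\<close> is then below \<open>card F\<close>, so a round without an award always
    stops the loop.\<close>
  have Fne: "0 < card F" using r(11)[OF jX(1)] by (simp add: F_def card_gt_0_iff)
  have step: "approx_step I st =
    (if 0 < q then
       \<lparr>candidates = X', winners = ?W @ [j], sched = (\<lambda>i. Units (D' i)),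
            stop = (q < int (card F) \<or> X' = {})\<rparr>
     else st\<lparr>stop := q < int (card F) \<or> ?X = {}\<rparr>)"
  proof -
    have "\<And>i. i \<in> ?X \<Longrightarrow> start_time I i < end_time I i" using user_valid(3) r(3) by blast
    from approx_step_Units[OF us r(1) this j_def q_def F_def]
    show ?thesis by (simp add: Let_def X'_def D'_def)
  qed
  have covD': "coverage I D' = ?C(user_task I j := ?C (user_task I j) \<union> firstn (nat q) F)"
    unfolding D'_def F_def by (rule coverage_award(1)[OF us ju Dj firstn_subset])
  have jX': "j \<notin> X'" if "int (card F) \<le> q"
  proof -
    have "firstn (nat q) F = F" using that by (intro firstn_all) (simp_all add: F_def nat_le_iff le_nat_iff)
    then have "free I (coverage I D') j = {}" unfolding covD' by (auto simp: free_def F_def)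
    then show ?thesis by (simp add: X'_def)
  qed
  have X'less: "card X' < card ?X" if "int (card F) \<le> q"
    using fX jX'[OF that] jX(1) by (intro psubset_card_mono) (auto simp: X'_def)
  have wf': "sched_wf I D' (?W @ [j])"
    unfolding D'_def F_def using r(2) ju r(10)[OF jX(1)] by (rule sched_wf_snoc)
  have below': "prec I i w" if "i \<in> X'" "int (card F) \<le> q" "w \<in> set (?W @ [j])" for i w
  proof -
    have "i \<in> ?X" "i \<noteq> j" using that(1) jX'[OF that(2)] by (auto simp: X'_def)
    then show ?thesis using that(3) r(10) jX(2) by auto
  qed
  define s0 where "s0 = s\<lparr>ivar := (ivar s)(''j'' := 0)\<rparr>"
  have 0: "env I s0" "cand_ok I ?X (iarr s0 ''cand'')" "ivar s0 ''j'' = 0"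
    using E r(4) by (simp_all add: s0_def)
  show ?thesis
    apply (simp only: runs_simps(2,6) ival.simps flip: s0_def)
    apply (rule runs_conseq[OF runs_select[OF conjunct1[OF 0(1)] 0(2) r(3,12) 0(3), folded j_def]])
    subgoal premises p1 for k1 s1
    proof -
      note f1 = frameD[OF p1(2)]
      have 1: "env I s1" "ivar s1 ''j'' = int j" "occ_ok I ?C (iarr s1 ''occ'')"
        using f1 E r(8) p1(1) by (simp_all add: s0_def)
      show ?thesis
        apply (rule runs_conseq[OF runs_count_free[OF 1(1) ju 1(2) _ _ _ 1(3), folded F_def]])
           apply simp_all[3]
        subgoal premises p2 for k2 s2
        proof -
          note f2 = frameD[OF p2(2)]
          have 2: "env I s2" "ivar s2 ''j'' = int j" "ivar s2 ''z'' = int (card (free I ?C j))"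
            "rvar s2 ''rev'' = cov_revenue I ?C"
            using f1 f2 1 r(9) p2(1) by (simp_all add: s0_def F_def)
          show ?thesis
            apply (rule runs_conseq[OF runs_quota[OF conjunct1[OF 2(1)] ju 2(2) _ _ 2(3,4), folded q_def]])
              apply simp_all[2]
            subgoal premises p3 for k3 s3
            proof -
              note f3 = frameD[OF p3(2)]
              have 3: "env I s3" "ivar s3 ''j'' = int j" "wins_ok ?W (ivar s3 ''h'') (iarr s3 ''W'')"
                "marks_ok I D (iarr s3 ''y'')" "occ_ok I ?C (iarr s3 ''occ'')"
                "cand_ok I ?X (iarr s3 ''cand'')" "ivar s3 ''ncand'' = int (card ?X)"
                "rvar s3 ''rev'' = cov_revenue I ?C" "ivar s3 ''q'' = q" "ivar s3 ''z'' = int (card F)"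
                "ivar s3 ''stop'' = 0"
                using f1 f2 f3 2 r p2(1) p3(1) by (simp_all add: s0_def F_def)
              have k3: "k1 + k2 + k3 + 60 \<le> 240 * (nu * la)"
                using p1(1) p2(1) p3(1) prod_pos by linarith
              show ?thesis
              proof (cases "0 < q")
                case True
                show ?thesis
                  apply (simp only: runs_When bval.simps ival.simps 3(9) True if_True)
                  apply (rule runs_conseq[OF runs_award[OF 3(1) ju 3(2,3) us Dj 3(4,5,6) r(3) 3(7,8)
                      3(9)[unfolded q_def] True[unfolded q_def] D'_def[unfolded q_def F_def] X'_def]])
                  subgoal premises p4 for k4 s4
                  proof -
                    note f4 = frameD[OF p4(2)]
                    have 4: "ivar s4 ''q'' = q" "ivar s4 ''z'' = int (card F)" "ivar s4 ''stop'' = 0"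
                      "ivar s4 ''ncand'' = 0 \<longleftrightarrow> X' = {}"
                      using f4 3 p4(1) fX by (simp_all add: X'_def)
                    have k4: "k1 + k2 + k3 + k4 + 60 \<le> 500 * (nu * la)"
                      using p4(1) k3 prod_pos by linarith
                    \<comment> \<open>The relation is stated with \<open>stop\<close> overwritten by
                      its abstract value. If the round goes on, \<open>stop\<close> is 0 already and
                      the update is the identity.\<close>
                    have "approx_rel D' (approx_step I st) (s4\<lparr>ivar := (ivar s4)(''stop'' := of_bool (stop (approx_step I st)))\<rparr>)"
                      using True p4(1) wf' below' r(3) by (auto simp: approx_rel_def step X'_def)
                    moreover have "s4\<lparr>ivar := (ivar s4)(''stop'' := 0)\<rparr> = s4"
                      using 4(3) by (simp add: fun_upd_idem)
                    ultimately show ?thesis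
                      using True k4 X'less 4
                      by (cases "q < int (card F) \<or> X' = {}") (auto simp: step)
                  qed
                  done
              next
                case False
                then have "q < int (card F)" using Fne by simp
                then have "approx_rel D (approx_step I st) (s3\<lparr>ivar := (ivar s3)(''stop'' := 1)\<rparr>)"
                  using False 3 r by (simp add: approx_rel_def step)
                then show ?thesis
                  using False k3 prod_pos(1) 3(9,10) \<open>q < int (card F)\<close> by (auto simp: step)
              qed
            qed
            done
        qed
        done
    qed
    done
qed

text \<open>The abstract \<open>while\<close> and the loop of the program are unfolded in parallel,
  by induction on the number of candidates, with measure 0 for a stopped state. The summand 4 is the
  failing test.\<close>

lemma runs_approx_loop:
  assumes "env I s" "approx_rel D st s"
  shows "runs (WHILE V ''stop'' =\<^sub>i N 0 DO approx_body) s
    (\<lambda>k s'. k \<le> (if stop st then 0 else card (candidates st)) * (510 * (nu * la)) + 4 \<and>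
       (\<exists>D'. approx_rel D' (while (\<lambda>st. \<not> stop st) (approx_step I) st) s'))"
  using assms
proof (induction "if stop st then 0 else card (candidates st)" arbitrary: s D st rule: less_induct)
  case less
  let ?loop = "WHILE V ''stop'' =\<^sub>i N 0 DO approx_body" and ?st = "approx_step I st"
  have sv: "ivar s ''stop'' = of_bool (stop st)" using less.prems(2) by (simp add: approx_rel_def)
  show ?case
  proof (cases "stop st")
    case True
    then show ?thesis using sv less.prems(2) by (subst runs_Loop, subst while_unfold) auto
  next
    case False
    have "runs approx_body s (\<lambda>k s'. runs ?loop s' (\<lambda>l s''. 4 + k + l \<le>
         card (candidates st) * (510 * (nu * la)) + 4 \<and>
         (\<exists>D'. approx_rel D' (while (\<lambda>st. \<not> stop st) (approx_step I) ?st) s'')))"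
    proof (rule runs_conseq[OF runs_approx_body[OF less.prems False]])
      fix k s'
      assume p: "k \<le> 500 * (nu * la) \<and> (\<exists>D'. approx_rel D' ?st s') \<and>
         (stop ?st \<or> card (candidates ?st) < card (candidates st))" and "frame approx_body s s'"
      note f = frameD[OF this(2)]
      from p obtain D' where R: "approx_rel D' ?st s'" by blast
      have E: "env I s'" using f less.prems(1) by simp
      \<comment> \<open>A running state has a candidate, so its measure is positive and even a round
        that stops lowers it.\<close>
      have c0: "0 < card (candidates st)"
        using False less.prems(2) finite_subset[OF _ finite_users] by (auto simp: approx_rel_def card_gt_0_iff)
      then have dec: "(if stop ?st then 0 else card (candidates ?st)) < (if stop st then 0 else card (candidates st))"
        using p False by auto
      show "runs ?loop s' (\<lambda>l s''. 4 + k + l \<le> card (candidates st) * (510 * (nu * la)) + 4 \<and>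
         (\<exists>D'. approx_rel D' (while (\<lambda>st. \<not> stop st) (approx_step I) ?st) s''))"
      proof (rule runs_mono[OF less.hyps[OF dec E R]])
        fix l s''
        let ?c = "if stop ?st then 0 else card (candidates ?st)"
        assume q: "l \<le> ?c * (510 * (nu * la)) + 4 \<and>
          (\<exists>D'. approx_rel D' (while (\<lambda>st. \<not> stop st) (approx_step I) ?st) s'')"
        have "Suc ?c \<le> card (candidates st)" using dec False by simp
        then have "Suc ?c * (510 * (nu * la)) \<le> card (candidates st) * (510 * (nu * la))"
          by (rule mult_le_mono1)
        moreover have "4 + k + 4 \<le> 510 * (nu * la) + 4" using p prod_pos(1) by linarith
        ultimately have "4 + k + l \<le> card (candidates st) * (510 * (nu * la)) + 4"
          using q unfolding mult_Suc by linarith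
        then show "4 + k + l \<le> card (candidates st) * (510 * (nu * la)) + 4 \<and>
          (\<exists>D'. approx_rel D' (while (\<lambda>st. \<not> stop st) (approx_step I) ?st) s'')"
          using q by blast
      qed
    qed
    then show ?thesis
      using sv False by (subst runs_Loop, subst while_unfold) simp
  qed
qed

lemma w_approx [simp]:
  "wiv approx_com = {''x'', ''i'', ''ncand'', ''h'', ''stop'', ''j'', ''z'', ''t'', ''q'', ''c'', ''z1''}"
  "wrv approx_com = {''rev''}"
  "wia approx_com = {''occ'', ''y'', ''cand'', ''W''}" "wra approx_com = {}"
  by (auto simp: approx_com_def)

lemma coverage_empty: "coverage I (\<lambda>_. {}) = (\<lambda>_. {})"
  by (simp add: coverage_def fun_eq_iff)

text \<open>At most \<open>nu\<close> rounds of \<open>510 * (nu * la)\<close> steps each. The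
  set-up costs a multiple of \<open>nu * la\<close>, which \<open>nu \<ge> 1\<close> lifts to the
  main term.\<close>

lemma runs_approx:
  assumes E: "env I s"
  shows "runs approx_com s (\<lambda>k s'. k \<le> 700 * (nu * nu * la) \<and>
    (\<exists>D. fst (approx_mcs I) = (\<lambda>i. Units (D i)) \<and> sched_wf I D (snd (approx_mcs I)) \<and>
       marks_ok I D (iarr s' ''y'') \<and> wins_ok (snd (approx_mcs I)) (ivar s' ''h'') (iarr s' ''W'')))"
proof -
  have clear: "runs (clear_com ''y'') s (\<lambda>k s'. k \<le> 60 * (nu * la) \<and>
      occ_ok I (\<lambda>_. {}) (iarr s' ''occ'') \<and> marks_ok I (\<lambda>_. {}) (iarr s' ''y'') \<and> rvar s' ''rev'' = 0)"
    using E by (intro runs_clear) auto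
  show ?thesis
    unfolding approx_com_def
    apply (simp only: runs_simps(6))
    apply (rule runs_conseq[OF clear])
    subgoal premises p1 for k1 s1
    proof -
      have 1: "env I s1" using frameD[OF p1(2)] E by simp
      note [simp] = inputsD[OF conjunct1[OF 1]]
      show ?thesis
        apply (rule runs_conseq[OF runs_For[where B = "int nu + 1" and M = nu and K = 30 and
            Inv = "\<lambda>i s'. \<forall>l\<in>users I. int l < i \<longrightarrow> iarr s' ''cand'' (int l) = 1"]])
        subgoal using users_less_1 by auto
        subgoal premises p for i s' using p(3,4) by auto
        subgoal premises p for s' using frameD[OF p] by simp
        subgoal by simp
        subgoal by simp
        subgoal by (rule num_users_pos)
        subgoal by simp
        subgoal premises p2 for k2 s2
        proof -
          note f2 = frameD[OF p2(2)]
          have 2: "env I s2" "occ_ok I (\<lambda>_. {}) (iarr s2 ''occ'')" "marks_ok I (\<lambda>_. {}) (iarr s2 ''y'')"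
            "rvar s2 ''rev'' = 0" "cand_ok I (users I) (iarr s2 ''cand'')"
            using f2 1 p1(1) p2(1) users_less_past by (simp_all add: cand_ok_def)
          define s3 where "s3 = s2\<lparr>ivar := (ivar s2)(''ncand'' := ivar s2 ''n'', ''h'' := 0, ''stop'' := 0)\<rparr>"
          have ne: "users I \<noteq> {}" using num_users_pos by (simp add: users_def)
          have fr: "free I (\<lambda>_. {}) i \<noteq> {}" if "i \<in> users I" for i
            using user_valid(3)[OF that] by (simp add: free_def units_def)
          have 3: "env I s3" using 2(1) by (simp add: s3_def)
          have "approx_rel (\<lambda>_. {}) (approx_init I) s3"
            unfolding approx_rel_def
            using 2 inputsD(1)[OF conjunct1[OF 2(1)]] ne fr
            by (auto simp: s3_def approx_init_def coverage_empty sched_wf_def unit_sched_def Units_def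
                wins_ok_def cov_revenue_def) (simp add: users_def)
          from runs_approx_loop[OF 3 this]
          have loop: "runs (WHILE V ''stop'' =\<^sub>i N 0 DO approx_body) s3
            (\<lambda>k s'. k \<le> nu * (510 * (nu * la)) + 4 \<and>
               (\<exists>D'. approx_rel D' (while (\<lambda>st. \<not> stop st) (approx_step I) (approx_init I)) s'))"
            by (simp add: approx_init_def users_def)
          show ?thesis
            apply (simp add: runs_simps(2) flip: s3_def)
            apply (rule runs_conseq[OF loop])
            subgoal premises p3 for k3 s4
            proof -
              have e: "nu * (510 * (nu * la)) = 510 * (nu * nu * la)" by simp
              have "1 * (nu * la) \<le> nu * (nu * la)" using num_users_pos by (rule mult_le_mono1)
              then have m: "nu * la \<le> nu * nu * la" by simp
              have "k3 + k2 + k1 + 50 \<le> 700 * (nu * nu * la)"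
                using p3(1) p2(1) p1(1) m prod_pos unfolding e by linarith
              then show ?thesis using p3(1)
                by (auto simp: approx_rel_def approx_mcs_def Let_def add.commute add.left_commute)
            qed
            done
        qed
        done
    qed
    done
qed

end

section \<open>Algorithm 3\<close>

lemma unit_schedD: "unit_sched I D \<Longrightarrow> i \<in> users I \<Longrightarrow> D i \<subseteq> units I i"
  unfolding unit_sched_def by presburger

context market
begin

lemma w_integral [simp]:
  "wiv (integral_com i) = {''a''}" "wrv (integral_com i) = {''c'', ''pay''}"
  "wia (integral_com i) = {}" "wra (integral_com i) = {}"
  by (auto simp: integral_com_def)

text \<open>If \<open>inf = 1\<close>, the variable \<open>g2\<close> holds a stale value.\<close>

definition limit_ok :: "ereal \<Rightarrow> state \<Rightarrow> bool" where
  "limit_ok g s \<longleftrightarrow> (ivar s ''inf'' = 1 \<and> g = \<infinity>) \<or> (ivar s ''inf'' = 0 \<and> g = ereal (rvar s ''g2''))"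

text \<open>One round for each layer of the integrand; \<open>z \<le> la\<close> makes their number
  independent of \<open>nu\<close>. The final comparison in the body computes the maximum with
  0.\<close>

lemma runs_integral:
  assumes E: "inputs I s" and w: "w \<in> users I" "ivar s ''w'' = int w"
    and z: "ivar s ''z1'' = int z" "z \<le> la" and g: "limit_ok g s"
  shows "runs (integral_com (V ''w'')) s (\<lambda>k s'. k \<le> 80 * la \<and> rvar s' ''pay'' = rvar s ''pay'' +
    (\<Sum>a = 1..z. max 0 (clip g (budget I / (2 * (real a + rvar s ''rev'' / user_value I w))) - rvar s ''g1'')))"
proof -
  note [simp] = inputsD[OF E] w z
  let ?h = "\<lambda>a. max 0 (clip g (budget I / (2 * (real a + rvar s ''rev'' / user_value I w))) - rvar s ''g1'')"
  show ?thesis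
    unfolding integral_com_def
    apply (rule runs_conseq[OF runs_For[where B = "int z + 1" and M = la and K = 80 and
      Inv = "\<lambda>x s'. rvar s' ''pay'' = rvar s ''pay'' + (\<Sum>a = 1..<nat x. ?h a)"]])
    subgoal by simp
    subgoal premises p for x s'
    proof -
      obtain a where a: "x = int a" "1 \<le> a" using p(1) by (intro that[of "nat x"]) auto
      note f = frameD[OF p(5)]
      have "nat (int a + 1) = Suc a" by simp
      then have S: "(\<Sum>a = 1..<nat (int a + 1). ?h a) = (\<Sum>a = 1..<nat (int a). ?h a) + ?h a"
        using a(2) by simp
      have sv: "ivar s' ''w'' = int w" "rvar s' ''G'' = budget I" "rvar s' ''rev'' = rvar s ''rev''"
        "rvar s' ''g1'' = rvar s ''g1''" "rvar s' ''g2'' = rvar s ''g2''" "ivar s' ''inf'' = ivar s ''inf''"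
        "rarr s' ''u'' = rarr s ''u''" "iarr s' ''kappa'' = iarr s ''kappa''" "ivar s' ''a'' = int a"
        using f p(4) a by simp_all
      show ?thesis using p(3) a(1) g S sv unfolding limit_ok_def clip_def
        by (auto simp: max_def)
    qed
    subgoal premises p for s' using frameD[OF p] by simp
    subgoal by simp
    subgoal by simp
    subgoal by (rule la_pos)
    subgoal by simp
    subgoal premises p for k s'
    proof -
      have "nat (int z + 1) = Suc z" by simp
      then have "{1..<nat (int z + 1)} = {1..z}" by auto
      then show ?thesis using p(1) by simp
    qed
    done
qed

section \<open>Coverage before a given winner\<close>

definition prefix :: "(nat \<Rightarrow> int set) \<Rightarrow> nat list \<Rightarrow> nat \<Rightarrow> nat \<Rightarrow> int set" where
  "prefix D W m i = (if i \<in> set (take m W) then D i else {})"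

lemma sched_wf_distinct:
  assumes "sched_wf I D W" shows "distinct W"
proof -
  have "sorted_wrt (\<lambda>v w. prec I w v) W" using assms by (simp add: sched_wf_def)
  then show ?thesis by (induction W) (auto simp: prec_irrefl)
qed

lemma prefix_Suc:
  "m < length W \<Longrightarrow> prefix D W (Suc m) = (prefix D W m)(W ! m := D (W ! m))"
  by (auto simp: prefix_def fun_eq_iff take_Suc_conv_app_nth)

text \<open>The award of \<open>W ! m\<close> is free with respect to all earlier awards, because
  awards within a task are disjoint. The schedule before a winner can thus be rebuilt as a sequence
  of awards.\<close>

lemma prefix_facts:
  assumes "sched_wf I D W" "m < length W"
  shows "unit_sched I (prefix D W m)" "prefix D W m (W ! m) = {}" "W ! m \<in> users I"
    "D (W ! m) \<subseteq> free I (coverage I (prefix D W m)) (W ! m)"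
proof -
  have us: "unit_sched I D" using assms(1) by (simp add: sched_wf_def)
  show "unit_sched I (prefix D W m)"
    unfolding unit_sched_def
  proof
    fix i show "prefix D W m i \<subseteq> (if i \<in> users I then units I i else {})"
      using us[unfolded unit_sched_def, rule_format, of i] unfolding prefix_def
      by (cases "i \<in> set (take m W)") (simp_all only: if_True if_False empty_subsetI)
  qed
  have "W ! m \<in> set W" using assms(2) by simp
  then show wu: "W ! m \<in> users I" using assms(1) by (auto simp: sched_wf_def)
  have nm: "W ! m \<notin> set (take m W)"
    using sched_wf_distinct[OF assms(1)] assms(2)
    by (auto simp: in_set_conv_nth nth_eq_iff_index_eq)
  then show "prefix D W m (W ! m) = {}" by (simp add: prefix_def)
  have "D (W ! m) \<subseteq> units I (W ! m)" using us wu by (rule unit_schedD)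
  moreover have "D (W ! m) \<inter> prefix D W m i = {}" if "i \<in> users I" "user_task I i = user_task I (W ! m)" for i
  proof (cases "i \<in> set (take m W)")
    case True
    then have "i \<noteq> W ! m" using nm by auto
    then show ?thesis using assms(1) that wu True by (simp add: sched_wf_def prefix_def Int_commute)
  qed (simp add: prefix_def)
  ultimately show "D (W ! m) \<subseteq> free I (coverage I (prefix D W m)) (W ! m)"
    by (auto simp: free_def coverage_def)
qed

lemma wins_okD: "wins_ok W h a \<Longrightarrow> k < length W \<Longrightarrow> a (int k + 1) = int (W ! k)"
  by (simp add: wins_ok_def)

lemma marks_okD: "marks_ok I D a \<Longrightarrow> i \<in> users I \<Longrightarrow> t \<in> units I i \<Longrightarrow>
    a (offset I i + (t - start_time I i)) = of_bool (t \<in> D i)"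
  by (simp add: marks_ok_def position_offset)

lemma below_Suc:
  "{u \<in> A. u < (t::int) + 1} = (if t \<in> A then insert t {u \<in> A. u < t} else {u \<in> A. u < t})"
  by (auto simp: le_less)

lemma length_winners:
  assumes "sched_wf I D W" shows "length W \<le> nu"
proof -
  have "card (set W) \<le> card (users I)"
    using assms by (intro card_mono) (auto simp: sched_wf_def)
  then show ?thesis by (simp add: distinct_card[OF sched_wf_distinct[OF assms]] users_def)
qed

abbreviation refill_com :: com where
  "refill_com \<equiv> FOR ''l'' FROM N 1 UNTO V ''b'' DO
         (''j'' :=\<^sub>i ''W''.[V ''l'']\<^sub>i;;
          FOR ''t'' FROM start (V ''j'') UNTO finish (V ''j'') DO
            WHEN ''y''.[pos (V ''j'') (V ''t'')]\<^sub>i =\<^sub>i N 1 DO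
              (''tt''.[pos (V ''j'') (V ''t'')] :=\<^sub>i N 1;;
               ''occ''.[cell (V ''j'') (V ''t'')] :=\<^sub>i N 1;;
               ''rev'' :=\<^sub>r R ''rev'' +\<^sub>r mu (V ''j'')))"

text \<open>Selection and payments share the array \<open>occ\<close>, so the coverage before a
  winner is recovered from the marks in \<open>y\<close>, going through at most \<open>nu\<close>
  winners with \<open>la\<close> units each. In round \<open>x\<close> the first
  \<open>x - 1\<close> winners are in place.\<close>

lemma runs_refill:
  assumes E: "env I s" and D: "sched_wf I D W" and W: "wins_ok W h (iarr s ''W'')"
    and y: "marks_ok I D (iarr s ''y'')" and O: "occ_ok I (\<lambda>_. {}) (iarr s ''occ'')"
    and rev: "rvar s ''rev'' = 0" and m: "m < length W" "ivar s ''b'' = int m + 1"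
  shows "runs refill_com s (\<lambda>k s'. k \<le> 100 * (nu * la) \<and>
     occ_ok I (coverage I (prefix D W m)) (iarr s' ''occ'') \<and>
     rvar s' ''rev'' = cov_revenue I (coverage I (prefix D W m)))"
proof -
  let ?P = "prefix D W"
  have P0: "?P 0 = (\<lambda>_. {})" by (simp add: prefix_def fun_eq_iff)
  show ?thesis
    apply (rule runs_conseq[OF runs_For[where B = "int m + 1" and M = nu and K = "100 * la" and
      Inv = "\<lambda>x s'. occ_ok I (coverage I (?P (nat (x - 1)))) (iarr s' ''occ'') \<and>
         rvar s' ''rev'' = cov_revenue I (coverage I (?P (nat (x - 1))))"]])
    subgoal using O rev by (simp add: P0 coverage_empty cov_revenue_def)
    subgoal premises p for x s1
    proof -
      obtain l where l: "x = int l + 1" using p(1) by (intro that[of "nat (x - 1)"]) auto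
      then have lm: "l < length W" using p(2) m by simp
      note f1 = frameD[OF p(5)]
      let ?j = "W ! l" and ?C = "coverage I (?P l)"
      note pf = prefix_facts[OF D lm]
      define T where "T t = {u \<in> D ?j. u < t}" for t
      define s2 where "s2 = s1\<lparr>ivar := (ivar s1)(''j'' := int ?j)\<rparr>"
      have 2: "env I s2" "ivar s2 ''j'' = int ?j" "ivar s2 ''l'' = int l + 1" "occ_ok I ?C (iarr s2 ''occ'')"
        "rvar s2 ''rev'' = cov_revenue I ?C" "marks_ok I D (iarr s2 ''y'')"
        using f1 E p(3,4) y l by (simp_all add: s2_def)
      note [simp] = inputsD[OF conjunct1[OF 2(1)]] off_okD[OF conjunct1[OF conjunct2[OF 2(1)]]]
        cid_okD[OF conjunct1[OF conjunct2[OF conjunct2[OF 2(1)]]]] marks_okD[OF 2(6)] pf(3)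
      have jv: "iarr s1 ''W'' (ivar s1 ''l'') = int ?j"
        using f1 wins_okD[OF W lm] p(4) l by simp
      have st: "start_time I ?j < end_time I ?j" "nat (end_time I ?j - start_time I ?j) \<le> la"
        using user_valid[OF pf(3)] by auto
      have Du: "D ?j \<subseteq> units I ?j" using pf(4) by (auto simp: free_def)
      have T0: "T (start_time I ?j) = {}" and T1: "T (end_time I ?j) = D ?j"
        using Du by (auto simp: T_def units_def)
      have fT: "finite (T t)" for t
        using Du by (auto simp: T_def intro: finite_subset[OF _ finite_units])
      define Inv where "Inv t s' \<longleftrightarrow> occ_ok I (?C(user_task I ?j := ?C (user_task I ?j) \<union> T t)) (iarr s' ''occ'') \<and>
         rvar s' ''rev'' = cov_revenue I ?C + user_value I ?j * card (T t)" for t and s' :: state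
      show ?thesis
        apply (simp add: jv flip: s2_def)
        apply (rule runs_conseq[OF runs_For[where B = "end_time I ?j" and M = la and K = 60 and Inv = Inv]])
        subgoal using 2 by (simp add: Inv_def T0)
        subgoal premises q for t s'
        proof -
          have t: "t \<in> units I ?j" using q 2 by (simp add: units_def)
          note f2 = frameD[OF q(5)]
          have sv: "ivar s' ''j'' = int ?j" "iarr s' ''off'' = iarr s2 ''off''" "iarr s' ''s'' = iarr s2 ''s''"
            "iarr s' ''cid'' = iarr s2 ''cid''" "iarr s' ''y'' = iarr s2 ''y''" "ivar s' ''t'' = t"
            "rarr s' ''u'' = rarr s2 ''u''" "iarr s' ''kappa'' = iarr s2 ''kappa''"
            using f2 2 q(4) by simp_all
          have TS: "T (t + 1) = (if t \<in> D ?j then insert t (T t) else T t)"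
            unfolding T_def by (rule below_Suc)
          have nT: "t \<notin> T t" by (simp add: T_def)
          have o: "occ_ok I (?C(user_task I ?j := insert t (?C (user_task I ?j) \<union> T t)))
              ((iarr s' ''occ'')(canon I ?j t := 1))"
            using occ_ok_insert[OF conjunct1[OF q(3)[unfolded Inv_def]] pf(3) t] by simp
          show ?thesis
          proof (cases "t \<in> D ?j")
            case True
            then show ?thesis using q(3) sv TS fT nT t o by (simp add: Inv_def distrib_left)
          next
            case False
            then show ?thesis using q(3) sv TS t by (simp add: Inv_def)
          qed
        qed
        subgoal premises q for s' using frameD[OF q] 2 by simp
        subgoal using st 2 by simp
        subgoal using st 2 by simp
        subgoal by (rule la_pos)
        subgoal by simp
        subgoal premises q for k s'
        proof -
          note cov = coverage_award[OF pf(1,3,2,4), folded prefix_Suc[OF lm]]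
          have "ivar s' ''l'' = int l + 1" using frameD[OF q(2)] 2 by simp
          moreover have "k + 30 \<le> 100 * la" using q(1) la_pos by linarith
          moreover have "nat (int l + 1) = Suc l" by simp
          moreover have "occ_ok I (coverage I (?P (Suc l))) (iarr s' ''occ'')"
            using q(1) unfolding cov(1) by (simp add: Inv_def T1)
          moreover have "rvar s' ''rev'' = cov_revenue I (coverage I (?P (Suc l)))"
            using q(1) unfolding cov(2) by (simp add: Inv_def T1)
          ultimately show ?thesis using l by simp
        qed
        done
    qed
    subgoal premises p for s' using frameD[OF p] m by simp
    subgoal by simp
    subgoal using m length_winners[OF D] by simp
    subgoal by (rule num_users_pos)
    subgoal using la_pos by simp
    subgoal premises p for k s' using p(1) by (simp add: mult.left_commute)
    done
qed

abbreviation own_com :: com where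
  "own_com \<equiv> FOR ''t'' FROM start (V ''w'') UNTO finish (V ''w'') DO
         WHEN ''y''.[pos (V ''w'') (V ''t'')]\<^sub>i =\<^sub>i N 1 DO ''c'' :=\<^sub>i V ''c'' +\<^sub>i N 1"

lemma runs_own:
  assumes E: "env I s" and w: "w \<in> users I" "ivar s ''w'' = int w" and c: "ivar s ''c'' = 0"
    and y: "marks_ok I D (iarr s ''y'')" and D: "D w \<subseteq> units I w"
  shows "runs own_com s (\<lambda>k s'. k \<le> 50 * la \<and> ivar s' ''c'' = int (card (D w)))"
proof -
  note [simp] = inputsD[OF conjunct1[OF E]] off_okD[OF conjunct1[OF conjunct2[OF E]]] marks_okD[OF y] w
  have st: "start_time I w < end_time I w" "nat (end_time I w - start_time I w) \<le> la"
    using user_valid[OF w(1)] by auto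
  define T where "T t = {u \<in> D w. u < t}" for t
  have T0: "T (start_time I w) = {}" and T1: "T (end_time I w) = D w"
    using D by (auto simp: T_def units_def)
  have fT: "finite (T t)" for t
    using D by (auto simp: T_def intro: finite_subset[OF _ finite_units])
  show ?thesis
    apply (rule runs_conseq[OF runs_For[where B = "end_time I w" and M = la and K = 50 and
      Inv = "\<lambda>t s'. ivar s' ''c'' = int (card (T t))"]])
    subgoal using c by (simp add: T0)
    subgoal premises p for t s'
    proof -
      have t: "t \<in> units I w" using p by (simp add: units_def)
      have "ivar s' ''w'' = int w" "iarr s' ''off'' = iarr s ''off''" "iarr s' ''s'' = iarr s ''s''"
        "iarr s' ''y'' = iarr s ''y''"
        using frameD[OF p(5)] by simp_all
      moreover have "T (t + 1) = (if t \<in> D w then insert t (T t) else T t)"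
        unfolding T_def by (rule below_Suc)
      moreover have "t \<notin> T t" by (simp add: T_def)
      ultimately show ?thesis using p(3,4) t fT by simp
    qed
    subgoal premises p for s' using frameD[OF p] by simp
    subgoal using st by simp
    subgoal using st by simp
    subgoal by (rule la_pos)
    subgoal by simp
    subgoal premises p for k s' using p(1) T1 by simp
    done
qed

end

text \<open>Sequencing nests to the right, so the three middle commands are not a subprogram of
  their own. This regroups them.\<close>

lemma runs_middle:
  "runs (c1;; c2;; c3;; c4;; c5) s Q \<longleftrightarrow>
     runs c1 s (\<lambda>k s1. runs (c2;; c3;; c4) s1 (\<lambda>l s2. runs c5 s2 (\<lambda>m. Q (k + l + m))))"
  by (simp add: add.assoc)

text \<open>The bid at which \<open>w\<close> would have the same value per cost as
  \<open>k\<close>; it is the lower limit of integration.\<close>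

definition pay_from :: "mcs \<Rightarrow> nat \<Rightarrow> nat \<Rightarrow> real" where
  "pay_from I w k = user_value I w / user_value I k * unit_cost I k"

text \<open>The upper limit of integration: the bid at which \<open>w\<close> would tie with the
  next user below, if there is one, capped by the bid at which the budget term of the integrand
  vanishes.\<close>

definition pay_limit :: "mcs \<Rightarrow> (nat \<Rightarrow> int set) \<Rightarrow> nat \<Rightarrow> nat \<Rightarrow> ereal" where
  "pay_limit I C w r =
     (let g = (if cov_revenue I C = 0 then \<infinity>
               else ereal (user_value I w * budget I / (2 * cov_revenue I C)))
      in if r < num_users I then min (ereal (pay_from I w (prec_max I (tail I r)))) g else g)"

definition pay_gain :: "mcs \<Rightarrow> (nat \<Rightarrow> int set) \<Rightarrow> nat \<Rightarrow> nat \<Rightarrow> nat \<Rightarrow> real" where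
  "pay_gain I C w k r = (\<Sum>a = 1..card (free I C w).
     max 0 (clip (pay_limit I C w r)
       (budget I / (2 * (real a + cov_revenue I C / user_value I w))) - pay_from I w k))"

definition award :: "mcs \<Rightarrow> (nat \<Rightarrow> int set) \<Rightarrow> nat \<Rightarrow> nat \<Rightarrow> int set" where
  "award I D j =
     (if 0 < cov_quota I (coverage I D) j
      then D(j := firstn (nat (cov_quota I (coverage I D) j)) (free I (coverage I D) j)) else D)"

context market
begin

text \<open>The cap built into \<open>pay_limit\<close> supplies the last assumption of
  \<open>payment_integral\<close>.\<close>

lemma pay_integral_eq:
  assumes "w \<in> users I" "k \<in> users I" "ereal (pay_from I w k) \<le> pay_limit I C w r"
  shows "(LBINT v=ereal (pay_from I w k)..pay_limit I C w r. min (real (card (free I C w)))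
      (real_of_int \<lfloor>budget I / (2 * v) - cov_revenue I C / user_value I w\<rfloor>)) = pay_gain I C w k r"
  unfolding pay_gain_def
  using assms user_valid budget_pos
  by (intro payment_integral cov_revenue_nonneg) (auto simp: pay_from_def pay_limit_def Let_def)

text \<open>Counterpart of \<open>approx_step_Units\<close>: lengths and quotas become integers and
  the integral becomes a finite sum.\<close>

lemma pay_step_Units:
  assumes w: "w \<in> users I" and k: "cur st \<in> users I" and D: "psched st = (\<lambda>i. Units (D i))" "unit_sched I D"
    and r: "rest st = tail I r" and C: "C = coverage I D" and j: "j = prec_max I (tail I r)"
  shows "pay_step I w st =
    (if free I C w \<noteq> {} \<and> ereal (pay_from I w (cur st)) \<le> pay_limit I C w r then
       if r < nu then
         if cov_quota I C j < int (card (free I C j))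
         then st\<lparr>pay := pay st + pay_gain I C w (cur st) r, psched := (\<lambda>i. Units (award I D j i)), exited := True\<rparr>
         else st\<lparr>pay := pay st + pay_gain I C w (cur st) r, psched := (\<lambda>i. Units (award I D j i)),
                 cur := j, theta := int (nu - r) - 1, rest := tail I r - {j}\<rparr>
       else st\<lparr>pay := pay st + pay_gain I C w (cur st) r, theta := theta st - 1\<rparr>
     else st\<lparr>exited := True\<rparr>)"
proof -
  have len: "len (free_time I (psched st) i) = real (card (free I C i))" for i
    by (simp add: D(1) C len_free_time)
  have pos: "0 < real (card (free I C w)) \<longleftrightarrow> free I C w \<noteq> {}" by (simp add: card_gt_0_iff)
  have rev: "revenue I (psched st) = cov_revenue I C" by (simp add: D C revenue_Units)
  have quo: "quota I (psched st) j = real_of_int (cov_quota I C j)" by (simp add: D C quota_Units)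
  have ne: "tail I r \<noteq> {} \<longleftrightarrow> r < nu" by (simp add: tail_empty_iff not_le)
  have lt: "real_of_int (cov_quota I C j) < real (card (free I C j)) \<longleftrightarrow>
      cov_quota I C j < int (card (free I C j))" by linarith
  have sch: "(if 0 < real_of_int (cov_quota I C j) then (psched st)(j := first_units (nat \<lfloor>real_of_int (cov_quota I C j)\<rfloor>)
      (free_time I (psched st) j)) else psched st) = (\<lambda>i. Units (award I D j i))"
    by (simp add: D(1) first_units_free_time award_def Units_upd C)
  have lim: "(if tail I r \<noteq> {} then min (ereal (user_value I w / user_value I j * unit_cost I j))
       (if cov_revenue I C = 0 then \<infinity> else ereal (user_value I w * budget I / (2 * cov_revenue I C)))
     else (if cov_revenue I C = 0 then \<infinity> else ereal (user_value I w * budget I / (2 * cov_revenue I C)))) =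
     pay_limit I C w r"
    by (simp only: ne pay_limit_def Let_def pay_from_def j)
  have from_eq: "user_value I w / user_value I (cur st) * unit_cost I (cur st) = pay_from I w (cur st)"
    by (simp add: pay_from_def)
  show ?thesis
  proof (cases "free I C w \<noteq> {} \<and> ereal (pay_from I w (cur st)) \<le> pay_limit I C w r")
    case False
    then show ?thesis
      unfolding pay_step_def Let_def r j[symmetric] rev len pos lim from_eq by (simp only: if_False)
  next
    case True
    note int = pay_integral_eq[OF w k conjunct2[OF True]]
    show ?thesis
      unfolding pay_step_def Let_def r j[symmetric] rev len pos lim from_eq int quo sch lt card_tail
      using True ne by (cases "r < nu") (simp_all add: of_nat_diff)
  qed
qed

section \<open>One round of the payment loop\<close>

abbreviation limits_com :: com where
  "limits_com \<equiv>
    (''g1'' :=\<^sub>r mu (V ''w'') /\<^sub>r mu (V ''k'') *\<^sub>r bid (V ''k'');;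
          (IF R ''rev'' =\<^sub>r Real (N 0) THEN ''inf'' :=\<^sub>i N 1
           ELSE (''inf'' :=\<^sub>i N 0;;
                 ''g2'' :=\<^sub>r mu (V ''w'') *\<^sub>r R ''G'' /\<^sub>r (Real (N 2) *\<^sub>r R ''rev'')));;
          (WHEN V ''r'' <\<^sub>i V ''n'' DO
             (''j'' :=\<^sub>i ''ord''.[V ''r'']\<^sub>i;;
              ''c'' :=\<^sub>r mu (V ''w'') /\<^sub>r mu (V ''j'') *\<^sub>r bid (V ''j'');;
              WHEN (V ''inf'' =\<^sub>i N 1 OR R ''c'' <\<^sub>r R ''g2'') DO
                (''inf'' :=\<^sub>i N 0;; ''g2'' :=\<^sub>r R ''c''))))"

lemma prec_max_tail_props:
  assumes "r < nu"
  shows "prec_max I (tail I r) \<in> users I" "prio I (prec_max I (tail I r)) = r"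
proof -
  obtain j where j: "j \<in> users I" "prio I j = r" using ex_prio[OF assms] by blast
  then have "prec_max I (tail I r) = j" using prec_max_tail by blast
  with j show "prec_max I (tail I r) \<in> users I" "prio I (prec_max I (tail I r)) = r" by auto
qed

text \<open>Without revenue, \<open>inf = 1\<close> lets the limit of the next user replace
  \<open>g2\<close> whatever value it holds; otherwise the comparison computes the minimum.\<close>

lemma runs_limits:
  assumes E: "env I s" and w: "w \<in> users I" "ivar s ''w'' = int w"
    and k: "k \<in> users I" "ivar s ''k'' = int k" and rev: "rvar s ''rev'' = cov_revenue I C"
    and r: "ivar s ''r'' = int r"
  shows "runs limits_com s (\<lambda>l s'. l \<le> 100 \<and> rvar s' ''g1'' = pay_from I w k \<and>
     limit_ok (pay_limit I C w r) s' \<and> (r < nu \<longrightarrow> ivar s' ''j'' = int (prec_max I (tail I r))))"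
proof (cases "r < nu")
  case True
  define j where "j = prec_max I (tail I r)"
  have j: "j \<in> users I" "prio I j = r" using prec_max_tail_props[OF True] by (auto simp: j_def)
  then have o: "iarr s ''ord'' (int r) = int j" using prio_okD(2)[of _ "iarr s ''ord''" j] E by auto
  define g where "g = user_value I w * budget I / (2 * cov_revenue I C)"
  note [simp] = inputsD[OF conjunct1[OF E]] w k j(1) o rev r True
  note lim = pay_limit_def[of I C w r, folded j_def g_def]
  show ?thesis
  proof (cases "cov_revenue I C = 0")
    case R: True
    then have "pay_limit I C w r = ereal (pay_from I w j)" by (simp add: lim Let_def)
    then show ?thesis using R by (simp add: limit_ok_def pay_from_def flip: j_def)
  next
    case R: False
    show ?thesis
    proof (cases "pay_from I w j < g")
      case True
      then have "pay_limit I C w r = ereal (pay_from I w j)" using R by (simp add: lim Let_def)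
      then show ?thesis using R True by (simp add: limit_ok_def pay_from_def g_def flip: j_def)
    next
      case False
      then have "pay_limit I C w r = ereal g" using R by (simp add: lim Let_def min_def)
      then show ?thesis using R False by (simp add: limit_ok_def pay_from_def g_def flip: j_def)
    qed
  qed
next
  case False
  note [simp] = inputsD[OF conjunct1[OF E]] w k rev r False
  show ?thesis
    by (cases "cov_revenue I C = 0") (simp_all add: limit_ok_def pay_limit_def pay_from_def Let_def)
qed

abbreviation next_com :: com where
  "next_com \<equiv>
    (count_free_com ''z'' (V ''j'');;
                 quota_com (V ''j'') ''z'';;
                 (WHEN N 0 <\<^sub>i V ''q'' DO take_com ''tt'' (V ''j''));;
                 IF V ''q'' <\<^sub>i V ''z'' THEN ''theta'' :=\<^sub>i N 0
                 ELSE (''k'' :=\<^sub>i V ''j'';;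
                       ''theta'' :=\<^sub>i V ''n'' -\<^sub>i V ''r'';;
                       ''r'' :=\<^sub>i V ''r'' +\<^sub>i N 1))"

lemma unit_sched_award:
  assumes "unit_sched I D" "j \<in> users I"
  shows "unit_sched I (award I D j)"
proof -
  have "firstn q (free I C j) \<subseteq> units I j" for q C
    using firstn_subset[of q "free I C j"] by (auto simp: free_def)
  then show ?thesis using unit_sched_upd[OF assms] assms(1) by (simp add: award_def)
qed

text \<open>An early exit leaves \<open>theta\<close> at 0 and not below, since the enclosing body
  still subtracts 1.\<close>

lemma runs_next:
  assumes E: "env I s" and j: "j \<in> users I" "ivar s ''j'' = int j" and D: "unit_sched I D" "D j = {}"
    and O: "occ_ok I (coverage I D) (iarr s ''occ'')" and rev: "rvar s ''rev'' = cov_revenue I (coverage I D)"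
    and r: "ivar s ''r'' = int r" "r < nu"
  shows "runs next_com s (\<lambda>k s'. k \<le> 250 * la \<and>
      occ_ok I (coverage I (award I D j)) (iarr s' ''occ'') \<and>
      rvar s' ''rev'' = cov_revenue I (coverage I (award I D j)) \<and>
      (if cov_quota I (coverage I D) j < int (card (free I (coverage I D) j)) then ivar s' ''theta'' = 0
       else ivar s' ''k'' = int j \<and> ivar s' ''theta'' = int (nu - r) \<and> ivar s' ''r'' = int (Suc r)))"
proof -
  let ?C = "coverage I D"
  define q where "q = cov_quota I ?C j"
  let ?F = "free I ?C j"
  show ?thesis
    apply (simp only: runs_simps(6))
    apply (rule runs_conseq[OF runs_count_free[OF E j _ _ _ O]])
       apply simp_all[3]
    subgoal premises p1 for k1 s1
    proof -
      have 1: "env I s1" "ivar s1 ''j'' = int j" "occ_ok I ?C (iarr s1 ''occ'')" "rvar s1 ''rev'' = cov_revenue I ?C"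
        "ivar s1 ''r'' = int r" "ivar s1 ''z'' = int (card ?F)"
        using frameD[OF p1(2)] E j O rev r p1(1) by simp_all
      show ?thesis
        apply (rule runs_conseq[OF runs_quota[OF conjunct1[OF 1(1)] j(1) 1(2) _ _ 1(6,4), folded q_def]])
          apply simp_all[2]
        subgoal premises p2 for k2 s2
        proof -
          have 2: "env I s2" "ivar s2 ''j'' = int j" "occ_ok I ?C (iarr s2 ''occ'')" "rvar s2 ''rev'' = cov_revenue I ?C"
            "ivar s2 ''r'' = int r" "ivar s2 ''z'' = int (card ?F)" "ivar s2 ''q'' = q"
            using frameD[OF p2(2)] 1 p2(1) by simp_all
          show ?thesis
          proof (cases "0 < q")
            case True
            then have q: "ivar s2 ''q'' = int (nat q)" using 2 by simp
            note card = card_award[OF True[unfolded q_def], folded q_def]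
            have aw: "award I D j = D(j := firstn (nat q) ?F)" using True by (simp add: award_def q_def)
            note cov = coverage_award[OF D(1) j(1) D(2) firstn_subset[of "nat q"]]
            show ?thesis
              apply (simp only: runs_When bval.simps ival.simps 2(7) True if_True)
              apply (rule runs_conseq[OF runs_take[OF 2(1) j(1) 2(2) _ _ 2(3) q card(1)]])
                 apply simp_all[3]
              subgoal premises p3 for k3 s3
              proof -
                have 3: "ivar s3 ''n'' = int nu" "ivar s3 ''j'' = int j" "ivar s3 ''r'' = int r"
                  "ivar s3 ''z'' = int (card ?F)" "ivar s3 ''q'' = q"
                  using frameD[OF p3(2)] 2 inputsD(1)[OF conjunct1[OF 2(1)]] by simp_all
                have k3: "k1 + k2 + k3 + 60 \<le> 250 * la" using p1(1) p2(1) p3(1) la_pos by linarith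
                have "occ_ok I (coverage I (award I D j)) (iarr s3 ''occ'')"
                  using p3(1) unfolding aw cov(1) by simp
                moreover have "rvar s3 ''rev'' = cov_revenue I (coverage I (award I D j))"
                  using p3(1) 2(4) card(2) unfolding aw cov(2) by simp
                ultimately show ?thesis using k3 3 r(2) by (simp add: q_def[symmetric] of_nat_diff)
              qed
              done
          next
            case False
            have aw: "award I D j = D" using False by (simp add: award_def q_def)
            have "k1 + k2 + 60 \<le> 250 * la" using p1(1) p2(1) la_pos by linarith
            then show ?thesis using False 2 r(2) aw inputsD(1)[OF conjunct1[OF 2(1)]]
              by (simp add: q_def[symmetric] of_nat_diff)
          qed
        qed
        done
    qed
    done
qed

text \<open>The program never reads the schedule \<open>tt\<close>; \<open>occ\<close> and \<open>rev\<close> are all that matters.\<close>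

definition pay_rel :: "(nat \<Rightarrow> int set) \<Rightarrow> nat \<Rightarrow> pay_state \<Rightarrow> state \<Rightarrow> bool" where
  "pay_rel D r st s \<longleftrightarrow> psched st = (\<lambda>i. Units (D i)) \<and> unit_sched I D \<and>
     occ_ok I (coverage I D) (iarr s ''occ'') \<and> rvar s ''rev'' = cov_revenue I (coverage I D) \<and>
     cur st \<in> users I \<and> ivar s ''k'' = int (cur st) \<and> r \<le> nu \<and> ivar s ''r'' = int r \<and>
     rest st = tail I r \<and> theta st = int (nu - r) \<and> ivar s ''theta'' = int (nu - r) \<and>
     (\<forall>i\<in>tail I r. D i = {}) \<and> rvar s ''pay'' = pay st \<and> \<not> exited st"

abbreviation pay_body :: com where
  "pay_body \<equiv>
    (count_free_com ''z1'' (V ''w'');;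
          ''g1'' :=\<^sub>r mu (V ''w'') /\<^sub>r mu (V ''k'') *\<^sub>r bid (V ''k'');;
          (IF R ''rev'' =\<^sub>r Real (N 0) THEN ''inf'' :=\<^sub>i N 1
           ELSE (''inf'' :=\<^sub>i N 0;;
                 ''g2'' :=\<^sub>r mu (V ''w'') *\<^sub>r R ''G'' /\<^sub>r (Real (N 2) *\<^sub>r R ''rev'')));;
          (WHEN V ''r'' <\<^sub>i V ''n'' DO
             (''j'' :=\<^sub>i ''ord''.[V ''r'']\<^sub>i;;
              ''c'' :=\<^sub>r mu (V ''w'') /\<^sub>r mu (V ''j'') *\<^sub>r bid (V ''j'');;
              WHEN (V ''inf'' =\<^sub>i N 1 OR R ''c'' <\<^sub>r R ''g2'') DO
                (''inf'' :=\<^sub>i N 0;; ''g2'' :=\<^sub>r R ''c'')));;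
          IF (N 0 <\<^sub>i V ''z1'' AND (V ''inf'' =\<^sub>i N 1 OR NOT (R ''g2'' <\<^sub>r R ''g1''))) THEN
            (integral_com (V ''w'');;
             (WHEN V ''r'' <\<^sub>i V ''n'' DO next_com);;
             ''theta'' :=\<^sub>i V ''theta'' -\<^sub>i N 1)
          ELSE ''theta'' :=\<^sub>i N (- 1))"

text \<open>When the loop is about to end, only the sign of \<open>theta\<close> and the payment are
  asserted: the schedule is discarded afterwards, so the full relation need not survive the last
  round. Otherwise \<open>r\<close> grows by 1.\<close>

lemma runs_pay_body:
  assumes E: "env I s" and w: "w \<in> users I" "ivar s ''w'' = int w" and R: "pay_rel D r st s"
  shows "runs pay_body s (\<lambda>k s'. k \<le> 600 * la \<and>
    ((exited (pay_step I w st) \<or> theta (pay_step I w st) < 0) \<and> ivar s' ''theta'' < 0 \<and>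
        rvar s' ''pay'' = pay (pay_step I w st) \<or>
     r < nu \<and> (\<exists>D'. pay_rel D' (Suc r) (pay_step I w st) s')))"
proof -
  let ?C = "coverage I D"
  from R have R: "psched st = (\<lambda>i. Units (D i))" "unit_sched I D"
     "occ_ok I ?C (iarr s ''occ'')" "rvar s ''rev'' = cov_revenue I ?C"
     "cur st \<in> users I" "ivar s ''k'' = int (cur st)" "r \<le> nu" "ivar s ''r'' = int r"
     "rest st = tail I r" "theta st = int (nu - r)" "ivar s ''theta'' = int (nu - r)"
     "\<And>i. i \<in> tail I r \<Longrightarrow> D i = {}" "rvar s ''pay'' = pay st" "\<not> exited st"
    by (auto simp: pay_rel_def)
  define j where "j = prec_max I (tail I r)"
  define z where "z = card (free I ?C w)"
  define g where "g = pay_limit I ?C w r"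
  note step = pay_step_Units[OF w(1) R(5,1,2,9) refl j_def]
  have z: "z \<le> la"
  proof -
    have "z \<le> card (units I w)" unfolding z_def by (rule card_mono) (auto simp: free_def)
    then show ?thesis using user_valid(4)[OF w(1)] by (simp add: units_def)
  qed
  have z0: "0 < z \<longleftrightarrow> free I ?C w \<noteq> {}" by (simp add: z_def card_gt_0_iff)
  show ?thesis
    apply (simp only: runs_middle)
    apply (rule runs_conseq[OF runs_count_free[OF E w _ _ _ R(3), folded z_def]])
       apply simp_all[3]
    subgoal premises p1 for k1 s1
    proof -
      have 1: "env I s1" "ivar s1 ''w'' = int w" "ivar s1 ''k'' = int (cur st)" "rvar s1 ''rev'' = cov_revenue I ?C"
        "ivar s1 ''r'' = int r"
        using frameD[OF p1(2)] E w R by simp_all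
      show ?thesis
        apply (rule runs_conseq[OF runs_limits[OF 1(1) w(1) 1(2) R(5) 1(3,4,5), folded j_def g_def]])
        subgoal premises p2 for k2 s2
        proof -
          have 2: "env I s2" "ivar s2 ''w'' = int w" "rvar s2 ''rev'' = cov_revenue I ?C"
            "ivar s2 ''r'' = int r" "ivar s2 ''z1'' = int z" "occ_ok I ?C (iarr s2 ''occ'')"
            "ivar s2 ''theta'' = int (nu - r)" "rvar s2 ''pay'' = pay st" "ivar s2 ''n'' = int nu"
            using frameD[OF p2(2)] 1 frameD[OF p1(2)] R p1(1) inputsD(1)[OF conjunct1[OF 1(1)]] by simp_all
          have cond: "bval (N 0 <\<^sub>i V ''z1'' AND (V ''inf'' =\<^sub>i N 1 OR NOT (R ''g2'' <\<^sub>r R ''g1''))) s2 \<longleftrightarrow>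
              free I ?C w \<noteq> {} \<and> ereal (pay_from I w (cur st)) \<le> g"
            using p2(1) 2(5) by (auto simp: limit_ok_def z0[symmetric])
          have k2: "k1 + k2 \<le> 150 * la" using p1(1) p2(1) la_pos by linarith
          show ?thesis
          proof (cases "free I ?C w \<noteq> {} \<and> ereal (pay_from I w (cur st)) \<le> g")
            case False
            then have st': "pay_step I w st = st\<lparr>exited := True\<rparr>"
              unfolding step g_def by (simp only: if_False)
            have "k1 + k2 + 60 \<le> 600 * la" using k2 la_pos by linarith
            then show ?thesis
              unfolding runs_simps(7) cond if_not_P[OF False] using st' 2 by simp
          next
            case True
            note st' = step[unfolded g_def[symmetric], unfolded if_P[OF True]]
            show ?thesis
              apply (simp only: runs_simps(6,7) cond True simp_thms if_True)
              apply (rule runs_conseq[OF runs_integral[OF conjunct1[OF 2(1)] w(1) 2(2,5) z conjunct1[OF conjunct2[OF conjunct2[OF p2(1)]]]]])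
              subgoal premises p3 for k3 s3
              proof -
                have 3: "env I s3" "ivar s3 ''w'' = int w" "rvar s3 ''rev'' = cov_revenue I ?C"
                  "ivar s3 ''r'' = int r" "occ_ok I ?C (iarr s3 ''occ'')" "ivar s3 ''theta'' = int (nu - r)"
                  "ivar s3 ''n'' = int nu" "r < nu \<Longrightarrow> ivar s3 ''j'' = int j"
                  using frameD[OF p3(2)] 2 p2(1) by simp_all
                have pay3: "rvar s3 ''pay'' = pay st + pay_gain I ?C w (cur st) r"
                  using p3(1) p2(1) 2 by (simp add: pay_gain_def g_def z_def)
                have k3: "k1 + k2 + k3 + 60 \<le> 300 * la" using k2 p3(1) la_pos by linarith
                show ?thesis
                proof (cases "r < nu")
                  case False
                  \<comment> \<open>No user is left, so \<open>theta\<close> equals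
                    \<open>nu - r = 0\<close> and drops to -1.\<close>
                  then show ?thesis
                    using 3 pay3 k3 R(7,10) st' la_pos by simp
                next
                  case True
                  have ju: "j \<in> users I" "prio I j = r" using prec_max_tail_props[OF True] by (auto simp: j_def)
                  then have jt: "j \<in> tail I r" by (simp add: tail_def)
                  have rm: "tail I r - {j} = tail I (Suc r)" using tail_remove[OF ju(1)] ju(2) by simp
                  have D': "award I D j i = {}" if "i \<in> tail I (Suc r)" for i
                  proof -
                    have "i \<in> tail I r" "i \<noteq> j" using that rm by blast+
                    then show ?thesis using R(12) by (simp add: award_def)
                  qed
                  show ?thesis
                    apply (simp only: runs_When bval.simps ival.simps 3 of_nat_less_iff True if_True)
                    apply (rule runs_conseq[OF runs_next[OF 3(1) ju(1) 3(8)[OF True] R(2) R(12)[OF jt] 3(5,3,4) True]])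
                    subgoal premises p4 for k4 s4
                    proof -
                      have pay4: "rvar s4 ''pay'' = pay st + pay_gain I ?C w (cur st) r"
                        using frameD[OF p4(2)] pay3 by simp
                      have k4: "k1 + k2 + k3 + k4 + 60 \<le> 600 * la" using k3 p4(1) la_pos by linarith
                      show ?thesis
                      proof (cases "cov_quota I ?C j < int (card (free I ?C j))")
                        case q: True
                        then show ?thesis using True st' p4(1) pay4 k4 by simp
                      next
                        case q: False
                        have "pay_rel (award I D j) (Suc r) (pay_step I w st)
                            (s4\<lparr>ivar := (ivar s4)(''theta'' := ivar s4 ''theta'' - 1)\<rparr>)"
                          using True q st' p4(1) pay4 ju(1) rm D' R(14) unit_sched_award[OF R(2) ju(1)]
                          by (simp add: pay_rel_def of_nat_diff)
                        then show ?thesis using True k4 by auto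
                      qed
                    qed
                    done
                qed
              qed
              done
          qed
        qed
        done
    qed
    done
qed

end

section \<open>Algorithm 2\<close>

context market
begin

text \<open>\<open>r\<close> grows in every round that goes on and never passes \<open>nu\<close>.
  This leaves at most \<open>nu + 1 - r\<close> rounds, the additional one being the round in which
  no user remains.\<close>

lemma runs_pay_loop:
  assumes "env I s" "w \<in> users I" "ivar s ''w'' = int w" "pay_rel D r st s"
  shows "runs (WHILE NOT (V ''theta'' <\<^sub>i N 0) DO pay_body) s
    (\<lambda>k s'. k \<le> (nu + 1 - r) * (610 * la) + 10 \<and>
       rvar s' ''pay'' = pay (while (\<lambda>st. \<not> exited st \<and> theta st \<ge> 0) (pay_step I w) st))"
  using assms
proof (induction "nu - r" arbitrary: s D r st rule: less_induct)
  case less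
  let ?loop = "WHILE NOT (V ''theta'' <\<^sub>i N 0) DO pay_body" and ?st = "pay_step I w st"
  let ?while = "while (\<lambda>st. \<not> exited st \<and> theta st \<ge> 0) (pay_step I w)"
  have R: "\<not> exited st" "0 \<le> theta st" "0 \<le> ivar s ''theta''" "r \<le> nu"
    using less.prems(4) by (auto simp: pay_rel_def)
  have run: "runs pay_body s (\<lambda>k s'. runs ?loop s' (\<lambda>l s''. 5 + k + l \<le>
       (nu + 1 - r) * (610 * la) + 10 \<and> rvar s'' ''pay'' = pay (?while ?st)))"
  proof (rule runs_conseq[OF runs_pay_body[OF less.prems]])
    fix k s'
    assume p: "k \<le> 600 * la \<and>
      ((exited ?st \<or> theta ?st < 0) \<and> ivar s' ''theta'' < 0 \<and> rvar s' ''pay'' = pay ?st \<or>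
       r < nu \<and> (\<exists>D'. pay_rel D' (Suc r) ?st s'))" and "frame pay_body s s'"
    note f = frameD[OF this(2)]
    have k: "k + 10 \<le> 610 * la" using p la_pos by linarith
    from p consider (stop) "exited ?st \<or> theta ?st < 0" "ivar s' ''theta'' < 0" "rvar s' ''pay'' = pay ?st"
      | (go) D' where "r < nu" "pay_rel D' (Suc r) ?st s'" by blast
    then show "runs ?loop s' (\<lambda>l s''. 5 + k + l \<le>
       (nu + 1 - r) * (610 * la) + 10 \<and> rvar s'' ''pay'' = pay (?while ?st))"
    proof cases
      case stop
      have "1 * (610 * la) \<le> (nu + 1 - r) * (610 * la)" using R(4) by (intro mult_le_mono1) simp
      then have "5 + k + 5 \<le> (nu + 1 - r) * (610 * la) + 10" using k by linarith
      moreover have "?while ?st = ?st" using stop(1) by (subst while_unfold) auto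
      ultimately show ?thesis using stop by (subst runs_Loop) simp
    next
      case go
      have E: "env I s'" "ivar s' ''w'' = int w" using f less.prems by simp_all
      have lt: "nu - Suc r < nu - r" using go(1) by simp
      show ?thesis
      proof (rule runs_mono[OF less.hyps[OF lt E(1) less.prems(2) E(2) go(2)]])
        fix l s''
        assume q: "l \<le> (nu + 1 - Suc r) * (610 * la) + 10 \<and> rvar s'' ''pay'' = pay (?while ?st)"
        have "nu + 1 - r = Suc (nu + 1 - Suc r)" using go(1) by simp
        then have "5 + k + l \<le> (nu + 1 - r) * (610 * la) + 10"
          using q k by (simp only: mult_Suc) linarith
        then show "5 + k + l \<le> (nu + 1 - r) * (610 * la) + 10 \<and> rvar s'' ''pay'' = pay (?while ?st)"
          using q by blast
      qed
    qed
  qed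
  have "?while st = ?while ?st" using R by (subst while_unfold) simp
  then show ?case using run R by (subst runs_Loop) simp
qed

lemma w_payment [simp]:
  "wiv payment_com = {''w'', ''x'', ''l'', ''j'', ''t'', ''c'', ''k'', ''r'', ''theta'', ''z1'', ''inf'', ''a'', ''z'', ''q''}"
  "wrv payment_com = {''rev'', ''pay'', ''g1'', ''g2'', ''c''}"
  "wia payment_com = {''occ'', ''tt''}" "wra payment_com = {''p''}"
  by (auto simp: payment_com_def)

text \<open>Winners are selected in decreasing order, so everyone awarded before
  \<open>W ! m\<close> lies above her and outside the tail. The users still to be examined therefore
  hold nothing.\<close>

lemma pay_init_rel:
  assumes D: "sched_wf I D W" and m: "m < length W"
    and O: "occ_ok I (coverage I (prefix D W m)) (iarr s ''occ'')"
    and rev: "rvar s ''rev'' = cov_revenue I (coverage I (prefix D W m))"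
    and s: "ivar s ''k'' = int (W ! m)" "ivar s ''r'' = int (prio I (W ! m)) + 1"
      "ivar s ''theta'' = int nu - (int (prio I (W ! m)) + 1)"
      "rvar s ''pay'' = unit_cost I (W ! m) * card (D (W ! m))"
  shows "pay_rel (prefix D W m) (prio I (W ! m) + 1) (pay_init I (\<lambda>i. Units (D i)) (take m W) (W ! m)) s"
proof -
  let ?w = "W ! m"
  note pf = prefix_facts[OF D m]
  have rk: "prio I ?w + 1 \<le> nu" using prio_less_num_users[OF pf(3)] by simp
  have none: "prefix D W m i = {}" if "i \<in> tail I (prio I ?w + 1)" for i
  proof -
    have "prec I i ?w" using that below_eq_tail[OF pf(3)] by blast
    moreover have "prec I ?w i" if "i \<in> set (take m W)"
    proof -
      from that obtain l where l: "l < m" "i = W ! l" using m by (auto simp: in_set_conv_nth)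
      then show ?thesis using D m by (auto simp: sched_wf_def sorted_wrt_iff_nth_less)
    qed
    ultimately show ?thesis using prec_asym by (auto simp: prefix_def)
  qed
  have "(\<lambda>i. if i \<in> set (take m W) then Units (D i) else {}) = (\<lambda>i. Units (prefix D W m i))"
    by (auto simp: prefix_def fun_eq_iff Units_def)
  moreover have "finite (D ?w)" using D finite_sched[of I D] by (simp add: sched_wf_def)
  moreover have "int nu - (int (prio I ?w) + 1) = int (nu - (prio I ?w + 1))" using rk by simp
  ultimately show ?thesis
    using pf O rev s rk none
    by (simp add: pay_rel_def pay_init_def below_eq_tail card_tail len_Units Let_def)
qed

lemma runs_payment:
  assumes E: "env I s" and D: "sched_wf I D W" and W: "wins_ok W h (iarr s ''W'')"
    and y: "marks_ok I D (iarr s ''y'')" and m: "m < length W" "ivar s ''b'' = int m + 1"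
  shows "runs payment_com s (\<lambda>k s'. k \<le> 1700 * (nu * la) \<and>
     rarr s' ''p'' = (rarr s ''p'')(int (W ! m) :=
       cal_payment I (\<lambda>i. Units (D i)) (takeWhile (\<lambda>l. l \<noteq> W ! m) W) (W ! m)))"
proof -
  let ?w = "W ! m" and ?Y = "\<lambda>i. Units (D i)"
  note pf = prefix_facts[OF D m(1)]
  \<comment> \<open>Winners are distinct, so the list before the first occurrence of
    \<open>?w\<close> consists of the first \<open>m\<close> winners.\<close>
  have before: "takeWhile (\<lambda>l. l \<noteq> ?w) W = take m W"
    using m(1) sched_wf_distinct[OF D] by (intro takeWhile_eq_take_P_nth) (auto simp: nth_eq_iff_index_eq)
  define s1 where "s1 = s\<lparr>ivar := (ivar s)(''w'' := int ?w)\<rparr>"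
  have w1: "iarr s ''W'' (ivar s ''b'') = int ?w" using wins_okD[OF W m(1)] m(2) by simp
  have 1: "env I s1" "ivar s1 ''w'' = int ?w" "wins_ok W h (iarr s1 ''W'')" "marks_ok I D (iarr s1 ''y'')"
    "ivar s1 ''b'' = int m + 1" "rarr s1 ''p'' = rarr s ''p''"
    using E W y m by (simp_all add: s1_def)
  have clear: "runs (clear_com ''tt'') s1 (\<lambda>k s'. k \<le> 60 * (nu * la) \<and>
      occ_ok I (\<lambda>_. {}) (iarr s' ''occ'') \<and> marks_ok I (\<lambda>_. {}) (iarr s' ''tt'') \<and> rvar s' ''rev'' = 0)"
    using 1 by (intro runs_clear) auto
  show ?thesis
    unfolding payment_com_def
    apply (simp only: runs_simps(2,6) ival.simps w1 flip: s1_def)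
    apply (rule runs_conseq[OF clear])
    subgoal premises p1 for k1 s2
    proof -
      have 2: "env I s2" "ivar s2 ''w'' = int ?w" "wins_ok W h (iarr s2 ''W'')" "marks_ok I D (iarr s2 ''y'')"
        "ivar s2 ''b'' = int m + 1" "rarr s2 ''p'' = rarr s ''p''"
        using frameD[OF p1(2)] 1 by simp_all
      show ?thesis
        apply (rule runs_conseq[OF runs_refill[OF 2(1) D 2(3,4) _ _ m(1) 2(5)]])
        using p1(1) apply simp_all[2]
        subgoal premises p2 for k2 s3
        proof -
          define s4 where "s4 = s3\<lparr>ivar := (ivar s3)(''c'' := 0)\<rparr>"
          have 4: "env I s4" "ivar s4 ''w'' = int ?w" "marks_ok I D (iarr s4 ''y'')"
            "ivar s4 ''c'' = 0" "rarr s4 ''p'' = rarr s ''p''"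
            "occ_ok I (coverage I (prefix D W m)) (iarr s4 ''occ'')"
            "rvar s4 ''rev'' = cov_revenue I (coverage I (prefix D W m))"
            using frameD[OF p2(2)] 2 p2(1) by (simp_all add: s4_def)
          have Du: "D ?w \<subseteq> units I ?w" using pf(4) by (auto simp: free_def)
          show ?thesis
            apply (simp only: s4_def[symmetric])
            apply (rule runs_conseq[OF runs_own[OF 4(1) pf(3) 4(2,4,3) Du]])
            subgoal premises p3 for k3 s5
            proof -
              have 5: "env I s5" "ivar s5 ''w'' = int ?w" "rarr s5 ''p'' = rarr s ''p''"
                "occ_ok I (coverage I (prefix D W m)) (iarr s5 ''occ'')"
                "rvar s5 ''rev'' = cov_revenue I (coverage I (prefix D W m))" "ivar s5 ''c'' = int (card (D ?w))"
                using frameD[OF p3(2)] 4 p3(1) by simp_all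
              note io = inputsD[OF conjunct1[OF 5(1)]]
              have rk: "iarr s5 ''rank'' (int ?w) = int (prio I ?w)"
                using prio_okD(1)[of "iarr s5 ''rank''"] 5(1) pf(3) by blast
              define s6 where "s6 = s5\<lparr>rvar := (rvar s5)(''pay'' := unit_cost I ?w * real (card (D ?w))),
                ivar := (ivar s5)(''k'' := int ?w, ''r'' := int (prio I ?w) + 1,
                   ''theta'' := int nu - (int (prio I ?w) + 1))\<rparr>"
              have 6: "env I s6" "ivar s6 ''w'' = int ?w" "rarr s6 ''p'' = rarr s ''p''"
                using 5 by (simp_all add: s6_def)
              have rel: "pay_rel (prefix D W m) (prio I ?w + 1) (pay_init I ?Y (take m W) ?w) s6"
                by (rule pay_init_rel[OF D m(1)]) (use 5 in \<open>simp_all add: s6_def\<close>)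
              have "runs (WHILE NOT (V ''theta'' <\<^sub>i N 0) DO pay_body) s6 (\<lambda>k4 s7.
                 k1 + k2 + k3 + k4 + 60 \<le> 1700 * (nu * la) \<and>
                 rarr s7 ''p'' = rarr s ''p'' \<and> ivar s7 ''w'' = int ?w \<and>
                 rvar s7 ''pay'' = cal_payment I ?Y (take m W) ?w)"
              proof (rule runs_conseq[OF runs_pay_loop[OF 6(1) pf(3) 6(2) rel]])
                fix k4 s7
                assume p4: "k4 \<le> (nu + 1 - (prio I ?w + 1)) * (610 * la) + 10 \<and>
                  rvar s7 ''pay'' = pay (while (\<lambda>st. \<not> exited st \<and> theta st \<ge> 0) (pay_step I ?w)
                    (pay_init I ?Y (take m W) ?w))"
                  and fr: "frame (WHILE NOT (V ''theta'' <\<^sub>i N 0) DO pay_body) s6 s7"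
                have "(nu + 1 - (prio I ?w + 1)) * (610 * la) \<le> nu * (610 * la)"
                  by (intro mult_le_mono1) simp
                also have "\<dots> = 610 * (nu * la)" by simp
                finally have "k1 + k2 + k3 + k4 + 60 \<le> 1700 * (nu * la)"
                  using p1(1) p2(1) p3(1) p4 prod_pos by linarith
                then show "k1 + k2 + k3 + k4 + 60 \<le> 1700 * (nu * la) \<and>
                   rarr s7 ''p'' = rarr s ''p'' \<and> ivar s7 ''w'' = int ?w \<and>
                   rvar s7 ''pay'' = cal_payment I ?Y (take m W) ?w"
                  using p4 frameD[OF fr] 6 by (simp add: cal_payment_def)
              qed
              then show ?thesis
                apply (simp add: 5 io pf(3) rk flip: s6_def)
                apply (erule runs_mono)
                apply (simp add: before add.commute add.left_commute)
                done
            qed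
            done
        qed
        done
    qed
    done
qed

text \<open>\<open>payment_com\<close> writes neither \<open>y\<close> nor \<open>W\<close>, so by
  the frame each payment starts from the result of the selection. Losers keep the 0 stored
  beforehand.\<close>

lemma runs_payments:
  assumes E: "env I s" and D: "sched_wf I D W" and W: "wins_ok W (ivar s ''h'') (iarr s ''W'')"
    and y: "marks_ok I D (iarr s ''y'')" and p: "\<And>i. i \<in> users I \<Longrightarrow> rarr s ''p'' (int i) = 0"
  shows "runs (FOR ''b'' FROM N 1 UNTO V ''h'' +\<^sub>i N 1 DO payment_com) s (\<lambda>k s'. k \<le> 1800 * (nu * nu * la) \<and>
     (\<forall>i\<in>users I. rarr s' ''p'' (int i) = (if i \<in> set W
        then cal_payment I (\<lambda>i. Units (D i)) (takeWhile (\<lambda>l. l \<noteq> i) W) i else 0)))"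
proof -
  let ?pay = "\<lambda>i. cal_payment I (\<lambda>i. Units (D i)) (takeWhile (\<lambda>l. l \<noteq> i) W) i"
  have h: "ivar s ''h'' = int (length W)" using W by (simp add: wins_ok_def)
  show ?thesis
    apply (rule runs_conseq[OF runs_For[where B = "int (length W) + 1" and M = nu and K = "1800 * (nu * la)" and
      Inv = "\<lambda>x s'. \<forall>i\<in>users I. rarr s' ''p'' (int i) = (if i \<in> set (take (nat (x - 1)) W) then ?pay i else 0)"]])
    subgoal using p by simp
    subgoal premises q for x s1
    proof -
      obtain m where m: "x = int m + 1" using q(1) by (intro that[of "nat (x - 1)"]) auto
      then have ml: "m < length W" using q(2) by simp
      have 1: "env I s1" "wins_ok W (ivar s ''h'') (iarr s1 ''W'')" "marks_ok I D (iarr s1 ''y'')"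
        "ivar s1 ''b'' = int m + 1"
        using frameD[OF q(5)] E W y q(4) m by simp_all
      show ?thesis
      proof (rule runs_conseq[OF runs_payment[OF 1(1) D 1(2,3) ml 1(4)]], goal_cases)
        case (1 k s2)
        have "ivar s2 ''b'' = x" using frameD[OF 1(2)] q(4) by simp
        moreover have "k + 20 \<le> 1800 * (nu * la)" using 1(1) prod_pos(1) by linarith
        moreover have "nat (1 + int m) = Suc m" by simp
        moreover have "\<forall>i\<in>users I. rarr s2 ''p'' (int i) = (if i \<in> set (take (Suc m) W) then ?pay i else 0)"
          using 1(1) q(3) m by (auto simp: take_Suc_conv_app_nth[OF ml])
        ultimately show ?case using m by simp
      qed
    qed
    subgoal premises q for s' using frameD[OF q] h by simp
    subgoal by simp
    subgoal using length_winners[OF D] by simp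
    subgoal by (rule num_users_pos)
    subgoal
    proof -
      have "19 \<le> 1800 * (nu * la)" using prod_pos(1) by linarith
      then show ?thesis by simp
    qed
    subgoal premises q for k s' using q(1) by (simp add: mult.assoc mult.left_commute)
    done
qed

lemma schedule_of_marks:
  assumes "marks_ok I D (iarr s ''y'')" "unit_sched I D"
  shows "schedule_of I s = (\<lambda>i. Units (D i))"
proof
  fix i
  show "schedule_of I s i = Units (D i)"
  proof (cases "i \<in> users I")
    case True
    have "{t. i \<in> users I \<and> start_time I i \<le> t \<and> t < end_time I i \<and> iarr s ''y'' (position I i t) = 1} = D i"
      using assms(1) True unit_schedD[OF assms(2) True] by (auto simp: marks_ok_def units_def)
    then show ?thesis by (simp add: schedule_of_def Units_def)
  next
    case False
    then have "D i = {}" using assms(2) unfolding unit_sched_def by (metis subset_empty)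
    then show ?thesis using False by (simp add: schedule_of_def Units_def)
  qed
qed

section \<open>The branch with a single selected user\<close>

lemma w_single [simp]:
  "wiv single_com = {''x'', ''j'', ''i''}" "wrv single_com = {''rev''}"
  "wia single_com = {''occ'', ''y''}" "wra single_com = {''p''}"
  by (auto simp: single_com_def)

lemma runs_single:
  assumes E: "inputs I s" "off_ok I (iarr s ''off'')"
    and p: "\<And>i. i \<in> users I \<Longrightarrow> rarr s ''p'' (int i) = 0"
  shows "runs single_com s (\<lambda>k s'. k \<le> 200 * (nu * la) \<and>
    (schedule_of I s', payments_of I s') \<in> mechanism I False)"
proof -
  let ?E = "{i \<in> users I. unit_cost I i \<le> budget I}"
  have clear: "runs (clear_com ''y'') s (\<lambda>k s'. k \<le> 60 * (nu * la) \<and>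
      occ_ok I (\<lambda>_. {}) (iarr s' ''occ'') \<and> marks_ok I (\<lambda>_. {}) (iarr s' ''y'') \<and> rvar s' ''rev'' = 0)"
    using E by (intro runs_clear) auto
  \<comment> \<open>Again 0 encodes that no affordable user has been met. Scanning upwards with a
    strict comparison keeps the smallest index among users of equal value, as \<open>Min\<close>
    demands.\<close>
  define Best where "Best i j \<longleftrightarrow>
     (j = 0 \<and> (\<forall>l\<in>?E. \<not> int l < i)) \<or>
     (\<exists>m\<in>?E. int m < i \<and> j = int m \<and> (\<forall>l\<in>?E. int l < i \<longrightarrow> user_value I l \<le> user_value I m \<and>
        (user_value I l = user_value I m \<longrightarrow> m \<le> l)))" for i j
  have Epos: "l \<in> ?E \<Longrightarrow> 1 \<le> l \<and> l \<le> nu" for l by (auto simp: users_def)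
  have le: "int l < int i + 1 \<longleftrightarrow> int l < int i \<or> l = i" for l i by auto
  show ?thesis
    unfolding single_com_def
    apply (simp only: runs_simps(6))
    apply (rule runs_conseq[OF clear])
    subgoal premises p1 for k1 s1
    proof -
      define s2 where "s2 = s1\<lparr>ivar := (ivar s1)(''j'' := 0)\<rparr>"
      have 2: "inputs I s2" "off_ok I (iarr s2 ''off'')" "rarr s2 ''p'' = rarr s ''p''"
        "marks_ok I (\<lambda>_. {}) (iarr s2 ''y'')" "ivar s2 ''j'' = 0"
        using frameD[OF p1(2)] E p1(1) by (simp_all add: s2_def)
      note [simp] = inputsD[OF 2(1)]
      show ?thesis
        apply (simp only: runs_simps(2) ival.simps flip: s2_def)
        apply (rule runs_conseq[OF runs_For[where B = "int nu + 1" and M = nu and K = 60 and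
          Inv = "\<lambda>i s'. Best i (ivar s' ''j'')"]])
        subgoal using 2(5) Epos by (force simp: Best_def)
        subgoal premises q for i' s'
        proof -
          obtain i where i: "i \<in> users I" "i' = int i" using q(1,2) by (auto elim: int_of_user)
          have iv: "ivar s' ''i'' = int i" using q(4) i by simp
          have sv: "rvar s' ''G'' = budget I" "rarr s' ''d'' = rarr s2 ''d''" "rarr s' ''u'' = rarr s2 ''u''"
            "iarr s' ''kappa'' = iarr s2 ''kappa''"
            using frameD[OF q(5)] by simp_all
          consider (out) "i \<notin> ?E" | (first) "i \<in> ?E" "ivar s' ''j'' = 0" "\<forall>l\<in>?E. \<not> int l < int i"
            | (better) m where "i \<in> ?E" "m \<in> ?E" "int m < int i" "ivar s' ''j'' = int m"
              "\<forall>l\<in>?E. int l < int i \<longrightarrow> user_value I l \<le> user_value I m \<and>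
                 (user_value I l = user_value I m \<longrightarrow> m \<le> l)"
            using q(3) i unfolding Best_def by blast
          then show ?thesis
          proof cases
            case out
            then have "Best (int i + 1) (ivar s' ''j'')" using q(3) i unfolding Best_def le by blast
            then show ?thesis using out iv i sv by simp
          next
            case first
            then have "Best (int i + 1) (int i)" unfolding Best_def le
              by (intro disjI2 bexI[of _ i]) auto
            then show ?thesis using first iv i sv by simp
          next
            case (better m)
            have mu: "m \<in> users I" "0 < m" using better(2) Epos[OF better(2)] by auto
            show ?thesis
            proof (cases "user_value I m < user_value I i")
              case True
              then have "Best (int i + 1) (int i)" using better unfolding Best_def le
                by (intro disjI2 bexI[of _ i]) force+
              then show ?thesis using better iv i sv True mu by simp
            next
              case False
              then have "Best (int i + 1) (int m)" using better unfolding Best_def le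
                by (intro disjI2 bexI[of _ m]) auto
              then show ?thesis using better iv i sv False mu by simp
            qed
          qed
        qed
        subgoal premises q for s' using frameD[OF q] by simp
        subgoal by simp
        subgoal by simp
        subgoal by (rule num_users_pos)
        subgoal by simp
        subgoal premises q for k2 s3
        proof -
          have 3: "inputs I s3" "off_ok I (iarr s3 ''off'')" "rarr s3 ''p'' = rarr s ''p''"
            "marks_ok I (\<lambda>_. {}) (iarr s3 ''y'')"
            using frameD[OF q(2)] 2 by simp_all
          have k: "k1 + k2 + 40 \<le> 200 * (nu * la)" using p1(1) q(1) prod_pos by linarith
          have us: "unit_sched I (\<lambda>_. {})" by (simp add: unit_sched_def)
          show ?thesis
          proof (cases "?E = {}")
            case True
            then have j: "ivar s3 ''j'' = 0" using q(1) unfolding Best_def by blast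
            have "schedule_of I s3 = (\<lambda>_. {})"
              using schedule_of_marks[OF 3(4) us] by (simp add: Units_def)
            moreover have "payments_of I s3 = (\<lambda>_. 0)" using 3(3) p by (simp add: payments_of_def fun_eq_iff)
            ultimately have "(schedule_of I s3, payments_of I s3) \<in> mechanism I False"
              unfolding mechanism_def Let_def using True by simp
            then show ?thesis using j k by simp
          next
            case False
            then obtain l where "l \<in> ?E" by blast
            moreover then have "int l < int nu + 1" using Epos by force
            ultimately obtain m where m: "m \<in> ?E" "ivar s3 ''j'' = int m" "\<forall>l\<in>?E. int l < int nu + 1 \<longrightarrow>
              user_value I l \<le> user_value I m \<and> (user_value I l = user_value I m \<longrightarrow> m \<le> l)"
              using q(1) unfolding Best_def by blast
            have best: "user_value I l \<le> user_value I m" "user_value I l = user_value I m \<Longrightarrow> m \<le> l" if "l \<in> ?E" for l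
            proof -
              have "int l < int nu + 1" using Epos[OF that] by linarith
              then show "user_value I l \<le> user_value I m" "user_value I l = user_value I m \<Longrightarrow> m \<le> l"
                using m(3) that by blast+
            qed
            have min: "Min {i \<in> ?E. \<forall>l\<in>?E. user_value I l \<le> user_value I i} = m"
            proof (rule Min_eqI)
              fix i assume "i \<in> {i \<in> ?E. \<forall>l\<in>?E. user_value I l \<le> user_value I i}"
              then have "i \<in> ?E" "user_value I m \<le> user_value I i" using m(1) by blast+
              then show "m \<le> i" using best[of i] by simp
            qed (use m(1) best in auto)
            have mu: "m \<in> users I" using m(1) by blast
            have st: "start_time I m < end_time I m" using user_valid(3)[OF mu] .
            \<comment> \<open>The mechanism leaves the time unit open; the program takes the first
              one of user \<open>m\<close>.\<close>
            define s4 where "s4 = s3\<lparr>iarr := (iarr s3)(''y'' := (iarr s3 ''y'')(position I m (start_time I m) := 1)),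
               rarr := (rarr s3)(''p'' := (rarr s3 ''p'')(int m := budget I))\<rparr>"
            have "marks_ok I ((\<lambda>_. {})(m := {start_time I m})) (iarr s4 ''y'')"
            proof -
              have "(iarr s3 ''y'')(position I m (start_time I m) := 1) =
                  (\<lambda>x. if x \<in> position I m ` {start_time I m} then 1 else iarr s3 ''y'' x)"
                by (simp add: fun_eq_iff)
              then show ?thesis
                using marks_ok_upd[OF 3(4) mu, of "{start_time I m}"] st by (simp add: s4_def units_def)
            qed
            moreover have "unit_sched I ((\<lambda>_. {})(m := {start_time I m}))"
              using unit_sched_upd[OF us mu, of "{start_time I m}"] st by (simp add: units_def)
            ultimately have "schedule_of I s4 = (\<lambda>i. if i = m then time_unit (start_time I m) else {})"
              by (simp add: schedule_of_marks Units_def fun_eq_iff)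
            moreover have "payments_of I s4 = (\<lambda>i. if i = m then budget I else 0)"
              using 3(3) p mu by (simp add: payments_of_def fun_eq_iff s4_def)
            ultimately have "(schedule_of I s4, payments_of I s4) \<in> mechanism I False"
              unfolding mechanism_def Let_def min using False st by (simp, blast)
            moreover have "int m \<noteq> 0" using Epos[OF m(1)] by linarith
            ultimately show ?thesis
              using k m(2) inputsD[OF 3(1)] off_okD[OF 3(2)] mu
              by (simp add: s4_def position_offset)
          qed
        qed
        done
    qed
    done
qed

text \<open>The longer branch adds the bounds 300, 100, 700 and 1800 of its four phases to a linear
  set-up, which stays below 4000. The facts \<open>m\<close> and \<open>m'\<close> lift the smaller
  products to \<open>nu * nu * la\<close>.\<close>

lemma runs_mechanism:
  assumes "loaded I coin s"
  shows "runs mechanism_com s (\<lambda>k s'. k \<le> 4000 * (nu * nu * la) \<and>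
    (schedule_of I s', payments_of I s') \<in> mechanism I coin)"
proof -
  have 0: "inputs I s" "ivar s ''coin'' = (if coin then 1 else 0)"
    using assms by (auto simp: loaded_def input_ok_def)
  have "1 * (nu * la) \<le> nu * (nu * la)" using num_users_pos by (rule mult_le_mono1)
  then have m: "nu * la \<le> nu * nu * la" by simp
  have "nu * nu * 1 \<le> nu * nu * la" using la_pos by (rule mult_le_mono2)
  then have m': "nu * nu \<le> nu * nu * la" by simp
  show ?thesis
    unfolding mechanism_com_def
    apply (simp only: runs_simps(6))
    apply (rule runs_conseq[OF runs_offsets[OF 0(1)]])
    subgoal premises p1 for k1 s1
    proof -
      have 1: "inputs I s1" "off_ok I (iarr s1 ''off'')" "ivar s1 ''coin'' = (if coin then 1 else 0)"
        using frameD[OF p1(2)] 0 p1(1) by simp_all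
      note [simp] = inputsD[OF 1(1)]
      show ?thesis
        apply (rule runs_conseq[OF runs_For[where B = "int nu + 1" and M = nu and K = 30 and
          Inv = "\<lambda>i s'. \<forall>l\<in>users I. int l < i \<longrightarrow> rarr s' ''p'' (int l) = 0"]])
        subgoal using users_less_1 by auto
        subgoal premises p for i s' using p(3,4) by auto
        subgoal premises p for s' using frameD[OF p] by simp
        subgoal by simp
        subgoal by simp
        subgoal by (rule num_users_pos)
        subgoal by simp
        subgoal premises p2 for k2 s2
        proof -
          have 2: "inputs I s2" "off_ok I (iarr s2 ''off'')" "ivar s2 ''coin'' = (if coin then 1 else 0)"
            "\<And>i. i \<in> users I \<Longrightarrow> rarr s2 ''p'' (int i) = 0"
            using frameD[OF p2(2)] 1 p2(1) users_less_past by simp_all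
          show ?thesis
          proof (cases coin)
            case False
            show ?thesis
              using 2(3) False apply simp
              apply (rule runs_mono[OF runs_single[OF 2(1,2,4)]])
               apply assumption
              using p1(1) p2(1) m prod_pos by linarith
          next
            case True
            have cells: "runs cells_com s2 (\<lambda>k s'. k \<le> 300 * (nu * nu * la) \<and> cid_ok I (iarr s' ''cid''))"
              by (rule runs_cells[OF 2(1,2)])
            show ?thesis
              using 2(3) True apply simp
              apply (rule runs_conseq[OF cells])
              subgoal premises p3 for k3 s3
              proof -
                have 3: "inputs I s3" "off_ok I (iarr s3 ''off'')" "cid_ok I (iarr s3 ''cid'')"
                  "rarr s3 ''p'' = rarr s2 ''p''"
                  using frameD[OF p3(4)] 2 p3(3) by simp_all
                show ?thesis
                  apply (rule runs_conseq[OF runs_ranks[OF 3(1)]])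
                  subgoal premises p4 for k4 s4
                  proof -
                    have 4: "env I s4" "rarr s4 ''p'' = rarr s2 ''p''"
                      using frameD[OF p4(2)] 3 p4(1) by simp_all
                    show ?thesis
                      apply (rule runs_conseq[OF runs_approx[OF 4(1)]])
                      subgoal premises p5 for k5 s5
                      proof -
                        let ?W = "snd (approx_mcs I)"
                        obtain D where D: "fst (approx_mcs I) = (\<lambda>i. Units (D i))" "sched_wf I D ?W"
                          "marks_ok I D (iarr s5 ''y'')" "wins_ok ?W (ivar s5 ''h'') (iarr s5 ''W'')"
                          using p5(1) by blast
                        have 5: "env I s5" "\<And>i. i \<in> users I \<Longrightarrow> rarr s5 ''p'' (int i) = 0"
                          using frameD[OF p5(2)] 4 2(4) by simp_all
                        show ?thesis
                          apply (rule runs_conseq[OF runs_payments[OF 5(1) D(2,4,3) 5(2)]])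
                           apply assumption
                          subgoal premises p6 for k6 s6
                          proof -
                            have "iarr s6 ''y'' = iarr s5 ''y''" using frameD[OF p6(2)] by simp
                            then have "schedule_of I s6 = fst (approx_mcs I)"
                              using schedule_of_marks[of D s6] D by (simp add: sched_wf_def)
                            moreover have "payments_of I s6 = (\<lambda>i. if i \<in> set ?W
                              then cal_payment I (fst (approx_mcs I)) (takeWhile (\<lambda>l. l \<noteq> i) ?W) i else 0)"
                              using p6(1) D(2) unfolding D(1)
                              by (intro ext) (auto simp: payments_of_def sched_wf_def)
                            ultimately have "(schedule_of I s6, payments_of I s6) \<in> mechanism I coin"
                              using True by (simp add: mechanism_def case_prod_beta)
                            moreover have "k1 + k2 + k3 + k4 + k5 + k6 + 30 \<le> 4000 * (nu * nu * la)"
                              using p1(1) p2(1) p3(3) p4(1) p5(1) p6(1) m m' prod_pos by linarith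
                            ultimately show ?thesis using True by (simp add: add.assoc)
                          qed
                          done
                      qed
                      done
                  qed
                  done
              qed
              done
          qed
        qed
        done
    qed
    done
qed

end

theorem theorem8:
  fixes lam :: int
  shows "\<exists>T :: nat \<Rightarrow> real. T \<in> O(\<lambda>n. real n ^ 2) \<and>
    (\<forall>I st. \<forall>coin \<in> set_pmf fair_coin. valid_mcs lam I \<longrightarrow> loaded I coin st \<longrightarrow>
       (\<exists>steps st'. (mechanism_com, st) \<Rightarrow> steps \<Down> st' \<and>
          real steps \<le> T (num_users I) \<and>
          (schedule_of I st', payments_of I st') \<in> mechanism I coin))"
proof (rule exI[of _ "\<lambda>n. real (4000 * nat lam) * real n ^ 2"], intro conjI allI ballI impI)
  \<comment> \<open>\<open>lam\<close> is fixed before the bound is chosen and may enter its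
    constant; tasks, values, budget and coin do not.\<close>
  let ?T = "\<lambda>n. real (4000 * nat lam) * real n ^ 2"
  show "?T \<in> O(\<lambda>n. real n ^ 2)" by simp
  fix I st coin
  assume v: "valid_mcs lam I" and l: "loaded I coin st"
  interpret market lam I by standard (fact v)
  obtain steps st' where *: "(mechanism_com, st) \<Rightarrow> steps \<Down> st'" "steps \<le> 4000 * (nu * nu * la)"
    "(schedule_of I st', payments_of I st') \<in> mechanism I coin"
    using runs_mechanism[OF l] unfolding runs_def by blast
  have "real steps \<le> real (4000 * (nu * nu * la))" using *(2) by (simp only: of_nat_le_iff)
  also have "\<dots> = ?T nu" by (simp add: power2_eq_square)
  finally show "\<exists>steps st'. (mechanism_com, st) \<Rightarrow> steps \<Down> st' \<and> real steps \<le> ?T (num_users I) \<and>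
      (schedule_of I st', payments_of I st') \<in> mechanism I coin"
    using * by blast
qed

end
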